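(* Fix $n\ge 2$. Then $$d_{GH}\Bigl(\bigl(\operatorname{PureUCP}(\mathcal T_d,M_n),\rho_{d,n}\bigr),\ \bigl(\operatorname{UCP}(C(\mathbb T),M_n),\rho_n\bigr)\Bigr)\longrightarrow 0\qquad\text{as } d\to\infty,$$ where $d_{GH}$ denotes the Gromov--Hausdorff distance.
   Context: $\mathbb T$ is the unit circle, $M_n=M_n(\mathbb C)$, $C(\mathbb T)$ is the space of continuous complex-valued functions on $\mathbb T$. $\mathcal T_d\subseteq M_d$ is the operator system of all $d\times d$ Toeplitz matrices $[a_{i-j}]_{i,j=0}^{d-1}$, $a_k\in\mathbb C$. CP (UCP) means (unital) completely positive; $\operatorname{UCP}(\mathcal S,M_n)$ is the set of all UCP maps from an operator system $\mathcal S$ to $M_n$. For CP maps $\psi,\varphi:\mathcal T_d\to M_n$ write $\psi\le_{\mathrm{cp}}\varphi$ if $\varphi-\psi$ is CP. A nonzero CP map $\varphi$ is pure if every CP map $\psi\le_{\mathrm{cp}}\varphi$ is of the form $\psi=t\varphi$ for some $t\in[0,1]$. $\operatorname{PureUCP}(\mathcal T_d,M_n)$ is the set of pure UCP maps $\mathcal T_d\to M_n$. Matricial Connes distance: for $\varphi,\psi\in\operatorname{UCP}(\mathcal T_d,M_n)$, $$\rho_{d,n}(\varphi,\psi)=\sup\{\|\varphi(T)-\psi(T)\|:\ T\in\mathcal T_d,\ \|[D_d,T]\|\le 1\},$$ where $D_d=\operatorname{diag}(1,\ldots,d)$, $[D_d,T]=D_dT-TD_d$, and norms are operator norms. Matricial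 Monge--Kantorovich distance: for $\varphi,\psi\in\operatorname{UCP}(C(\mathbb T),M_n)$, $$\rho_n(\varphi,\psi)=\sup\{\|\varphi(f)-\psi(f)\|:\ f\in C^1(\mathbb T),\ \|f'\|_\infty\le 1\},$$ where $C^1(\mathbb T)$ is the space of continuously differentiable complex-valued functions on $\mathbb T$ and $f'$ is the derivative of $t\mapsto f(e^{it})$ (so $\|f'\|_\infty=\|[D,M_f]\|$ for $D=-i\frac{d}{dt}$ on $L^2(\mathbb T)$ and $M_f$ the multiplication operator). *)

theory Defs
  imports
    "HOL-Analysis.Smooth_Paths"
    "HOL-Analysis.Abstract_Metric_Spaces"
    "HOL-Library.Extended_Nonnegative_Real"
    "Jordan_Normal_Form.Matrix"
begin

section \<open>Matrices as operators\<close>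

definition vec_norm2 :: "complex vec \<Rightarrow> real" where
  "vec_norm2 v = sqrt (Re (v \<bullet>c v))"

definition op_norm :: "complex mat \<Rightarrow> real" where
  "op_norm A =
     (SUP v \<in> {v \<in> carrier_vec (dim_col A). vec_norm2 v \<le> 1}. vec_norm2 (A *\<^sub>v v))"

text \<open>
  The order on complex numbers is the one where \<open>0 \<le> z\<close> means that \<open>z\<close> is real and nonnegative.
\<close>

definition psd :: "complex mat \<Rightarrow> bool" where
  "psd A \<longleftrightarrow> square_mat A \<and> (\<forall>v \<in> carrier_vec (dim_row A). 0 \<le> (A *\<^sub>v v) \<bullet>c v)"

text \<open>
  A \<open>k \<times> k\<close> array of \<open>m \<times> m\<close> matrices, flattened under the identification of
  \<open>M\<^sub>k(M\<^sub>m)\<close> with \<open>M\<^bsub>km\<^esub>\<close>. Only the entries \<open>X i j\<close> with \<open>i, j < k\<close> matter.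
\<close>

definition block_mat :: "nat \<Rightarrow> nat \<Rightarrow> (nat \<Rightarrow> nat \<Rightarrow> complex mat) \<Rightarrow> complex mat" where
  "block_mat k m X =
     Matrix.mat (k * m) (k * m) (\<lambda>(r, c). X (r div m) (c div m) $$ (r mod m, c mod m))"


section \<open>Operator systems and completely positive maps\<close>

text \<open>
  The data of an operator system that enter the definition of (unital) completely positive maps
  into \<open>M\<^sub>n\<close>. The predicate \<open>os_pos S k\<close> is the positive cone of \<open>M\<^sub>k(S)\<close>, whose elements are
  given by their entries with indices below \<open>k\<close>.
\<close>

record 'a op_system =
  os_carrier :: "'a set"
  os_add :: "'a \<Rightarrow> 'a \<Rightarrow> 'a"
  os_scale :: "complex \<Rightarrow> 'a \<Rightarrow> 'a"
  os_unit :: 'a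
  os_pos :: "nat \<Rightarrow> (nat \<Rightarrow> nat \<Rightarrow> 'a) \<Rightarrow> bool"

definition os_linear :: "'a op_system \<Rightarrow> nat \<Rightarrow> ('a \<Rightarrow> complex mat) \<Rightarrow> bool" where
  "os_linear S n \<phi> \<longleftrightarrow>
     \<phi> \<in> os_carrier S \<rightarrow> carrier_mat n n \<and>
     (\<forall>x \<in> os_carrier S. \<forall>y \<in> os_carrier S. \<phi> (os_add S x y) = \<phi> x + \<phi> y) \<and>
     (\<forall>c. \<forall>x \<in> os_carrier S. \<phi> (os_scale S c x) = c \<cdot>\<^sub>m \<phi> x)"

definition completely_positive :: "'a op_system \<Rightarrow> nat \<Rightarrow> ('a \<Rightarrow> complex mat) \<Rightarrow> bool" where
  "completely_positive S n \<phi> \<longleftrightarrow>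
     os_linear S n \<phi> \<and>
     (\<forall>k X. (\<forall>i<k. \<forall>j<k. X i j \<in> os_carrier S) \<and> os_pos S k X \<longrightarrow>
        psd (block_mat k n (\<lambda>i j. \<phi> (X i j))))"

text \<open>
  Sets of maps consist of extensional functions, so that two maps are equal iff they agree on
  \<open>S\<close>.
\<close>

definition CP :: "'a op_system \<Rightarrow> nat \<Rightarrow> ('a \<Rightarrow> complex mat) set" where
  "CP S n = {\<phi> \<in> extensional (os_carrier S). completely_positive S n \<phi>}"

definition UCP :: "'a op_system \<Rightarrow> nat \<Rightarrow> ('a \<Rightarrow> complex mat) set" where
  "UCP S n = {\<phi> \<in> CP S n. \<phi> (os_unit S) = 1\<^sub>m n}"

definition cp_le ::
  "'a op_system \<Rightarrow> nat \<Rightarrow> ('a \<Rightarrow> complex mat) \<Rightarrow> ('a \<Rightarrow> complex mat) \<Rightarrow> bool" where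
  "cp_le S n \<psi> \<phi> \<longleftrightarrow> completely_positive S n (\<lambda>x. \<phi> x - \<psi> x)"

definition pure_cp :: "'a op_system \<Rightarrow> nat \<Rightarrow> ('a \<Rightarrow> complex mat) \<Rightarrow> bool" where
  "pure_cp S n \<phi> \<longleftrightarrow>
     \<phi> \<in> CP S n \<and>
     (\<exists>x \<in> os_carrier S. \<phi> x \<noteq> 0\<^sub>m n n) \<and>
     (\<forall>\<psi> \<in> CP S n. cp_le S n \<psi> \<phi> \<longrightarrow>
        (\<exists>t \<in> {0..1::real}. \<forall>x \<in> os_carrier S. \<psi> x = complex_of_real t \<cdot>\<^sub>m \<phi> x))"

definition PureUCP :: "'a op_system \<Rightarrow> nat \<Rightarrow> ('a \<Rightarrow> complex mat) set" where
  "PureUCP S n = {\<phi> \<in> UCP S n. pure_cp S n \<phi>}"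


section \<open>Toeplitz matrices\<close>

definition toeplitz_mats :: "nat \<Rightarrow> complex mat set" where
  "toeplitz_mats d =
     {Matrix.mat d d (\<lambda>(i, j). a (int i - int j)) | a :: int \<Rightarrow> complex. True}"

definition toeplitz_sys :: "nat \<Rightarrow> complex mat op_system" where
  "toeplitz_sys d =
     \<lparr> os_carrier = toeplitz_mats d,
       os_add = (+),
       os_scale = (\<cdot>\<^sub>m),
       os_unit = 1\<^sub>m d,
       os_pos = (\<lambda>k X. psd (block_mat k d X)) \<rparr>"

definition D_mat :: "nat \<Rightarrow> complex mat" where
  "D_mat d = mat_diag d (\<lambda>i. of_nat (i + 1))"

definition rho_toeplitz ::
  "nat \<Rightarrow> (complex mat \<Rightarrow> complex mat) \<Rightarrow> (complex mat \<Rightarrow> complex mat) \<Rightarrow> real" where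
  "rho_toeplitz d \<phi> \<psi> =
     (SUP T \<in> {T \<in> toeplitz_mats d. op_norm (D_mat d * T - T * D_mat d) \<le> 1}.
        op_norm (\<phi> T - \<psi> T))"


section \<open>Continuous functions on the circle\<close>

text \<open>
  A function on the circle is represented by its extension by zero to the plane. This
  representation is unique and compatible with pointwise operations.
\<close>

definition C_circle :: "(complex \<Rightarrow> complex) set" where
  "C_circle = {f. continuous_on (sphere 0 1) f \<and> (\<forall>z. z \<notin> sphere 0 1 \<longrightarrow> f z = 0)}"

definition circle_sys :: "(complex \<Rightarrow> complex) op_system" where
  "circle_sys =
     \<lparr> os_carrier = C_circle,
       os_add = (\<lambda>f g z. f z + g z),
       os_scale = (\<lambda>c f z. c * f z),
       os_unit = (\<lambda>z. if z \<in> sphere 0 1 then 1 else 0),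
       os_pos = (\<lambda>k F. \<forall>z \<in> sphere 0 1. psd (Matrix.mat k k (\<lambda>(i, j). F i j z))) \<rparr>"

definition C1_circle :: "(complex \<Rightarrow> complex) set" where
  "C1_circle = {f \<in> C_circle. (\<lambda>t. f (cis t)) C1_differentiable_on UNIV}"

definition circle_deriv :: "(complex \<Rightarrow> complex) \<Rightarrow> real \<Rightarrow> complex" where
  "circle_deriv f t = vector_derivative (\<lambda>s. f (cis s)) (at t)"

definition rho_circle ::
  "((complex \<Rightarrow> complex) \<Rightarrow> complex mat) \<Rightarrow> ((complex \<Rightarrow> complex) \<Rightarrow> complex mat) \<Rightarrow> real" where
  "rho_circle \<phi> \<psi> =
     (SUP f \<in> {f \<in> C1_circle. \<forall>t. cmod (circle_deriv f t) \<le> 1}. op_norm (\<phi> f - \<psi> f))"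


section \<open>Gromov--Hausdorff distance\<close>

definition hausdorff_dist :: "('a \<Rightarrow> 'a \<Rightarrow> real) \<Rightarrow> 'a set \<Rightarrow> 'a set \<Rightarrow> ennreal" where
  "hausdorff_dist \<delta> A B =
     max (SUP a \<in> A. INF b \<in> B. ennreal (\<delta> a b)) (SUP b \<in> B. INF a \<in> A. ennreal (\<delta> a b))"

definition isometric_embedding ::
  "'a set \<Rightarrow> ('a \<Rightarrow> 'a \<Rightarrow> real) \<Rightarrow> 'b set \<Rightarrow> ('b \<Rightarrow> 'b \<Rightarrow> real) \<Rightarrow> ('a \<Rightarrow> 'b) \<Rightarrow> bool" where
  "isometric_embedding X dX Z \<delta> f \<longleftrightarrow>
     f \<in> X \<rightarrow> Z \<and> (\<forall>x \<in> X. \<forall>y \<in> X. \<delta> (f x) (f y) = dX x y)"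

text \<open>
  The infimum of the Hausdorff distances between isometric copies of \<open>X\<close> and \<open>Y\<close> in a common
  metric space \<open>Z\<close>. Letting \<open>Z\<close> range over subsets of the type \<open>'a + 'b\<close> is no restriction:
  \<open>Z\<close> can be replaced by the union of the two copies, which has at most the cardinality of the
  disjoint union of \<open>X\<close> and \<open>Y\<close>.
\<close>

definition GH_dist ::
  "'a set \<Rightarrow> ('a \<Rightarrow> 'a \<Rightarrow> real) \<Rightarrow> 'b set \<Rightarrow> ('b \<Rightarrow> 'b \<Rightarrow> real) \<Rightarrow> ennreal" where
  "GH_dist X dX Y dY =
     Inf {hausdorff_dist \<delta> (f ` X) (g ` Y) | (Z :: ('a + 'b) set) \<delta> f g.
            Metric_space Z \<delta> \<and>
            isometric_embedding X dX Z \<delta> f \<and> isometric_embedding Y dY Z \<delta> g}"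

end

theory Submission
  imports Defs "HOL-Computational_Algebra.Fundamental_Theorem_Algebra"
begin

text \<open>
  Pulling back along the compression \<open>f \<mapsto> T\<^sub>f\<close> is almost isometric, because \<open>T \<mapsto> e\<^sub>z\<^sup>* T e\<^sub>z / d\<close> with
  \<open>e\<^sub>z = (1, z, \<dots>, z\<^bsup>d-1\<^esup>)\<close> nearly inverts it and both maps are compatible with the
  derivations up to a vanishing error. For density, a UCP map on \<open>C(\<T>)\<close> is discretized by a Fejer
  partition of unity and Cholesky factorization to \<open>f \<mapsto> \<Sum>\<^sub>j f(w\<^sub>j) v\<^sub>j v\<^sub>j\<^sup>*\<close> with a fixed
  number of \<open>d\<close>-th roots of unity \<open>w\<^sub>j\<close>. Since the \<open>e\<^bsub>w\<^sub>j\<^esub> / sqrt d\<close> are orthonormal,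
  \<open>V = \<Sum>\<^sub>j e\<^bsub>w\<^sub>j\<^esub> v\<^sub>j\<^sup>* / sqrt d\<close> is an isometry, and the off-diagonal terms of \<open>V\<^sup>* T V\<close>
  vanish as \<open>d \<rightarrow> \<infinity>\<close>. Finally \<open>T \<mapsto> V\<^sup>* T V\<close> is pure as soon as the \<open>n\<close> polynomials given by
  the columns of \<open>V\<close> have no common zero, including infinity; as \<open>n \<ge> 2\<close>, this holds after an
  arbitrarily small perturbation of \<open>V\<close>.
\<close>

section \<open>Sesquilinear forms\<close>

text \<open>No integral occurs: the circle is replaced by the \<open>N\<close>-th roots of unity
  with \<open>N = d ^ 4\<close>. Parseval and positivity are then exact for finite sums, and only
  the commutator estimate feels the grid, with an error of order \<open>d ^ 3 / N\<close>, that is,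
  1/d. The obstacle is that a bound on the commutator controls the numbers k a_k in l2, whereas the
  norm estimates use l1. Reading off one column and one row costs a factor sqrt d, and each later
  estimate brings a gain of 1/d to pay for it: the defect |k|/d of the Fejer weights, the Dirichlet
  kernel divided by d away from the diagonal, the relative error 32/d of the commutator. Hence the
  rate 1/sqrt d throughout. Contractivity of UCP maps is obtained from positivity of 2 x 2 blocks,
  for which \<open>form_bound\<close> is the matching notion of norm. The number M of sample points
  is fixed before d grows, since the off-diagonal terms are bounded by (M n)^3 / sqrt d up to a
  constant. For n = 1 the criterion for purity would ask a single polynomial of degree d - 1 to have
  no zeros; a second column is what makes it attainable.\<close>

definition sform ::
  "nat \<Rightarrow> (nat \<Rightarrow> nat \<Rightarrow> complex) \<Rightarrow> (nat \<Rightarrow> complex) \<Rightarrow> (nat \<Rightarrow> complex) \<Rightarrow> complex" where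
  "sform m F x y = (\<Sum>a<m. \<Sum>b<m. cnj (x a) * F a b * y b)"

definition nsq :: "nat \<Rightarrow> (nat \<Rightarrow> complex) \<Rightarrow> real" where
  "nsq m x = (\<Sum>a<m. (cmod (x a))\<^sup>2)"

abbreviation entries :: "complex mat \<Rightarrow> nat \<Rightarrow> nat \<Rightarrow> complex" where
  "entries A \<equiv> \<lambda>a b. A $$ (a, b)"

text \<open>
  By homogeneity and the inequality between arithmetic and geometric means this says that the
  operator norm of \<open>F\<close> is at most \<open>c\<close>; unlike a product of norms, the right-hand side is
  additive over orthogonal decompositions.
\<close>

definition form_bound :: "nat \<Rightarrow> (nat \<Rightarrow> nat \<Rightarrow> complex) \<Rightarrow> real \<Rightarrow> bool" where
  "form_bound m F c \<longleftrightarrow> (\<forall>x y. cmod (sform m F x y) \<le> c * (nsq m x + nsq m y) / 2)"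

lemma nsq_nonneg: "0 \<le> nsq m x"
  by (simp add: nsq_def sum_nonneg)

lemma nsq_eq: "complex_of_real (nsq m x) = (\<Sum>a<m. cnj (x a) * x a)"
  unfolding nsq_def by (simp add: complex_norm_square mult.commute del: of_real_power)

lemma nsq_scale: "nsq m (\<lambda>a. c * x a) = (cmod c)\<^sup>2 * nsq m x"
  by (simp add: nsq_def norm_mult power_mult_distrib sum_distrib_left)

lemma sform_cong:
  "(\<And>a b. a < m \<Longrightarrow> b < m \<Longrightarrow> F a b = G a b) \<Longrightarrow> (\<And>a. a < m \<Longrightarrow> x a = x' a) \<Longrightarrow>
   (\<And>a. a < m \<Longrightarrow> y a = y' a) \<Longrightarrow> sform m F x y = sform m G x' y'"
  unfolding sform_def by (intro sum.cong refl) auto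

lemma sform_add_left: "sform m F (\<lambda>a. x a + x' a) y = sform m F x y + sform m F x' y"
  by (simp add: sform_def algebra_simps sum.distrib)

lemma sform_add_right: "sform m F x (\<lambda>a. y a + y' a) = sform m F x y + sform m F x y'"
  by (simp add: sform_def algebra_simps sum.distrib)

lemma sform_scale_left: "sform m F (\<lambda>a. c * x a) y = cnj c * sform m F x y"
  by (simp add: sform_def sum_distrib_left mult_ac)

lemma sform_scale_right: "sform m F x (\<lambda>a. c * y a) = c * sform m F x y"
  by (simp add: sform_def sum_distrib_left mult_ac)

lemma sform_add: "sform m (\<lambda>a b. F a b + G a b) x y = sform m F x y + sform m G x y"
  by (simp add: sform_def algebra_simps sum.distrib)

lemma sform_diff: "sform m (\<lambda>a b. F a b - G a b) x y = sform m F x y - sform m G x y"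
  by (simp add: sform_def algebra_simps sum_subtractf)

lemma sform_scale: "sform m (\<lambda>a b. c * F a b) x y = c * sform m F x y"
  by (simp add: sform_def sum_distrib_left mult_ac)

lemma sform_sum: "sform m (\<lambda>a b. \<Sum>i\<in>I. F i a b) x y = (\<Sum>i\<in>I. sform m (F i) x y)"
proof -
  have "sform m (\<lambda>a b. \<Sum>i\<in>I. F i a b) x y =
    (\<Sum>a<m. \<Sum>b<m. \<Sum>i\<in>I. cnj (x a) * F i a b * y b)"
    by (simp add: sform_def sum_distrib_left sum_distrib_right)
  also have "\<dots> = (\<Sum>a<m. \<Sum>i\<in>I. \<Sum>b<m. cnj (x a) * F i a b * y b)"
    by (intro sum.cong refl sum.swap)
  also have "\<dots> = (\<Sum>i\<in>I. sform m (F i) x y)"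
    unfolding sform_def by (rule sum.swap)
  finally show ?thesis .
qed

lemma sform_rank1:
  "sform m (\<lambda>a b. u a * cnj (v b)) x y =
   cnj (\<Sum>a<m. cnj (u a) * x a) * (\<Sum>b<m. cnj (v b) * y b)"
  unfolding sform_def sum_product cnj_sum
  by (intro sum.cong refl) (simp add: mult_ac)

lemma sform_one: "sform m (\<lambda>a b. if a = b then c else 0) x y = c * (\<Sum>a<m. cnj (x a) * y a)"
proof -
  have "sform m (\<lambda>a b. if a = b then c else 0) x y =
      (\<Sum>a<m. \<Sum>b<m. if b = a then c * (cnj (x a) * y b) else 0)"
    unfolding sform_def by (intro sum.cong refl) auto
  thus ?thesis by (simp add: sum_distrib_left)
qed

lemma sform_entries_one:
  "sform m (entries (1\<^sub>m m)) x y = (\<Sum>a<m. cnj (x a) * y a)"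
proof -
  have "sform m (entries (1\<^sub>m m)) x y = sform m (\<lambda>a b. if a = b then 1 else 0) x y"
    by (rule sform_cong) auto
  thus ?thesis by (simp add: sform_one)
qed

lemma two_mult_le_sum_squares: "2 * (a * b) \<le> a\<^sup>2 + (b::real)\<^sup>2"
  using sum_squares_bound[of a b] by (simp add: mult_ac)

lemma sum_cmod_mult_le:
  "(\<Sum>a<m. cmod (x a) * cmod (y a)) \<le> (nsq m x + nsq m y) / 2"
proof -
  have "(\<Sum>a<m. cmod (x a) * cmod (y a)) \<le> (\<Sum>a<m. ((cmod (x a))\<^sup>2 + (cmod (y a))\<^sup>2) / 2)"
  proof (rule sum_mono)
    fix a
    show "cmod (x a) * cmod (y a) \<le> ((cmod (x a))\<^sup>2 + (cmod (y a))\<^sup>2) / 2"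
      using two_mult_le_sum_squares[of "cmod (x a)" "cmod (y a)"] by simp
  qed
  thus ?thesis by (simp add: nsq_def sum.distrib sum_divide_distrib[symmetric])
qed

lemma form_bound_mono: "form_bound m F c \<Longrightarrow> c \<le> c' \<Longrightarrow> form_bound m F c'"
  unfolding form_bound_def
  by (meson add_nonneg_nonneg divide_right_mono mult_right_mono nsq_nonneg order_trans
      zero_le_numeral)

lemma form_bound_cong:
  "(\<And>a b. a < m \<Longrightarrow> b < m \<Longrightarrow> F a b = G a b) \<Longrightarrow> form_bound m F c \<Longrightarrow> form_bound m G c"
  unfolding form_bound_def using sform_cong[of m F G] by simp

lemma form_bound_add:
  "form_bound m F c \<Longrightarrow> form_bound m G c' \<Longrightarrow> form_bound m (\<lambda>a b. F a b + G a b) (c + c')"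
  unfolding form_bound_def sform_add
  by (auto simp: distrib_right add_divide_distrib intro!: norm_triangle_le add_mono)

lemma form_bound_scale:
  assumes "form_bound m F c" shows "form_bound m (\<lambda>a b. k * F a b) (cmod k * c)"
  unfolding form_bound_def sform_scale norm_mult
proof (intro allI)
  fix x y
  have "cmod k * cmod (sform m F x y) \<le> cmod k * (c * (nsq m x + nsq m y) / 2)"
    using assms by (intro mult_left_mono) (auto simp: form_bound_def)
  thus "cmod k * cmod (sform m F x y) \<le> cmod k * c * (nsq m x + nsq m y) / 2"
    by (simp add: mult_ac)
qed

lemma form_bound_sum:
  assumes "\<And>i. i \<in> I \<Longrightarrow> form_bound m (F i) (c i)"
  shows "form_bound m (\<lambda>a b. \<Sum>i\<in>I. F i a b) (\<Sum>i\<in>I. c i)"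
  unfolding form_bound_def sform_sum
proof (intro allI)
  fix x y
  have "cmod (\<Sum>i\<in>I. sform m (F i) x y) \<le> (\<Sum>i\<in>I. cmod (sform m (F i) x y))"
    by (rule norm_sum)
  also have "\<dots> \<le> (\<Sum>i\<in>I. c i * (nsq m x + nsq m y) / 2)"
    using assms by (intro sum_mono) (auto simp: form_bound_def)
  finally show "cmod (\<Sum>i\<in>I. sform m (F i) x y) \<le> (\<Sum>i\<in>I. c i) * (nsq m x + nsq m y) / 2"
    by (simp add: sum_distrib_right sum_divide_distrib)
qed

lemma form_bound_nonneg:
  assumes "form_bound m F c" "0 < m" shows "0 \<le> c"
proof -
  let ?x = "\<lambda>a. if a = 0 then 1 else (0::complex)"
  have "nsq m ?x = (\<Sum>a<m. if a = 0 then 1 else (0::real))"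
    unfolding nsq_def by (intro sum.cong) auto
  hence "nsq m ?x = 1" using assms(2) by simp
  moreover have "0 \<le> c * (nsq m ?x + nsq m ?x) / 2"
    using assms(1) unfolding form_bound_def by (meson norm_ge_zero order_trans)
  ultimately show ?thesis by simp
qed

text \<open>The mean inequality is applied to each product \<open>cmod (x a) * cmod (y b)\<close>;
  summing over the other index costs the factor \<open>m\<close>. Crude, but used only for fixed
  \<open>m\<close> or for entries that are very small.\<close>

lemma form_bound_entries:
  assumes "\<And>a b. a < m \<Longrightarrow> b < m \<Longrightarrow> cmod (F a b) \<le> e"
  shows "form_bound m F (of_nat m * e)"
  unfolding form_bound_def
proof (intro allI)
  fix x y
  have "cmod (sform m F x y) \<le> (\<Sum>a<m. \<Sum>b<m. cmod (cnj (x a) * F a b * y b))"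
    unfolding sform_def by (intro order_trans[OF norm_sum] sum_mono norm_sum)
  also have "\<dots> \<le> (\<Sum>a<m. \<Sum>b<m. e * (((cmod (x a))\<^sup>2 + (cmod (y b))\<^sup>2) / 2))"
  proof (intro sum_mono)
    fix a b assume "a \<in> {..<m}" "b \<in> {..<m}"
    hence "cmod (F a b) \<le> e" using assms by simp
    moreover from this have "0 \<le> e" using norm_ge_zero order_trans by blast
    moreover have "cmod (x a) * cmod (y b) \<le> ((cmod (x a))\<^sup>2 + (cmod (y b))\<^sup>2) / 2"
      using two_mult_le_sum_squares[of "cmod (x a)" "cmod (y b)"] by simp
    ultimately have "cmod (F a b) * (cmod (x a) * cmod (y b)) \<le>
        e * (((cmod (x a))\<^sup>2 + (cmod (y b))\<^sup>2) / 2)"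
      by (intro mult_mono) auto
    thus "cmod (cnj (x a) * F a b * y b) \<le> e * (((cmod (x a))\<^sup>2 + (cmod (y b))\<^sup>2) / 2)"
      by (simp add: norm_mult mult_ac)
  qed
  also have "\<dots> = of_nat m * e * (nsq m x + nsq m y) / 2"
    unfolding nsq_def
    by (simp add: sum.distrib sum_distrib_left[symmetric] sum_divide_distrib[symmetric]
        distrib_left)
  finally show "cmod (sform m F x y) \<le> of_nat m * e * (nsq m x + nsq m y) / 2" .
qed

section \<open>Operator norm and positivity of matrices in terms of forms\<close>

lemma inner_self:
  assumes "v \<in> carrier_vec m" shows "v \<bullet>c v = complex_of_real (nsq m (vec_index v))"
  unfolding nsq_eq using assms
  by (auto simp: scalar_prod_def atLeast0LessThan mult.commute intro!: sum.cong)

lemma vec_norm2_sq: "v \<in> carrier_vec m \<Longrightarrow> (vec_norm2 v)\<^sup>2 = nsq m (vec_index v)"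
  by (simp add: vec_norm2_def inner_self nsq_nonneg)

lemma vec_norm2_nonneg: "v \<in> carrier_vec m \<Longrightarrow> 0 \<le> vec_norm2 v"
  by (simp add: vec_norm2_def inner_self nsq_nonneg)

lemma mult_mat_vec_inner:
  assumes "A \<in> carrier_mat m m" "v \<in> carrier_vec m" "w \<in> carrier_vec m"
  shows "(A *\<^sub>v v) \<bullet>c w = sform m (entries A) (vec_index w) (vec_index v)"
proof -
  have "(A *\<^sub>v v) \<bullet>c w = (\<Sum>a<m. (\<Sum>b<m. A $$ (a,b) * v $ b) * cnj (w $ a))"
    using assms by (auto simp: scalar_prod_def atLeast0LessThan row_def intro!: sum.cong)
  thus ?thesis
    by (simp add: sform_def sum_distrib_left sum_distrib_right mult_ac)
qed

lemma psd_iff_sform: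
  assumes "A \<in> carrier_mat m m"
  shows "psd A \<longleftrightarrow> (\<forall>x. 0 \<le> sform m (entries A) x x)"
proof -
  have "psd A \<longleftrightarrow> (\<forall>v\<in>carrier_vec m. 0 \<le> sform m (entries A) (vec_index v) (vec_index v))"
    using assms mult_mat_vec_inner[OF assms] by (auto simp: psd_def)
  also have "\<dots> \<longleftrightarrow> (\<forall>x. 0 \<le> sform m (entries A) x x)"
  proof (intro iffI allI ballI)
    fix x assume *: "\<forall>v\<in>carrier_vec m. 0 \<le> sform m (entries A) (vec_index v) (vec_index v)"
    have "sform m (entries A) (vec_index (vec m x)) (vec_index (vec m x)) = sform m (entries A) x x"
      by (rule sform_cong) auto
    thus "0 \<le> sform m (entries A) x x" using * by (metis vec_carrier)
  qed auto
  finally show ?thesis .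
qed

lemma block_mat_carrier [simp]: "block_mat k m X \<in> carrier_mat (k * m) (k * m)"
  by (simp add: block_mat_def)

lemma sum_blocks:
  "(\<Sum>r<k * m. f r) = (\<Sum>i<k. \<Sum>a<m. f (i * m + a))" for f :: "nat \<Rightarrow> 'a :: comm_monoid_add"
proof -
  have "(\<Sum>r<k * m. f r) = (\<Sum>i<k. sum f {i * m..<i * m + m})"
    by (rule sum.nat_group[symmetric])
  also have "\<dots> = (\<Sum>i<k. \<Sum>a<m. f (i * m + a))"
  proof (rule sum.cong[OF refl])
    fix i
    show "sum f {i * m..<i * m + m} = (\<Sum>a<m. f (i * m + a))"
      using sum.shift_bounds_nat_ivl[of f 0 "i * m" m]
      by (simp add: atLeast0LessThan add.commute)
  qed
  finally show ?thesis .
qed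

lemma psd_block_mat_iff:
  "psd (block_mat k m X) \<longleftrightarrow>
   (\<forall>x. 0 \<le> (\<Sum>i<k. \<Sum>j<k. sform m (entries (X i j)) (x i) (x j)))"
proof -
  have eq: "sform (k * m) (entries (block_mat k m X)) y y =
      (\<Sum>i<k. \<Sum>j<k. sform m (entries (X i j)) (\<lambda>a. y (i * m + a)) (\<lambda>a. y (j * m + a)))" for y
  proof -
    have "sform (k * m) (entries (block_mat k m X)) y y =
      (\<Sum>i<k. \<Sum>a<m. \<Sum>j<k. \<Sum>b<m. cnj (y (i * m + a)) *
         entries (block_mat k m X) (i * m + a) (j * m + b) * y (j * m + b))"
      unfolding sform_def sum_blocks ..
    also have "\<dots> = (\<Sum>i<k. \<Sum>a<m. \<Sum>j<k. \<Sum>b<m. cnj (y (i * m + a)) *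
         X i j $$ (a, b) * y (j * m + b))"
    proof (intro sum.cong refl)
      fix i a j b assume "i \<in> {..<k}" "a \<in> {..<m}" "j \<in> {..<k}" "b \<in> {..<m}"
      moreover have "i * m + a < k * m" if "i < k" "a < m" for i a
      proof -
        have "i * m + a < Suc i * m" using that by simp
        also have "\<dots> \<le> k * m" using that by (intro mult_le_mono1) simp
        finally show ?thesis .
      qed
      ultimately show "cnj (y (i * m + a)) * entries (block_mat k m X) (i * m + a) (j * m + b) *
          y (j * m + b) = cnj (y (i * m + a)) * X i j $$ (a, b) * y (j * m + b)"
        by (simp add: block_mat_def)
    qed
    also have "\<dots> = (\<Sum>i<k. \<Sum>j<k. \<Sum>a<m. \<Sum>b<m. cnj (y (i * m + a)) *
         X i j $$ (a, b) * y (j * m + b))"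
      by (intro sum.cong refl sum.swap)
    finally show ?thesis by (simp add: sform_def)
  qed
  show ?thesis
    unfolding psd_iff_sform[OF block_mat_carrier] eq
  proof safe
    fix x
    assume *: "\<forall>y. 0 \<le> (\<Sum>i<k. \<Sum>j<k.
      sform m (entries (X i j)) (\<lambda>a. y (i * m + a)) (\<lambda>a. y (j * m + a)))"
    let ?y = "\<lambda>r. x (r div m) (r mod m) :: complex"
    have "(\<Sum>i<k. \<Sum>j<k. sform m (entries (X i j)) (\<lambda>a. ?y (i * m + a)) (\<lambda>a. ?y (j * m + a))) =
      (\<Sum>i<k. \<Sum>j<k. sform m (entries (X i j)) (x i) (x j))"
      by (intro sum.cong refl sform_cong) auto
    thus "0 \<le> (\<Sum>i<k. \<Sum>j<k. sform m (entries (X i j)) (x i) (x j))"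
      using *[rule_format, of ?y] by simp
  qed auto
qed

text \<open>The form is tested on \<open>w = A v\<close>, scaled to length one, against
  \<open>v\<close>: its value is then the length of \<open>w\<close>, while the mean in
  \<open>form_bound\<close> is at most 1.\<close>

lemma op_norm_bdd_above:
  assumes "A \<in> carrier_mat m m" "form_bound m (entries A) c" "0 \<le> c"
    "v \<in> carrier_vec m" "vec_norm2 v \<le> 1"
  shows "vec_norm2 (A *\<^sub>v v) \<le> c"
proof -
  define w where "w = A *\<^sub>v v"
  have w: "w \<in> carrier_vec m" using assms by (simp add: w_def)
  define S where "S = nsq m (vec_index w)"
  have "complex_of_real S = w \<bullet>c w" using inner_self[OF w] by (simp add: S_def)
  also have "\<dots> = sform m (entries A) (vec_index w) (vec_index v)"
    using mult_mat_vec_inner[OF assms(1,4) w] by (simp add: w_def)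
  finally have S: "complex_of_real S = sform m (entries A) (vec_index w) (vec_index v)" .
  have v: "nsq m (vec_index v) \<le> 1"
    using assms(5) vec_norm2_nonneg[OF assms(4)] unfolding vec_norm2_sq[OF assms(4), symmetric]
    by (simp add: power_le_one)
  have "S \<le> c\<^sup>2"
  proof (cases "S = 0")
    case False
    hence "0 < S" using nsq_nonneg[of m "vec_index w"] unfolding S_def by linarith
    hence s: "0 < sqrt S" "S = sqrt S * sqrt S" by auto
    define k where "k = complex_of_real (1 / sqrt S)"
    have k: "(cmod k)\<^sup>2 * S = 1"
      using \<open>0 < S\<close> by (simp add: k_def power_divide norm_divide)
    have "cmod (sform m (entries A) (\<lambda>a. k * w $ a) (vec_index v)) \<le> c * (1 + 1) / 2"
    proof -
      have "cmod (sform m (entries A) (\<lambda>a. k * w $ a) (vec_index v))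
         \<le> c * (nsq m (\<lambda>a. k * w $ a) + nsq m (vec_index v)) / 2"
        using assms(2) by (simp add: form_bound_def)
      also have "\<dots> \<le> c * (1 + 1) / 2"
        using v k assms(3) by (intro divide_right_mono mult_left_mono add_mono)
          (auto simp: nsq_scale S_def)
      finally show ?thesis .
    qed
    moreover have "cmod (sform m (entries A) (\<lambda>a. k * w $ a) (vec_index v)) = S / sqrt S"
      using \<open>0 < S\<close> unfolding sform_scale_left S[symmetric] by (simp add: k_def norm_mult norm_divide)
    moreover have "S / sqrt S = sqrt S" using s by (metis nonzero_eq_divide_eq less_irrefl)
    ultimately have "sqrt S \<le> c" by simp
    hence "(sqrt S)\<^sup>2 \<le> c\<^sup>2" using s(1) by (intro power_mono) auto
    thus ?thesis using \<open>0 < S\<close> by simp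
  qed auto
  hence "(vec_norm2 w)\<^sup>2 \<le> c\<^sup>2" by (simp add: vec_norm2_sq[OF w] S_def)
  thus ?thesis using assms(3) by (simp add: w_def power2_le_iff_abs_le)
qed

lemma op_norm_le:
  assumes "A \<in> carrier_mat m m" "form_bound m (entries A) c" "0 \<le> c"
  shows "op_norm A \<le> c"
proof -
  have "vec_norm2 (0\<^sub>v m) \<le> 1"
    using vec_norm2_sq[of "0\<^sub>v m" m] by (simp add: nsq_def)
  hence "{v \<in> carrier_vec (dim_col A). vec_norm2 v \<le> 1} \<noteq> {}"
    using assms(1) by (metis (mono_tags, lifting) carrier_matD(2) empty_Collect_eq zero_carrier_vec)
  thus ?thesis unfolding op_norm_def
    using assms op_norm_bdd_above[OF assms] by (intro cSUP_least) auto
qed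

lemma form_bound_op_norm:
  assumes A: "A \<in> carrier_mat m m"
  shows "form_bound m (entries A) (op_norm A)"
  unfolding form_bound_def
proof (intro allI)
  fix x y :: "nat \<Rightarrow> complex"
  \<comment> \<open>A crude bound by the entries; a real supremum is informative only for a set
    known to be bounded above.\<close>
  define e where "e = (\<Sum>a<m. \<Sum>b<m. cmod (A $$ (a, b)))"
  have "cmod (A $$ (a, b)) \<le> e" if "a < m" "b < m" for a b
  proof -
    have "cmod (A $$ (a, b)) \<le> (\<Sum>b<m. cmod (A $$ (a, b)))"
      using that by (intro member_le_sum) auto
    also have "\<dots> \<le> e"
      unfolding e_def using that by (intro member_le_sum) (auto intro: sum_nonneg)
    finally show ?thesis .
  qed
  hence fb: "form_bound m (entries A) (of_nat m * e)" by (rule form_bound_entries)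
  have "0 \<le> e" by (auto simp: e_def intro!: sum_nonneg)
  hence bdd: "bdd_above (vec_norm2 ` ((*\<^sub>v) A ` {v \<in> carrier_vec m. vec_norm2 v \<le> 1}))"
    using op_norm_bdd_above[OF A fb] by (intro bdd_aboveI2[of _ _ "of_nat m * e"]) auto
  have upper: "vec_norm2 (A *\<^sub>v v) \<le> op_norm A" if "v \<in> carrier_vec m" "vec_norm2 v \<le> 1" for v
    unfolding op_norm_def using A bdd that
    by (intro cSUP_upper) (auto simp: image_image)
  have le: "nsq m (vec_index (A *\<^sub>v v)) \<le> (op_norm A)\<^sup>2 * nsq m (vec_index v)"
    if v: "v \<in> carrier_vec m" for v
  proof (cases "nsq m (vec_index v) = 0")
    case True
    hence "v $ a = 0" if "a < m" for a
      using that by (auto simp: nsq_def sum_nonneg_eq_0_iff)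
    hence "v = 0\<^sub>v m" using v by auto
    hence "A *\<^sub>v v = 0\<^sub>v m" using A by auto
    hence "nsq m (vec_index (A *\<^sub>v v)) = 0" by (simp add: nsq_def)
    thus ?thesis by (simp add: nsq_nonneg)
  next
    case False
    define s where "s = nsq m (vec_index v)"
    have s: "0 < s" using False nsq_nonneg[of m "vec_index v"] by (simp add: s_def)
    define k where "k = complex_of_real (1 / sqrt s)"
    have k: "(cmod k)\<^sup>2 = 1 / s" using s by (simp add: k_def power_divide norm_divide)
    have kv: "k \<cdot>\<^sub>v v \<in> carrier_vec m" using v by simp
    have sc: "nsq m (vec_index (k \<cdot>\<^sub>v u)) = (cmod k)\<^sup>2 * nsq m (vec_index u)"
      if "u \<in> carrier_vec m" for u
      unfolding nsq_scale[symmetric] using that by (auto simp: nsq_def intro!: sum.cong)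
    have "(vec_norm2 (k \<cdot>\<^sub>v v))\<^sup>2 = 1"
      unfolding vec_norm2_sq[OF kv] sc[OF v] k using s by (simp add: s_def)
    hence "vec_norm2 (k \<cdot>\<^sub>v v) \<le> 1" using power2_le_imp_le[of "vec_norm2 (k \<cdot>\<^sub>v v)" 1] by simp
    hence "vec_norm2 (A *\<^sub>v (k \<cdot>\<^sub>v v)) \<le> op_norm A" by (intro upper kv)
    hence "(vec_norm2 (A *\<^sub>v (k \<cdot>\<^sub>v v)))\<^sup>2 \<le> (op_norm A)\<^sup>2"
      using A v by (intro power_mono vec_norm2_nonneg[of _ m]) auto
    moreover have "A *\<^sub>v (k \<cdot>\<^sub>v v) = k \<cdot>\<^sub>v (A *\<^sub>v v)" using A v by auto
    moreover have "A *\<^sub>v v \<in> carrier_vec m" using A v by simp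
    ultimately have "nsq m (vec_index (A *\<^sub>v v)) / s \<le> (op_norm A)\<^sup>2"
      using sc[of "A *\<^sub>v v"] k vec_norm2_sq[of "k \<cdot>\<^sub>v (A *\<^sub>v v)" m] by simp
    thus ?thesis using s by (simp add: s_def field_simps)
  qed
  define v where "v = Matrix.vec m y"
  have v: "v \<in> carrier_vec m" by (simp add: v_def)
  define w where "w = vec_index (A *\<^sub>v v)"
  define c where "c = op_norm A"
  have nv: "nsq m (vec_index v) = nsq m y" by (simp add: v_def nsq_def)
  have c: "0 \<le> c"
    using upper[of "0\<^sub>v m"] vec_norm2_nonneg[of "A *\<^sub>v 0\<^sub>v m" m] A vec_norm2_sq[of "0\<^sub>v m" m]
    by (auto simp: c_def nsq_def)
  have w: "nsq m w \<le> c\<^sup>2 * nsq m y" using le[OF v] nv by (simp add: w_def c_def)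
  have "w a = (\<Sum>b<m. A $$ (a, b) * y b)" if "a < m" for a
    using A that by (auto simp: w_def v_def scalar_prod_def atLeast0LessThan intro!: sum.cong)
  hence "sform m (entries A) x y = (\<Sum>a<m. cnj (x a) * w a)"
    by (simp add: sform_def sum_distrib_left mult.assoc)
  hence sf: "cmod (sform m (entries A) x y) \<le> (\<Sum>a<m. cmod (x a) * cmod (w a))"
    by (auto simp: norm_mult intro!: order_trans[OF norm_sum])
  show "cmod (sform m (entries A) x y) \<le> op_norm A * (nsq m x + nsq m y) / 2"
  proof (cases "c = 0")
    case True
    hence "nsq m w = 0" using w nsq_nonneg[of m w] by simp
    hence "(\<Sum>a<m. cmod (x a) * cmod (w a)) = 0"
      by (auto simp: nsq_def sum_nonneg_eq_0_iff)
    thus ?thesis using sf True by (simp add: c_def)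
  next
    case False
    hence "0 < c" using c by simp
    \<comment> \<open>Dividing \<open>w\<close> by \<open>c\<close> first makes its square norm at
      most that of \<open>y\<close>, so that the mean inequality produces exactly the mean in
      \<open>form_bound\<close>.\<close>
    have "(\<Sum>a<m. cmod (x a) * cmod (w a)) =
        c * (\<Sum>a<m. cmod (x a) * cmod (of_real (1 / c) * w a))"
      using \<open>0 < c\<close> by (simp add: sum_distrib_left norm_mult norm_divide)
    also have "\<dots> \<le> c * ((nsq m x + nsq m (\<lambda>a. of_real (1 / c) * w a)) / 2)"
      using c by (intro mult_left_mono sum_cmod_mult_le)
    also have "nsq m (\<lambda>a. of_real (1 / c) * w a) \<le> nsq m y"
      using w \<open>0 < c\<close> unfolding nsq_scale by (simp add: power_divide field_simps norm_divide)
    finally show ?thesis using sf \<open>0 < c\<close> by (simp add: c_def)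
  qed
qed

lemma op_norm_nonneg: "A \<in> carrier_mat m m \<Longrightarrow> 0 < m \<Longrightarrow> 0 \<le> op_norm A"
  using form_bound_op_norm form_bound_nonneg by blast

lemma op_norm_le_iff:
  assumes "A \<in> carrier_mat m m" "0 < m"
  shows "op_norm A \<le> c \<longleftrightarrow> form_bound m (entries A) c"
proof
  show "form_bound m (entries A) c" if "op_norm A \<le> c"
    using form_bound_mono[OF form_bound_op_norm[OF assms(1)] that] .
  show "op_norm A \<le> c" if "form_bound m (entries A) c"
    using op_norm_le[OF assms(1) that form_bound_nonneg[OF that assms(2)]] .
qed

section \<open>Positive forms: null vectors, rank-one bounds, factorization\<close>

definition psd_form :: "nat \<Rightarrow> (nat \<Rightarrow> nat \<Rightarrow> complex) \<Rightarrow> bool" where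
  "psd_form m F \<longleftrightarrow> (\<forall>x. 0 \<le> sform m F x x)"

lemma sform_expand:
  "sform m F (\<lambda>a. x a + k * y a) (\<lambda>a. x a + k * y a) =
   sform m F x x + k * sform m F x y + cnj k * sform m F y x
     + of_real ((cmod k)\<^sup>2) * sform m F y y"
  unfolding complex_norm_square sform_add_left sform_add_right sform_scale_left sform_scale_right
  by (simp add: algebra_simps)

text \<open>Polarization: the values at \<open>x + k y\<close> are real, and \<open>k = 1\<close>
  and \<open>k = \<i>\<close> determine the imaginary and the real part of the difference.\<close>

lemma psd_form_hermitian:
  assumes "psd_form m F" shows "sform m F y x = cnj (sform m F x y)"
proof -
  have im: "Im (sform m F z z) = 0" for z
    using assms by (simp add: psd_form_def less_eq_complex_def)
  have *: "Im (k * sform m F x y + cnj k * sform m F y x) = 0" for k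
    using im[of "\<lambda>a. x a + k * y a"] im[of x] im[of y] unfolding sform_expand by simp
  show ?thesis
    using *[of 1] *[of \<i>] by (simp add: complex_eq_iff)
qed

text \<open>The degenerate case of Cauchy-Schwarz: for a short move from \<open>x\<close> along
  \<open>y\<close> a nonzero linear term would outweigh the quadratic one and make the form
  negative.\<close>

lemma psd_form_null:
  assumes "psd_form m F" "sform m F x x = 0" shows "sform m F x y = 0"
proof (rule ccontr)
  define b where "b = sform m F x y"
  define q where "q = Re (sform m F y y)"
  assume "sform m F x y \<noteq> 0"
  hence "0 < cmod b" by (simp add: b_def)
  have q: "sform m F y y = of_real q" "0 \<le> q"
    using assms(1) by (auto simp: psd_form_def less_eq_complex_def q_def complex_eq_iff)
  \<comment> \<open>Small enough for the linear term to win: the value computed below is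
    \<open>t * (cmod b)\<^sup>2 * (t * q - 2)\<close>.\<close>
  define t where "t = 1 / (1 + q)"
  have t: "0 < t" "t * q < 1" using q by (auto simp: t_def field_simps)
  define k where "k = - (of_real t * cnj b)"
  have kb: "k * b = - of_real (t * (cmod b)\<^sup>2)"
    unfolding k_def by (simp add: complex_norm_square mult_ac del: of_real_power)
  have "0 \<le> Re (sform m F (\<lambda>a. x a + k * y a) (\<lambda>a. x a + k * y a))"
    using assms(1) by (simp add: psd_form_def less_eq_complex_def)
  also have "\<dots> = Re (k * b + cnj (k * b) + of_real ((cmod k)\<^sup>2 * q))"
    unfolding sform_expand psd_form_hermitian[OF assms(1), of y x] assms(2) q b_def by simp
  also have "\<dots> = - 2 * (t * (cmod b)\<^sup>2) + (t * cmod b)\<^sup>2 * q"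
    unfolding kb using t by (simp add: k_def norm_mult)
  also have "\<dots> = t * (cmod b)\<^sup>2 * (t * q - 2)"
    by (simp add: power2_eq_square algebra_simps)
  finally have "0 \<le> t * (cmod b)\<^sup>2 * (t * q - 2)" .
  moreover have "t * (cmod b)\<^sup>2 * (t * q - 2) < 0"
    using t \<open>0 < cmod b\<close> by (intro mult_pos_neg) auto
  ultimately show False by simp
qed

lemma sum_two_points:
  fixes g :: "nat \<Rightarrow> complex"
  assumes "a < m" "c < m"
  shows "(\<Sum>i<m. ((if i = a then p else 0) + (if i = c then q else 0)) * g i) = p * g a + q * g c"
proof -
  have "(\<Sum>i<m. ((if i = a then p else 0) + (if i = c then q else 0)) * g i) =
      (\<Sum>i<m. (if i = a then p * g i else 0) + (if i = c then q * g i else 0))"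
    by (intro sum.cong refl) (auto simp: distrib_right)
  thus ?thesis using assms by (simp add: sum.distrib)
qed

text \<open>A positive form below \<open>u u*\<close> kills every vector orthogonal to
  \<open>u\<close>; \<open>x\<close> is such a vector, supported on two coordinates. So the columns
  of \<open>F\<close> are proportional to \<open>u\<close>. The cross-multiplied version survives
  zeros of \<open>u\<close> and becomes a polynomial identity when \<open>u\<close> depends on a
  point of the circle.\<close>

lemma psd_form_below_rank1:
  assumes "psd_form m F" "psd_form m (\<lambda>a b. u a * cnj (u b) - F a b)" "a < m" "b < m" "c < m"
  shows "F a b * u c = F c b * u a"
proof -
  define x where "x = (\<lambda>i. (if i = a then cnj (u c) else 0) + (if i = c then - cnj (u a) else 0))"
  have cx: "cnj (x i) = (if i = a then u c else 0) + (if i = c then - u a else 0)" for i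
    by (simp add: x_def)
  have "(\<Sum>i<m. cnj (u i) * x i) = 0"
    using sum_two_points[OF assms(3,5), of "cnj (u c)" "- cnj (u a)" "\<lambda>i. cnj (u i)"]
    unfolding x_def by (simp add: mult.commute)
  hence "sform m (\<lambda>a b. u a * cnj (u b)) x x = 0" by (simp add: sform_rank1)
  moreover have "0 \<le> sform m (\<lambda>a b. u a * cnj (u b) - F a b) x x" "0 \<le> sform m F x x"
    using assms(1,2) unfolding psd_form_def by blast+
  ultimately have "sform m F x x = 0" by (auto simp: sform_diff less_eq_complex_def complex_eq_iff)
  define y where "y = (\<lambda>i. if i = b then 1 else 0 :: complex)"
  have "sform m F x y = (\<Sum>i<m. cnj (x i) * F i b)"
    using assms(4) unfolding sform_def y_def by (intro sum.cong refl) (simp add: if_distrib cong: if_cong)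
  also have "\<dots> = u c * F a b - u a * F c b"
    using sum_two_points[OF assms(3,5), of "u c" "- u a" "\<lambda>i. F i b"] unfolding cx by simp
  finally show ?thesis
    using psd_form_null[OF assms(1) \<open>sform m F x x = 0\<close>, of y] by (simp add: mult.commute)
qed

lemma psd_form_entry:
  assumes "b < m" "a < m"
  shows "sform m F (\<lambda>i. if i = a then 1 else 0) (\<lambda>i. if i = b then 1 else 0) = F a b"
proof -
  have "sform m F (\<lambda>i. if i = a then 1 else 0) (\<lambda>i. if i = b then 1 else 0) =
     (\<Sum>i<m. \<Sum>j<m. if i = a then (if j = b then F i j else 0) else 0)"
    unfolding sform_def by (intro sum.cong refl) auto
  also have "\<dots> = (\<Sum>i<m. if i = a then F i b else 0)"
    using assms by (intro sum.cong refl) auto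
  finally show ?thesis using assms by simp
qed

text \<open>Cholesky elimination; the first \<open>k\<close> rows and columns have already been cleared.\<close>

lemma psd_form_decomp_aux:
  assumes "psd_form m F" "\<And>a b. a < m \<Longrightarrow> b < m \<Longrightarrow> a < k \<or> b < k \<Longrightarrow> F a b = 0" "k + r = m"
  shows "\<exists>v. \<forall>a<m. \<forall>b<m. F a b = (\<Sum>i<r. v i a * cnj (v i b))"
  using assms
proof (induction r arbitrary: k F)
  case 0
  thus ?case by auto
next
  case (Suc r)
  have k: "k < m" using Suc.prems by simp
  define e where "e = (\<lambda>i. if i = k then 1 else 0 :: complex)"
  have ek: "sform m F e e = F k k" unfolding e_def by (rule psd_form_entry[OF k k])
  have row: "sform m F e y = (\<Sum>b<m. F k b * y b)" for y
  proof -
    have "sform m F e y = (\<Sum>a<m. if a = k then (\<Sum>b<m. F a b * y b) else 0)"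
      unfolding sform_def e_def by (intro sum.cong refl) auto
    thus ?thesis using k by simp
  qed
  have herm: "F b a = cnj (F a b)" if "a < m" "b < m" for a b
    using psd_form_hermitian[OF Suc.prems(1), of "\<lambda>i. if i = b then 1 else 0" "\<lambda>i. if i = a then 1 else 0"]
    by (simp add: psd_form_entry that)
  show ?case
  proof (cases "F k k = 0")
    case True
    \<comment> \<open>A zero pivot makes \<open>e\<close> a null vector, so its row vanishes and no
      rank-one term has to be split off.\<close>
    have z: "F k b = 0" if "b < m" for b
      using psd_form_null[OF Suc.prems(1), of e "\<lambda>i. if i = b then 1 else 0"] True that
      by (simp add: ek) (simp add: e_def psd_form_entry[OF that k])
    have "F a b = 0" if "a < m" "b < m" "a < Suc k \<or> b < Suc k" for a b
      using Suc.prems(2)[OF that(1,2)] that z[OF that(2)] z[OF that(1)] herm[OF k that(1)]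
      by (auto simp: less_Suc_eq)
    then obtain v where v: "\<forall>a<m. \<forall>b<m. F a b = (\<Sum>i<r. v i a * cnj (v i b))"
      using Suc.IH[OF Suc.prems(1), of "Suc k"] Suc.prems(3) by auto
    show ?thesis
      by (rule exI[of _ "v(r := \<lambda>a. 0)"]) (use v in auto)
  next
    case False
    define s where "s = Re (F k k)"
    have s: "F k k = of_real s" "0 < s"
      using Suc.prems(1) False unfolding psd_form_def ek[symmetric]
      by (auto simp: s_def ek[symmetric] less_eq_complex_def complex_eq_iff)
        (metis less_eq_real_def)
    define w where "w = (\<lambda>a. F a k / of_real (sqrt s))"
    define G where "G = (\<lambda>a b. F a b - w a * cnj (w b))"
    have ww: "w a * cnj (w b) = F a k * F k b / of_real s" if "a < m" "b < m" for a b
      using s(2) herm[OF k that(2)] unfolding w_def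
      by (simp add: flip: of_real_mult)
    have "psd_form m G"
      unfolding psd_form_def
    proof
      fix x
      \<comment> \<open>This \<open>t\<close> minimizes the form on the line through
        \<open>x\<close> in direction \<open>e\<close>; the minimum is the Schur complement
        \<open>G\<close>, which is therefore positive.\<close>
      define t where "t = sform m F e x / of_real s"
      have cw: "(\<Sum>b<m. cnj (w b) * x b) = sform m F e x / of_real (sqrt s)"
        unfolding row w_def sum_divide_distrib
        by (intro sum.cong refl) (use herm[OF k] in auto)
      have sq: "sform m (\<lambda>a b. w a * cnj (w b)) x x = cnj (sform m F e x) * sform m F e x / of_real s"
        unfolding sform_rank1 cw using s(2) by (simp flip: of_real_mult)
      have "0 \<le> sform m F (\<lambda>a. x a + (- t) * e a) (\<lambda>a. x a + (- t) * e a)"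
        using Suc.prems(1) unfolding psd_form_def by blast
      also have "\<dots> = sform m F x x - cnj (sform m F e x) * sform m F e x / of_real s"
        unfolding sform_expand psd_form_hermitian[OF Suc.prems(1), of x e] ek s(1) norm_minus_cancel
          complex_norm_square
        using s(2) by (simp add: t_def complex_norm_square field_simps)
      also have "\<dots> = sform m G x x" unfolding G_def sform_diff sq ..
      finally show "0 \<le> sform m G x x" .
    qed
    moreover have "G a b = 0" if "a < m" "b < m" "a < Suc k \<or> b < Suc k" for a b
    proof -
      consider "a < k" | "b < k" | "a = k" | "b = k" using \<open>a < Suc k \<or> b < Suc k\<close> by linarith
      thus ?thesis
      proof cases
        case 1
        thus ?thesis using Suc.prems(2)[OF that(1,2)] Suc.prems(2)[OF that(1) k]
          by (simp add: G_def ww that)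
      next
        case 2
        thus ?thesis using Suc.prems(2)[OF that(1,2)] Suc.prems(2)[OF k that(2)]
          by (simp add: G_def ww that)
      qed (use that s in \<open>simp_all add: G_def ww\<close>)
    qed
    ultimately obtain v where v: "\<forall>a<m. \<forall>b<m. G a b = (\<Sum>i<r. v i a * cnj (v i b))"
      using Suc.IH[of G "Suc k"] Suc.prems(3) by auto
    show ?thesis
      by (rule exI[of _ "v(r := w)"]) (use v in \<open>auto simp: G_def algebra_simps\<close>)
  qed
qed

lemma psd_form_decomp:
  assumes "psd_form m F"
  obtains v where "\<And>a b. a < m \<Longrightarrow> b < m \<Longrightarrow> F a b = (\<Sum>i<m. v i a * cnj (v i b))"
  using psd_form_decomp_aux[OF assms, of 0 m] by auto

text \<open>The hypothesis is positivity of the block matrix with \<open>c\<close> on the diagonal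
  and \<open>F\<close>, \<open>G\<close> off it. It forces \<open>G\<close> to be the adjoint of
  \<open>F\<close>; rotating \<open>y\<close> by the phase that makes the value of \<open>F\<close>
  negative gives the bound.\<close>

lemma form_bound_if_psd:
  assumes pos: "\<And>x y. 0 \<le> complex_of_real (c * (nsq m x + nsq m y)) + sform m F x y + sform m G y x"
  shows "form_bound m F c"
  unfolding form_bound_def
proof (intro allI)
  fix x y
  define b where "b = sform m F x y"
  define g where "g = sform m G y x"
  have *: "Im (k * b + cnj k * g) = 0 \<and>
      0 \<le> c * (nsq m x + (cmod k)\<^sup>2 * nsq m y) + Re (k * b + cnj k * g)" for k
    using pos[of x "\<lambda>a. k * y a"]
    unfolding sform_scale_left sform_scale_right nsq_scale b_def[symmetric] g_def[symmetric]
    by (simp add: less_eq_complex_def)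
  have g: "g = cnj b"
    using *[of 1] *[of \<i>] by (simp add: complex_eq_iff)
  show "cmod b \<le> c * (nsq m x + nsq m y) / 2"
  proof (cases "b = 0")
    case True
    thus ?thesis using *[of 0] *[of 1] by (simp add: g)
  next
    case False
    define k where "k = - (cnj b / of_real (cmod b))"
    have k: "cmod k = 1" using False by (simp add: k_def norm_divide)
    have "k * b = - of_real (cmod b)"
      using False unfolding k_def
      by (simp add: field_simps complex_norm_square[symmetric] power2_eq_square)
    moreover have "cnj k * g = cnj (k * b)" by (simp add: g)
    ultimately have "Re (k * b + cnj k * g) = - 2 * cmod b" by simp
    thus ?thesis using *[of k] k by simp
  qed
qed

text \<open>The mean in \<open>form_bound\<close>, taken once for \<open>F\<close> and once for its
  adjoint, is exactly the diagonal part of the block form.\<close>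

lemma psd_if_form_bound:
  assumes "form_bound m F c" "\<And>a b. a < m \<Longrightarrow> b < m \<Longrightarrow> G a b = cnj (F b a)"
  shows "0 \<le> complex_of_real (c * (nsq m x + nsq m y)) + sform m F x y + sform m G y x"
proof -
  have "sform m G y x = (\<Sum>a<m. \<Sum>b<m. cnj (cnj (x b) * F b a * y a))"
    unfolding sform_def by (intro sum.cong refl) (simp add: assms(2) mult_ac)
  also have "\<dots> = cnj (sform m F x y)"
    unfolding sform_def cnj_sum by (rule sum.swap)
  finally have "sform m G y x = cnj (sform m F x y)" .
  moreover have "- Re (sform m F x y) \<le> c * (nsq m x + nsq m y) / 2"
    using assms(1) abs_Re_le_cmod[of "sform m F x y"] unfolding form_bound_def
    by (meson abs_le_D2 order_trans)
  ultimately show ?thesis by (simp add: less_eq_complex_def)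
qed

section \<open>Unital completely positive maps\<close>

lemma UCP_D:
  assumes "\<phi> \<in> UCP S n"
  shows "completely_positive S n \<phi>" "os_linear S n \<phi>" "\<phi> (os_unit S) = 1\<^sub>m n"
    "x \<in> os_carrier S \<Longrightarrow> \<phi> x \<in> carrier_mat n n"
  using assms by (auto simp: UCP_def CP_def completely_positive_def os_linear_def)

lemma sum_lessThan_2: "(\<Sum>i<2. f i) = f 0 + f (Suc 0)" for f :: "nat \<Rightarrow> 'a :: comm_monoid_add"
  by (simp add: numeral_2_eq_2)

text \<open>The 2 x 2 trick: the positive block \<open>[[c, x], [y, c]]\<close> is mapped to a
  positive block of the same shape, from which the bound is read off. An \<open>op_system\<close>
  carries no involution, so the adjoint of \<open>x\<close> is supplied as \<open>y\<close> and
  enters through positivity.\<close>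

lemma UCP_form_bound:
  assumes "\<phi> \<in> UCP S n" and "x \<in> os_carrier S" "y \<in> os_carrier S" "os_unit S \<in> os_carrier S"
    "os_scale S (of_real c) (os_unit S) \<in> os_carrier S"
    and pos: "os_pos S 2 (\<lambda>i j. if i = j then os_scale S (of_real c) (os_unit S)
                               else if i = 0 then x else y)"
  shows "form_bound n (entries (\<phi> x)) c"
proof -
  define X where "X = (\<lambda>i j. if i = j then os_scale S (of_real c) (os_unit S)
                               else if i = (0::nat) then x else y)"
  have "psd (block_mat 2 n (\<lambda>i j. \<phi> (X i j)))"
    using assms UCP_D(1)[OF assms(1)] unfolding completely_positive_def X_def by auto
  hence *: "0 \<le> (\<Sum>i<2. \<Sum>j<2. sform n (entries (\<phi> (X i j))) (z i) (z j))" for z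
    by (simp add: psd_block_mat_iff)
  have u: "\<phi> (os_scale S (of_real c) (os_unit S)) = of_real c \<cdot>\<^sub>m 1\<^sub>m n"
    using UCP_D(2,3)[OF assms(1)] assms(4) by (simp add: os_linear_def)
  have ue: "sform n (entries (of_real c \<cdot>\<^sub>m 1\<^sub>m n)) z z = of_real (c * nsq n z)" for z
  proof -
    have "sform n (entries (of_real c \<cdot>\<^sub>m 1\<^sub>m n)) z z = sform n (\<lambda>a b. if a = b then of_real c else 0) z z"
      by (rule sform_cong) auto
    thus ?thesis by (simp add: sform_one nsq_eq)
  qed
  show ?thesis
  proof (rule form_bound_if_psd)
    fix z w
    have "0 \<le> (\<Sum>i<2. \<Sum>j<2. sform n (entries (\<phi> (X i j)))
      ((\<lambda>i. if i = 0 then z else w) i) ((\<lambda>i. if i = 0 then z else w) j))"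
      by (rule *)
    thus "0 \<le> of_real (c * (nsq n z + nsq n w)) + sform n (entries (\<phi> x)) z w
              + sform n (entries (\<phi> y)) w z"
      by (simp add: sum_lessThan_2 X_def u ue algebra_simps)
  qed
qed

section \<open>Roots of unity\<close>

definition rou :: "nat \<Rightarrow> nat \<Rightarrow> complex" where
  "rou N j = cis (2 * pi * real j / real N)"

lemma norm_rou [simp]: "cmod (rou N j) = 1"
  by (simp add: rou_def)

lemma rou_pow_N [simp]: "0 < N \<Longrightarrow> rou N j ^ N = 1"
  by (simp add: rou_def DeMoivre)

lemma unit_mult_cnj: "cmod z = 1 \<Longrightarrow> z * cnj z = 1"
  by (simp add: complex_norm_square[symmetric])

lemma unit_power_diff:
  assumes "cmod z = 1" shows "q \<le> p \<Longrightarrow> z ^ p * cnj z ^ q = z ^ (p - q)"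
    and "p \<le> q \<Longrightarrow> z ^ p * cnj z ^ q = cnj z ^ (q - p)"
proof -
  have 1: "z ^ k * cnj z ^ k = 1" for k
    using unit_mult_cnj[OF assms] by (simp flip: power_mult_distrib)
  show "z ^ p * cnj z ^ q = z ^ (p - q)" if "q \<le> p"
  proof -
    have "z ^ p * cnj z ^ q = z ^ (p - q) * (z ^ q * cnj z ^ q)"
      using that by (simp add: mult.assoc[symmetric] flip: power_add)
    thus ?thesis by (simp add: 1)
  qed
  show "z ^ p * cnj z ^ q = cnj z ^ (q - p)" if "p \<le> q"
  proof -
    have "z ^ p * cnj z ^ q = cnj z ^ (q - p) * (z ^ p * cnj z ^ p)"
      using that by (simp add: mult_ac flip: power_add)
    thus ?thesis by (simp add: 1)
  qed
qed

lemma rou_mult_cnj: "rou N i * cnj (rou N j) = cis (2 * pi * (real i - real j) / real N)"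
  unfolding rou_def cis_cnj cis_mult
  by (rule arg_cong[of _ _ cis]) (simp add: field_simps diff_divide_distrib)

lemma rou_power: "rou N j ^ p = cis (2 * pi * real j * real p / real N)"
  by (simp add: rou_def DeMoivre mult_ac)

lemma cis_2pi_frac_ne_1:
  assumes "k \<noteq> 0" "\<bar>k\<bar> < int N" shows "cis (2 * pi * of_int k / real N) \<noteq> 1"
proof
  assume "cis (2 * pi * of_int k / real N) = 1"
  hence "cos (2 * pi * of_int k / real N) = 1" by (simp add: complex_eq_iff)
  then obtain m :: int where "2 * pi * of_int k / real N = of_int m * (2 * pi)"
    using cos_one_2pi_int by auto
  hence "of_int k = real_of_int m * real N" using assms by (simp add: field_simps)
  hence "k = m * int N" by (metis of_int_eq_iff of_int_mult of_int_of_nat_eq)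
  moreover from this assms(1) have "1 \<le> \<bar>m\<bar>" by auto
  ultimately have "int N \<le> \<bar>k\<bar>" by (simp add: abs_mult mult_le_cancel_right1)
  thus False using assms by simp
qed

lemma sum_rou_powers:
  assumes "k \<noteq> 0" "\<bar>k\<bar> < int N"
  shows "(\<Sum>j<N. cis (2 * pi * of_int k / real N) ^ j) = 0"
proof -
  let ?u = "cis (2 * pi * of_int k / real N)"
  have "?u ^ N = cis (2 * pi * of_int k)" using assms by (simp add: DeMoivre)
  hence "?u ^ N = 1" by simp
  thus ?thesis using cis_2pi_frac_ne_1[OF assms] by (simp add: geometric_sum)
qed

lemma sum_rou_index:
  assumes "p < N" "q < N"
  shows "(\<Sum>j<N. rou N j ^ p * cnj (rou N j) ^ q) = (if p = q then of_nat N else 0)"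
proof (cases "p = q")
  case True
  thus ?thesis
    by (simp add: unit_mult_cnj flip: power_mult_distrib)
next
  case False
  have "rou N j ^ p * cnj (rou N j) ^ q = cis (2 * pi * of_int (int p - int q) / real N) ^ j" for j
    unfolding rou_power complex_cnj_power[symmetric] cis_cnj cis_mult DeMoivre
    by (rule arg_cong[of _ _ cis]) (simp add: field_simps diff_divide_distrib)
  thus ?thesis using sum_rou_powers[of "int p - int q" N] False assms by simp
qed

text \<open>The dual orthogonality relation: with as many roots as coordinates, the geometric
  vectors of the roots form an orthogonal basis.\<close>

lemma sum_rou_exponent:
  assumes "i < N" "j < N"
  shows "(\<Sum>p<N. rou N i ^ p * cnj (rou N j) ^ p) = (if i = j then of_nat N else 0)"
proof (cases "i = j")
  case True
  thus ?thesis
    by (simp add: unit_mult_cnj flip: power_mult_distrib)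
next
  case False
  have "rou N i ^ p * cnj (rou N j) ^ p = cis (2 * pi * of_int (int i - int j) / real N) ^ p" for p
    using rou_mult_cnj[of N i j] by (simp flip: power_mult_distrib)
  thus ?thesis using sum_rou_powers[of "int i - int j" N] False assms by simp
qed

definition evec :: "complex \<Rightarrow> nat \<Rightarrow> complex" where
  "evec z p = z ^ p"

lemma cnj_evec: "cnj (evec z p) = cnj z ^ p"
  by (simp add: evec_def)

lemma nsq_evec: "cmod z = 1 \<Longrightarrow> nsq m (evec z) = of_nat m"
  by (simp add: nsq_def evec_def norm_power)

text \<open>For length \<open>m \<le> N\<close> all exponents differ by less than \<open>N\<close>,
  so nothing aliases, and the \<open>N\<close> geometric vectors form a tight frame. This is the
  substitute for integration over the circle.\<close>

lemma parseval_rou: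
  assumes "m \<le> N"
  shows "(\<Sum>j<N. (\<Sum>p<m. cnj (evec (rou N j) p) * y p) * cnj (\<Sum>p<m. cnj (evec (rou N j) p) * x p))
         = of_nat N * (\<Sum>p<m. cnj (x p) * y p)"
proof -
  have "(\<Sum>j<N. (\<Sum>p<m. cnj (evec (rou N j) p) * y p) * cnj (\<Sum>p<m. cnj (evec (rou N j) p) * x p))
      = (\<Sum>j<N. \<Sum>p<m. \<Sum>q<m. (y p * cnj (x q)) * (rou N j ^ q * cnj (rou N j) ^ p))"
    by (simp add: sum_product evec_def mult_ac)
  also have "\<dots> = (\<Sum>p<m. \<Sum>j<N. \<Sum>q<m. (y p * cnj (x q)) * (rou N j ^ q * cnj (rou N j) ^ p))"
    by (rule sum.swap)
  also have "\<dots> = (\<Sum>p<m. \<Sum>q<m. \<Sum>j<N. (y p * cnj (x q)) * (rou N j ^ q * cnj (rou N j) ^ p))"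
    by (intro sum.cong refl sum.swap)
  also have "\<dots> = (\<Sum>p<m. \<Sum>q<m. if q = p then of_nat N * (cnj (x p) * y p) else 0)"
    unfolding sum_distrib_left[symmetric]
    using assms by (intro sum.cong refl) (auto simp: sum_rou_index mult_ac)
  finally show ?thesis by (simp add: sum_distrib_left)
qed

lemma parseval_rou_norm:
  assumes "m \<le> N"
  shows "(\<Sum>j<N. (cmod (\<Sum>p<m. cnj (evec (rou N j) p) * x p))\<^sup>2) = of_nat N * nsq m x"
proof -
  have "complex_of_real (\<Sum>j<N. (cmod (\<Sum>p<m. cnj (evec (rou N j) p) * x p))\<^sup>2)
      = complex_of_real (of_nat N * nsq m x)"
    using parseval_rou[OF assms, of x x]
    by (simp add: complex_norm_square nsq_eq del: of_real_power)
  thus ?thesis by (simp only: of_real_eq_iff)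
qed

section \<open>The discrete Fejer operator\<close>

text \<open>The unnormalized Fejer kernel, the squared modulus of a Dirichlet kernel; by
  \<open>fejer_sum\<close>, division by \<open>N * m\<close> turns it into probability weights on
  the grid.\<close>

definition fejer :: "nat \<Rightarrow> complex \<Rightarrow> complex \<Rightarrow> real" where
  "fejer m w z = (cmod (\<Sum>p<m. cnj (evec w p) * evec z p))\<^sup>2"

lemma fejer_nonneg: "0 \<le> fejer m w z"
  by (simp add: fejer_def)

lemma fejer_sum:
  assumes "m \<le> N" "cmod z = 1"
  shows "(\<Sum>j<N. fejer m (rou N j) z) = of_nat N * of_nat m"
  using parseval_rou_norm[OF assms(1), of "evec z"] assms(2)
  by (simp add: fejer_def nsq_evec)

text \<open>A geometric sum, multiplied out so that \<open>z = w\<close> is no exception. Only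
  \<open>w\<close> is on the circle, which allows zeros to be located in the whole plane
  later.\<close>

lemma dirichlet_telescope:
  assumes "cmod w = 1"
  shows "(z - w) * (\<Sum>p<m. cnj (evec w p) * evec z p) = w * (cnj w ^ m * z ^ m - 1)"
proof -
  have "z - w = w * (cnj w * z - 1)"
    using unit_mult_cnj[OF assms] by (simp add: algebra_simps)
  moreover have "(\<Sum>p<m. cnj (evec w p) * evec z p) = (\<Sum>p<m. (cnj w * z) ^ p)"
    by (simp add: evec_def power_mult_distrib)
  moreover have "(cnj w * z - 1) * (\<Sum>p<m. (cnj w * z) ^ p) = (cnj w * z) ^ m - 1"
    by (simp add: power_diff_1_eq)
  ultimately show ?thesis by (simp add: power_mult_distrib mult.assoc)
qed

lemma dirichlet_bound:
  assumes "cmod w = 1" "cmod z = 1"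
  shows "cmod (z - w) * cmod (\<Sum>p<m. cnj (evec w p) * evec z p) \<le> 2"
proof -
  have "cmod (z - w) * cmod (\<Sum>p<m. cnj (evec w p) * evec z p) = cmod (cnj w ^ m * z ^ m - 1)"
    unfolding norm_mult[symmetric] dirichlet_telescope[OF assms(1)] using assms
    by (simp add: norm_mult)
  also have "\<dots> \<le> cmod (cnj w ^ m * z ^ m) + cmod 1" by (rule norm_triangle_ineq4)
  finally show ?thesis using assms by (simp add: norm_mult norm_power)
qed

text \<open>
  The kernel concentrates because \<open>\<bar>z - w\<bar>\<^sup>2\<close> times it is bounded, uniformly in \<open>m\<close>.
\<close>

lemma fejer_approx:
  assumes m: "0 < m" "m \<le> N" and z: "cmod z = 1"
    and lip: "\<And>w. cmod w = 1 \<Longrightarrow> cmod (g w - g z) \<le> L * cmod (z - w)" and L: "0 \<le> L"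
  shows "cmod ((\<Sum>j<N. g (rou N j) * of_real (fejer m (rou N j) z)) / (of_nat N * of_nat m) - g z)
           \<le> 2 * L / sqrt (real m)"
proof -
  define C where "C = real N * real m"
  have C: "0 < C" using m by (simp add: C_def)
  define K where "K = (\<lambda>j. fejer m (rou N j) z)"
  have K: "(\<Sum>j<N. K j) = C" using fejer_sum[OF m(2) z] by (simp add: K_def C_def)
  have K0: "0 \<le> K j" for j by (simp add: K_def fejer_nonneg)
  define s where "s = sqrt (real m)"
  have s: "0 < s" "s\<^sup>2 = real m" using m by (simp_all add: s_def)
  \<comment> \<open>The Dirichlet bound controls \<open>e * D\<close>, but the kernel is
    \<open>D\<^sup>2\<close>. The mean inequality splits \<open>e * D\<^sup>2\<close> into
    \<open>D\<^sup>2 / s\<close>, which sums to \<open>C / s\<close>, and \<open>s\<close>, which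
    sums to \<open>N * s\<close>; with \<open>s = sqrt m\<close> both sums agree.\<close>
  have one: "cmod (z - rou N j) * K j \<le> K j / s + s" for j
  proof -
    define D where "D = cmod (\<Sum>p<m. cnj (evec (rou N j) p) * evec z p)"
    define e where "e = cmod (z - rou N j)"
    have e: "e * D \<le> 2" "0 \<le> e * D" using dirichlet_bound[OF norm_rou z] by (simp_all add: e_def D_def)
    have "2 * ((D / sqrt s) * (e * D * sqrt s / 2)) \<le> (D / sqrt s)\<^sup>2 + (e * D * sqrt s / 2)\<^sup>2"
      by (rule two_mult_le_sum_squares)
    also have "(D / sqrt s)\<^sup>2 = D\<^sup>2 / s" using s by (simp add: power_divide)
    also have "(e * D * sqrt s / 2)\<^sup>2 = (e * D)\<^sup>2 * s / 4"
      using s by (simp add: power_mult_distrib power_divide)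
    also have "(e * D)\<^sup>2 * s / 4 \<le> 2\<^sup>2 * s / 4"
      using e s by (intro divide_right_mono mult_right_mono power_mono) auto
    finally have "e * D\<^sup>2 \<le> D\<^sup>2 / s + s"
      using s by (simp add: power2_eq_square mult_ac)
    thus ?thesis
      by (simp add: K_def fejer_def D_def e_def)
  qed
  have "(\<Sum>j<N. g (rou N j) * of_real (K j)) / of_real C - g z =
      (\<Sum>j<N. (g (rou N j) - g z) * of_real (K j)) / of_real C"
  proof -
    have "(\<Sum>j<N. (g (rou N j) - g z) * of_real (K j)) =
        (\<Sum>j<N. g (rou N j) * of_real (K j)) - g z * of_real C"
      by (simp add: left_diff_distrib sum_subtractf sum_distrib_left flip: K)
    thus ?thesis using C by (simp add: field_simps)
  qed
  also have "cmod \<dots> \<le> (\<Sum>j<N. L * (K j / s + s)) / C"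
    unfolding norm_divide
  proof (intro frac_le order_trans[OF norm_sum] sum_mono)
    fix j
    have "cmod ((g (rou N j) - g z) * of_real (K j)) \<le> L * cmod (z - rou N j) * K j"
      using lip[OF norm_rou] K0 by (simp add: norm_mult mult_right_mono)
    also have "\<dots> \<le> L * (K j / s + s)"
      using mult_left_mono[OF one L] by (simp add: mult.assoc)
    finally show "cmod ((g (rou N j) - g z) * of_real (K j)) \<le> L * (K j / s + s)" .
  qed (use C L K0 s in \<open>auto intro!: sum_nonneg\<close>)
  also have "(\<Sum>j<N. L * (K j / s + s)) = L * (C / s + real N * s)"
    unfolding sum_distrib_left[symmetric] sum.distrib sum_divide_distrib[symmetric] K by simp
  also have "\<dots> / C = 2 * L / s"
  proof -
    have "C = real N * (s * s)" using s(2) by (simp add: C_def power2_eq_square)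
    moreover have "0 < real N" using m by simp
    ultimately show ?thesis using s(1) by (simp add: field_simps)
  qed
  finally show ?thesis by (simp add: K_def C_def s_def)
qed

section \<open>Toeplitz matrices\<close>

definition toep :: "nat \<Rightarrow> (int \<Rightarrow> complex) \<Rightarrow> complex mat" where
  "toep d a = Matrix.mat d d (\<lambda>(p, q). a (int p - int q))"

lemma toep_index: "p < d \<Longrightarrow> q < d \<Longrightarrow> toep d a $$ (p, q) = a (int p - int q)"
  by (simp add: toep_def)

lemma toep_carrier [simp]: "toep d a \<in> carrier_mat d d"
  by (simp add: toep_def)

lemma dim_toep [simp]: "dim_row (toep d a) = d" "dim_col (toep d a) = d"
  by (simp_all add: toep_def)

lemma toep_in [simp]: "toep d a \<in> toeplitz_mats d"
  by (auto simp: toep_def toeplitz_mats_def)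

lemma toeplitz_matsE:
  assumes "T \<in> toeplitz_mats d" obtains a where "T = toep d a"
  using assms by (auto simp: toep_def toeplitz_mats_def)

lemma toep_cong:
  assumes "\<And>k. \<bar>k\<bar> < int d \<Longrightarrow> a k = b k" shows "toep d a = toep d b"
  using assms by (intro eq_matI) (auto simp: toep_def)

lemma toep_add: "toep d a + toep d b = toep d (\<lambda>k. a k + b k)"
  by (intro eq_matI) (auto simp: toep_def)

lemma toep_diff: "toep d a - toep d b = toep d (\<lambda>k. a k - b k)"
  by (intro eq_matI) (auto simp: toep_def)

lemma toep_smult: "c \<cdot>\<^sub>m toep d a = toep d (\<lambda>k. c * a k)"
  by (intro eq_matI) (auto simp: toep_def)

lemma toep_one: "1\<^sub>m d = toep d (\<lambda>k. if k = 0 then 1 else 0)"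
  by (intro eq_matI) (auto simp: toep_def)

text \<open>Commuting with a diagonal matrix multiplies the entry at (p, q) by a difference of
  diagonal entries, here \<open>p - q\<close>: on coefficients the derivation acts like a
  derivative.\<close>

lemma toep_commutator: "D_mat d * toep d a - toep d a * D_mat d = toep d (\<lambda>k. of_int k * a k)"
proof (rule eq_matI)
  fix p q assume "p < dim_row (toep d (\<lambda>k. of_int k * a k))" "q < dim_col (toep d (\<lambda>k. of_int k * a k))"
  hence pq: "p < d" "q < d" by (auto simp: toep_def)
  have "(\<Sum>i<d. D_mat d $$ (p, i) * toep d a $$ (i, q)) = (\<Sum>i<d. if i = p then of_nat (p + 1) * toep d a $$ (p, q) else 0)"
    using pq by (intro sum.cong refl) (auto simp: D_mat_def mat_diag_def)
  hence 1: "(D_mat d * toep d a) $$ (p, q) = of_nat (p + 1) * a (int p - int q)"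
    using pq by (simp add: scalar_prod_def atLeast0LessThan D_mat_def mat_diag_def toep_index)
  have "(\<Sum>i<d. toep d a $$ (p, i) * D_mat d $$ (i, q)) = (\<Sum>i<d. if i = q then of_nat (q + 1) * toep d a $$ (p, q) else 0)"
    using pq by (intro sum.cong refl) (auto simp: D_mat_def mat_diag_def)
  hence 2: "(toep d a * D_mat d) $$ (p, q) = of_nat (q + 1) * a (int p - int q)"
    using pq by (simp add: scalar_prod_def atLeast0LessThan D_mat_def mat_diag_def toep_index)
  have dim: "D_mat d \<in> carrier_mat d d" by (simp add: D_mat_def mat_diag_def)
  show "(D_mat d * toep d a - toep d a * D_mat d) $$ (p, q) = toep d (\<lambda>k. of_int k * a k) $$ (p, q)"
    using pq dim by (simp add: 1 2 toep_index algebra_simps del: index_mult_mat(1))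
qed (auto simp: toep_def D_mat_def mat_diag_def)

section \<open>Single diagonals and their values on geometric vectors\<close>

definition shift :: "int \<Rightarrow> nat \<Rightarrow> nat \<Rightarrow> complex" where
  "shift k p q = (if int p - int q = k then 1 else 0)"

definition diags :: "nat \<Rightarrow> int set" where
  "diags d = {- int d<..<int d}"

lemma finite_diags [simp]: "finite (diags d)"
  by (simp add: diags_def)

lemma toep_entries_shift:
  assumes "p < d" "q < d"
  shows "a (int p - int q) = (\<Sum>k\<in>diags d. a k * shift k p q)"
proof -
  have "(\<Sum>k\<in>diags d. a k * shift k p q) = (\<Sum>k\<in>diags d. if k = int p - int q then a k else 0)"
    by (intro sum.cong refl) (simp add: shift_def)
  thus ?thesis using assms by (simp add: diags_def)
qed

lemma sform_toep:
  "sform d (\<lambda>p q. a (int p - int q)) x y = (\<Sum>k\<in>diags d. a k * sform d (shift k) x y)"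
proof -
  have "sform d (\<lambda>p q. a (int p - int q)) x y = sform d (\<lambda>p q. \<Sum>k\<in>diags d. a k * shift k p q) x y"
    by (rule sform_cong) (auto intro: toep_entries_shift)
  thus ?thesis by (simp add: sform_sum sform_scale)
qed

lemma sform_entries_toep:
  "sform d (entries (toep d a)) x y = sform d (\<lambda>p q. a (int p - int q)) x y"
  by (rule sform_cong) (auto simp: toep_index)

lemma sform_shift_nat:
  "sform d (shift (int k)) x y = (\<Sum>q<d - k. cnj (x (q + k)) * y q)"
proof -
  have "sform d (shift (int k)) x y = (\<Sum>q<d. \<Sum>p<d. if p = q + k then cnj (x (q + k)) * y q else 0)"
    unfolding sform_def
    by (subst sum.swap) (intro sum.cong refl, auto simp: shift_def)
  also have "\<dots> = (\<Sum>q<d. if q + k < d then cnj (x (q + k)) * y q else 0)"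
    by (intro sum.cong refl) auto
  also have "\<dots> = (\<Sum>q<d - k. cnj (x (q + k)) * y q)"
    by (intro sum.mono_neutral_cong_right) auto
  finally show ?thesis .
qed

lemma sform_shift_neg:
  "sform d (shift (- int k)) x y = (\<Sum>p<d - k. cnj (x p) * y (p + k))"
proof -
  have "sform d (shift (- int k)) x y = (\<Sum>p<d. \<Sum>q<d. if q = p + k then cnj (x p) * y (p + k) else 0)"
    unfolding sform_def
    by (intro sum.cong refl) (auto simp: shift_def)
  also have "\<dots> = (\<Sum>p<d. if p + k < d then cnj (x p) * y (p + k) else 0)"
    by (intro sum.cong refl) auto
  also have "\<dots> = (\<Sum>p<d - k. cnj (x p) * y (p + k))"
    by (intro sum.mono_neutral_cong_right) auto
  finally show ?thesis .
qed

lemma sform_shift_cases: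
  obtains k :: nat where "j = int k" "\<And>x y. sform d (shift j) x y = (\<Sum>q<d - k. cnj (x (q + k)) * y q)"
  | k :: nat where "j = - int k" "\<And>x y. sform d (shift j) x y = (\<Sum>p<d - k. cnj (x p) * y (p + k))"
  by (metis int_cases2 sform_shift_nat sform_shift_neg)

lemma nsq_mono: "k \<le> m \<Longrightarrow> nsq k x \<le> nsq m x"
  unfolding nsq_def by (intro sum_mono2) auto

lemma nsq_shift_mono: "nsq (m - k) (\<lambda>q. x (q + k)) \<le> nsq m x"
proof -
  have "nsq (m - k) (\<lambda>q. x (q + k)) = (\<Sum>q\<in>(\<lambda>q. q + k) ` {..<m - k}. (cmod (x q))\<^sup>2)"
    unfolding nsq_def by (subst sum.reindex) (auto simp: inj_on_def)
  also have "\<dots> \<le> nsq m x"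
    unfolding nsq_def by (intro sum_mono2) auto
  finally show ?thesis .
qed

lemma form_bound_shift: "form_bound d (shift k) 1"
  unfolding form_bound_def
proof (intro allI)
  fix x y
  have *: "cmod (\<Sum>q<e. cnj (u q) * v q) \<le> (nsq e u + nsq e v) / 2" for e and u v :: "nat \<Rightarrow> complex"
    by (rule order_trans[OF norm_sum]) (use sum_cmod_mult_le[of u v e] in \<open>simp add: norm_mult\<close>)
  show "cmod (sform d (shift k) x y) \<le> 1 * (nsq d x + nsq d y) / 2"
  proof (rule sform_shift_cases[of k d])
    fix j assume "\<And>x y. sform d (shift k) x y = (\<Sum>q<d - j. cnj (x (q + j)) * y q)"
    thus ?thesis
      using *[where e="d - j" and u="\<lambda>q. x (q + j)" and v=y] nsq_shift_mono[of d j x]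
        nsq_mono[of "d - j" d y] by simp
  next
    fix j assume "\<And>x y. sform d (shift k) x y = (\<Sum>p<d - j. cnj (x p) * y (p + j))"
    thus ?thesis
      using *[where e="d - j" and u=x and v="\<lambda>q. y (q + j)"] nsq_shift_mono[of d j y]
        nsq_mono[of "d - j" d x] by simp
  qed
qed

lemma form_bound_toep:
  "form_bound d (entries (toep d a)) (\<Sum>k\<in>diags d. cmod (a k))"
proof -
  have "form_bound d (\<lambda>p q. \<Sum>k\<in>diags d. a k * shift k p q) (\<Sum>k\<in>diags d. cmod (a k) * 1)"
    by (intro form_bound_sum form_bound_scale form_bound_shift)
  hence "form_bound d (\<lambda>p q. \<Sum>k\<in>diags d. a k * shift k p q) (\<Sum>k\<in>diags d. cmod (a k))"
    by simp
  thus ?thesis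
    by (rule form_bound_cong[rotated]) (simp add: toep_index toep_entries_shift[symmetric])
qed

text \<open>All entries of one diagonal contribute the same power of \<open>z\<close>, and there are
  \<open>d - \<bar>k\<bar>\<close> of them: these are the Fejer weights.\<close>

lemma sform_shift_evec_diag:
  assumes "cmod z = 1" "\<bar>k\<bar> \<le> int d"
  shows "sform d (shift k) (evec z) (evec z) = of_int (int d - \<bar>k\<bar>) * (if 0 \<le> k then cnj z ^ nat k else z ^ nat (- k))"
proof -
  have 1: "z ^ q * cnj z ^ q = 1" for q
    using unit_mult_cnj[OF assms(1)] by (simp flip: power_mult_distrib)
  show ?thesis
  proof (cases "0 \<le> k")
    case True
    then obtain j where j: "k = int j" using zero_le_imp_eq_int by blast
    have "cnj (evec z (q + j)) * evec z q = cnj z ^ j" for q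
      using 1[of q] by (simp add: evec_def power_add mult_ac)
    thus ?thesis using assms(2) by (simp add: j sform_shift_nat of_nat_diff)
  next
    case False
    define j where "j = nat (- k)"
    have j: "k = - int j" "0 < j" using False by (auto simp: j_def)
    have "cnj (evec z q) * evec z (q + j) = z ^ j" for q
      using 1[of q] by (simp add: evec_def power_add mult_ac)
    thus ?thesis using assms(2) j(2) by (simp add: j sform_shift_neg of_nat_diff)
  qed
qed

text \<open>A shifted geometric sequence is a unimodular multiple of itself, so every diagonal
  yields a truncated Dirichlet kernel. The bound is uniform in \<open>k\<close> and
  \<open>d\<close>; division by \<open>d\<close> therefore beats coefficients whose l1 norm is of
  order sqrt d.\<close>

lemma sform_shift_evec_offdiag:
  assumes "cmod w = 1" "cmod z = 1"
  shows "cmod (z - w) * cmod (sform d (shift k) (evec w) (evec z)) \<le> 2"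
proof (rule sform_shift_cases[of k d])
  fix j assume *: "\<And>x y. sform d (shift k) x y = (\<Sum>q<d - j. cnj (x (q + j)) * y q)"
  have "sform d (shift k) (evec w) (evec z) = cnj w ^ j * (\<Sum>q<d - j. cnj (evec w q) * evec z q)"
    unfolding * sum_distrib_left by (simp add: evec_def power_add mult_ac)
  thus ?thesis using dirichlet_bound[OF assms, of "d - j"] assms
    by (simp add: norm_mult norm_power)
next
  fix j assume *: "\<And>x y. sform d (shift k) x y = (\<Sum>p<d - j. cnj (x p) * y (p + j))"
  have "sform d (shift k) (evec w) (evec z) = z ^ j * (\<Sum>q<d - j. cnj (evec w q) * evec z q)"
    unfolding * sum_distrib_left by (simp add: evec_def power_add mult_ac)
  thus ?thesis using dirichlet_bound[OF assms, of "d - j"] assms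
    by (simp add: norm_mult norm_power)
qed

text \<open>The first column and the first row of the commutator already control all coefficients.\<close>

lemma commutator_l1:
  assumes fb: "form_bound d (\<lambda>p q. of_int (int p - int q) * a (int p - int q)) c" and "0 < c"
  shows "(\<Sum>k\<in>diags d. cmod (of_int k * a k)) \<le> 2 * c * sqrt (real d)"
proof (cases "d = 0")
  case False
  hence d: "0 < d" by simp
  define b where "b = (\<lambda>k::int. of_int k * a k)"
  \<comment> \<open>The factor \<open>c\<close> balances the mean in \<open>form_bound\<close>:
    testing the column against itself gives \<open>c * S \<le> c * (S + c\<^sup>2) / 2\<close>,
    hence \<open>S \<le> c\<^sup>2\<close>.\<close>
  define e where "e = (\<lambda>p::nat. if p = 0 then of_real c else 0 :: complex)"
  have ne: "nsq d e = c\<^sup>2"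
  proof -
    have "nsq d e = (\<Sum>p<d. if p = 0 then c\<^sup>2 else 0)"
      unfolding nsq_def by (intro sum.cong refl) (auto simp: e_def)
    thus ?thesis using d by simp
  qed
  have half: "S \<le> c\<^sup>2" if "c * S \<le> c * (S + c\<^sup>2) / 2" for S
    using that \<open>0 < c\<close> by (simp add: field_simps)
  have l1: "(\<Sum>p<d. cmod (x p)) \<le> c * sqrt (real d)" if "nsq d x \<le> c\<^sup>2" for x
  proof -
    define s where "s = sqrt (real d)"
    have s: "0 < s" "real d = s * s" using d by (simp_all add: s_def)
    have "(\<Sum>p<d. cmod (x p)) \<le> (\<Sum>p<d. (c / s + s / c * (cmod (x p))\<^sup>2) / 2)"
    proof (rule sum_mono)
      fix p
      \<comment> \<open>A weighted mean inequality in the role of Cauchy-Schwarz; with these weights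
        each of the two terms sums to at most \<open>c * s\<close>.\<close>
      have "2 * (sqrt (c / s) * (sqrt (s / c) * cmod (x p))) \<le> (sqrt (c / s))\<^sup>2 + (sqrt (s / c) * cmod (x p))\<^sup>2"
        by (rule two_mult_le_sum_squares)
      moreover have "sqrt (c / s) * (sqrt (s / c) * cmod (x p)) = cmod (x p)"
        using s \<open>0 < c\<close> by (simp add: mult.assoc[symmetric] real_sqrt_mult[symmetric])
      ultimately show "cmod (x p) \<le> (c / s + s / c * (cmod (x p))\<^sup>2) / 2"
        using s \<open>0 < c\<close> by (simp add: power_mult_distrib)
    qed
    also have "\<dots> = (real d * (c / s) + s / c * nsq d x) / 2"
      unfolding nsq_def by (simp add: sum.distrib sum_distrib_left sum_divide_distrib[symmetric])
    also have "\<dots> \<le> (real d * (c / s) + s / c * c\<^sup>2) / 2"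
      using that s \<open>0 < c\<close> by (intro divide_right_mono add_left_mono mult_left_mono) auto
    also have "\<dots> = c * s" using s(1) \<open>0 < c\<close> by (simp add: s(2) power2_eq_square)
    finally show ?thesis by (simp add: s_def)
  qed
  have col: "nsq d (\<lambda>p. b (int p)) \<le> c\<^sup>2"
  proof (rule half)
    let ?x = "\<lambda>p. b (int p)"
    have "sform d (\<lambda>p q. b (int p - int q)) ?x e = (\<Sum>p<d. cnj (?x p) * ?x p * of_real c)"
      unfolding sform_def
    proof (rule sum.cong[OF refl])
      fix p
      have "(\<Sum>q<d. cnj (b (int p)) * b (int p - int q) * e q) =
         (\<Sum>q<d. if q = 0 then cnj (?x p) * ?x p * of_real c else 0)"
        by (intro sum.cong refl) (auto simp: e_def)
      thus "(\<Sum>q<d. cnj (b (int p)) * b (int p - int q) * e q) = cnj (?x p) * ?x p * of_real c"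
        using d by simp
    qed
    also have "\<dots> = of_real (c * nsq d ?x)"
      by (simp add: nsq_eq sum_distrib_left mult_ac)
    finally have "sform d (\<lambda>p q. b (int p - int q)) ?x e = of_real (c * nsq d ?x)" .
    moreover have "cmod (sform d (\<lambda>p q. b (int p - int q)) ?x e) \<le> c * (nsq d ?x + nsq d e) / 2"
      using fb unfolding form_bound_def b_def by blast
    ultimately show "c * nsq d ?x \<le> c * (nsq d ?x + c\<^sup>2) / 2"
      using \<open>0 < c\<close> nsq_nonneg[of d ?x] by (simp add: ne norm_mult)
  qed
  have row: "nsq d (\<lambda>p. b (- int p)) \<le> c\<^sup>2"
  proof (rule half)
    let ?y = "\<lambda>q. b (- int q)"
    have "sform d (\<lambda>p q. b (int p - int q)) e (\<lambda>q. cnj (?y q)) =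
      (\<Sum>q<d. \<Sum>p<d. if p = 0 then of_real c * (cnj (?y q) * ?y q) else 0)"
      unfolding sform_def by (subst sum.swap) (intro sum.cong refl, auto simp: e_def)
    also have "\<dots> = of_real (c * nsq d ?y)"
      using d by (simp add: nsq_eq sum_distrib_left)
    finally have "sform d (\<lambda>p q. b (int p - int q)) e (\<lambda>q. cnj (?y q)) = of_real (c * nsq d ?y)" .
    moreover have "cmod (sform d (\<lambda>p q. b (int p - int q)) e (\<lambda>q. cnj (?y q)))
       \<le> c * (nsq d e + nsq d (\<lambda>q. cnj (?y q))) / 2"
      using fb unfolding form_bound_def b_def by blast
    moreover have "nsq d (\<lambda>q. cnj (?y q)) = nsq d ?y" by (simp add: nsq_def)
    ultimately show "c * nsq d ?y \<le> c * (nsq d ?y + c\<^sup>2) / 2"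
      using \<open>0 < c\<close> nsq_nonneg[of d ?y] by (simp add: ne norm_mult add.commute)
  qed
  have "(\<Sum>k\<in>diags d. cmod (b k)) \<le>
     (\<Sum>k\<in>int ` {..<d} \<union> (\<lambda>p. - int p) ` {..<d}. cmod (b k))"
  proof (rule sum_mono2)
    show "diags d \<subseteq> int ` {..<d} \<union> (\<lambda>p. - int p) ` {..<d}"
    proof
      fix k assume "k \<in> diags d"
      thus "k \<in> int ` {..<d} \<union> (\<lambda>p. - int p) ` {..<d}"
        by (cases k rule: int_cases2) (auto simp: diags_def)
    qed
  qed auto
  also have "\<dots> \<le> (\<Sum>k\<in>int ` {..<d}. cmod (b k)) + (\<Sum>k\<in>(\<lambda>p. - int p) ` {..<d}. cmod (b k))"
    by (simp add: sum_Un sum_nonneg)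
  also have "\<dots> = (\<Sum>p<d. cmod (b (int p))) + (\<Sum>p<d. cmod (b (- int p)))"
    by (simp add: sum.reindex inj_on_def)
  also have "\<dots> \<le> c * sqrt (real d) + c * sqrt (real d)"
    by (intro add_mono l1[OF col] l1[OF row])
  finally show ?thesis by (simp add: b_def)
qed (simp add: diags_def)

section \<open>Toeplitz compressions of functions and symbols of Toeplitz matrices\<close>

text \<open>
  The compression of multiplication by \<open>f\<close>, with the integral over the circle replaced by the
  average over the \<open>N\<close>-th roots of unity.
\<close>

definition rcoef :: "nat \<Rightarrow> (complex \<Rightarrow> complex) \<Rightarrow> int \<Rightarrow> complex" where
  "rcoef N f k = (\<Sum>j<N. f (rou N j) * cis (2 * pi * real j * of_int k / real N)) / of_nat N"

definition compr :: "nat \<Rightarrow> nat \<Rightarrow> (complex \<Rightarrow> complex) \<Rightarrow> complex mat" where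
  "compr d N f = toep d (rcoef N f)"

lemma compr_in [simp]: "compr d N f \<in> toeplitz_mats d" "compr d N f \<in> carrier_mat d d"
  by (simp_all add: compr_def)

lemma cis_diff_evec:
  "cis (2 * pi * real j * of_int (int p - int q) / real N) = evec (rou N j) p * cnj (evec (rou N j) q)"
  unfolding evec_def rou_power cis_cnj cis_mult
  by (rule arg_cong[of _ _ cis]) (simp add: field_simps diff_divide_distrib)

text \<open>The matrix is the grid average of \<open>f(w) e_w e_w*\<close>, since
  \<open>rcoef\<close> uses the exponent \<open>p - q\<close> with positive sign. Norm bound,
  positivity and the Fejer mean on the diagonal are all read off from this.\<close>

lemma sform_compr:
  "sform d (entries (compr d N f)) x y =
   (\<Sum>j<N. f (rou N j) * (cnj (\<Sum>p<d. cnj (evec (rou N j) p) * x p) *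
                          (\<Sum>p<d. cnj (evec (rou N j) p) * y p))) / of_nat N"
proof -
  have "sform d (entries (compr d N f)) x y =
     sform d (\<lambda>p q. \<Sum>j<N. f (rou N j) / of_nat N * (evec (rou N j) p * cnj (evec (rou N j) q))) x y"
    unfolding compr_def sform_entries_toep
    by (rule sform_cong) (simp_all only: rcoef_def cis_diff_evec sum_divide_distrib times_divide_eq_left)
  also have "\<dots> = (\<Sum>j<N. f (rou N j) / of_nat N * (cnj (\<Sum>p<d. cnj (evec (rou N j) p) * x p) *
                          (\<Sum>p<d. cnj (evec (rou N j) p) * y p)))"
    by (simp only: sform_sum sform_scale sform_rank1)
  finally show ?thesis
    by (simp only: sum_divide_distrib times_divide_eq_left)
qed

lemma form_bound_compr:
  assumes "d \<le> N" "0 < N" "\<And>j. j < N \<Longrightarrow> cmod (f (rou N j)) \<le> c"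
  shows "form_bound d (entries (compr d N f)) c"
  unfolding form_bound_def
proof (intro allI)
  fix x y
  define X where "X = (\<lambda>j. \<Sum>p<d. cnj (evec (rou N j) p) * x p)"
  define Y where "Y = (\<lambda>j. \<Sum>p<d. cnj (evec (rou N j) p) * y p)"
  have "cmod (\<Sum>j<N. f (rou N j) * (cnj (X j) * Y j)) \<le> (\<Sum>j<N. c * (((cmod (X j))\<^sup>2 + (cmod (Y j))\<^sup>2) / 2))"
  proof (rule order_trans[OF norm_sum], rule sum_mono)
    fix j assume "j \<in> {..<N}"
    hence f: "cmod (f (rou N j)) \<le> c" using assms by simp
    hence "0 \<le> c" using norm_ge_zero order_trans by blast
    moreover have "cmod (X j) * cmod (Y j) \<le> ((cmod (X j))\<^sup>2 + (cmod (Y j))\<^sup>2) / 2"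
      using two_mult_le_sum_squares[of "cmod (X j)" "cmod (Y j)"] by simp
    ultimately show "cmod (f (rou N j) * (cnj (X j) * Y j)) \<le> c * (((cmod (X j))\<^sup>2 + (cmod (Y j))\<^sup>2) / 2)"
      unfolding norm_mult complex_mod_cnj using f by (intro mult_mono) auto
  qed
  also have "\<dots> = c * ((\<Sum>j<N. (cmod (X j))\<^sup>2) + (\<Sum>j<N. (cmod (Y j))\<^sup>2)) / 2"
    by (simp add: sum_distrib_left[symmetric] sum_divide_distrib[symmetric] sum.distrib)
  also have "\<dots> = real N * (c * (nsq d x + nsq d y) / 2)"
    unfolding X_def Y_def parseval_rou_norm[OF assms(1)] by (simp add: algebra_simps)
  finally show "cmod (sform d (entries (compr d N f)) x y) \<le> c * (nsq d x + nsq d y) / 2"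
    using assms(2) unfolding sform_compr X_def[symmetric, THEN fun_cong] Y_def[symmetric, THEN fun_cong]
    by (simp add: norm_divide pos_divide_le_eq mult.commute)
qed

lemma compr_add: "compr d N (\<lambda>z. f z + g z) = compr d N f + compr d N g"
  unfolding compr_def toep_add
  by (rule toep_cong) (simp add: rcoef_def distrib_right sum.distrib add_divide_distrib)

lemma compr_scale: "compr d N (\<lambda>z. c * f z) = c \<cdot>\<^sub>m compr d N f"
  unfolding compr_def toep_smult
  by (rule toep_cong) (simp add: rcoef_def sum_distrib_left mult.assoc)

lemma rcoef_const:
  assumes "\<And>j. j < N \<Longrightarrow> f (rou N j) = c" "\<bar>k\<bar> < int N"
  shows "rcoef N f k = (if k = 0 then c else 0)"
proof -
  have "rcoef N f k = c * (\<Sum>j<N. cis (2 * pi * of_int k / real N) ^ j) / of_nat N"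
    unfolding rcoef_def sum_distrib_left DeMoivre
    by (intro arg_cong2[of _ _ _ _ "(/)"] sum.cong refl) (simp add: assms mult_ac)
  thus ?thesis using sum_rou_powers[of k N] assms(2) by auto
qed

text \<open>With \<open>d \<le> N\<close> no diagonal other than the main one has an index divisible
  by \<open>N\<close>, where a constant would leave a trace. This makes the pull-back
  unital.\<close>

lemma compr_const:
  assumes "\<And>z. cmod z = 1 \<Longrightarrow> f z = c" "d \<le> N" "0 < d"
  shows "compr d N f = c \<cdot>\<^sub>m 1\<^sub>m d"
  unfolding compr_def toep_one toep_smult
  by (rule toep_cong) (use assms in \<open>auto simp: rcoef_const\<close>)

lemma psd_block_compr:
  assumes "\<forall>z\<in>sphere 0 1. psd (Matrix.mat k k (\<lambda>(i, j). X i j z))"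
  shows "psd (block_mat k d (\<lambda>i j. compr d N (X i j)))"
  unfolding psd_block_mat_iff
proof
  fix x :: "nat \<Rightarrow> nat \<Rightarrow> complex"
  define Y where "Y = (\<lambda>l i. \<Sum>p<d. cnj (evec (rou N l) p) * x i p)"
  have "(\<Sum>i<k. \<Sum>j<k. sform d (entries (compr d N (X i j))) (x i) (x j)) =
     (\<Sum>i<k. \<Sum>j<k. \<Sum>l<N. X i j (rou N l) * (cnj (Y l i) * Y l j)) / of_nat N"
    unfolding sform_compr Y_def sum_divide_distrib ..
  also have "(\<Sum>i<k. \<Sum>j<k. \<Sum>l<N. X i j (rou N l) * (cnj (Y l i) * Y l j)) =
      (\<Sum>i<k. \<Sum>l<N. \<Sum>j<k. X i j (rou N l) * (cnj (Y l i) * Y l j))"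
    by (intro sum.cong refl sum.swap)
  also have "\<dots> = (\<Sum>l<N. \<Sum>i<k. \<Sum>j<k. X i j (rou N l) * (cnj (Y l i) * Y l j))"
    by (rule sum.swap)
  also have "\<dots> = (\<Sum>l<N. sform k (\<lambda>i j. X i j (rou N l)) (Y l) (Y l))"
    by (simp add: sform_def mult_ac)
  finally have eq: "(\<Sum>i<k. \<Sum>j<k. sform d (entries (compr d N (X i j))) (x i) (x j)) =
     (\<Sum>l<N. sform k (\<lambda>i j. X i j (rou N l)) (Y l) (Y l)) / of_nat N" .
  have "0 \<le> sform k (\<lambda>i j. X i j (rou N l)) (Y l) (Y l)" for l
  proof -
    have "psd (Matrix.mat k k (\<lambda>(i, j). X i j (rou N l)))" using assms by simp
    hence "0 \<le> sform k (entries (Matrix.mat k k (\<lambda>(i, j). X i j (rou N l)))) (Y l) (Y l)"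
      using psd_iff_sform[of "Matrix.mat k k (\<lambda>(i, j). X i j (rou N l))" k] by simp
    also have "\<dots> = sform k (\<lambda>i j. X i j (rou N l)) (Y l) (Y l)"
      by (rule sform_cong) auto
    finally show ?thesis .
  qed
  hence "0 \<le> (\<Sum>l<N. sform k (\<lambda>i j. X i j (rou N l)) (Y l) (Y l))" by (intro sum_nonneg)
  thus "0 \<le> (\<Sum>i<k. \<Sum>j<k. sform d (entries (compr d N (X i j))) (x i) (x j))"
    unfolding eq by (auto simp: less_eq_complex_def)
qed

lemma toeplitz_sys_simps [simp]:
  "os_carrier (toeplitz_sys d) = toeplitz_mats d" "os_add (toeplitz_sys d) = (+)"
  "os_scale (toeplitz_sys d) = (\<cdot>\<^sub>m)" "os_unit (toeplitz_sys d) = 1\<^sub>m d"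
  "os_pos (toeplitz_sys d) k X = psd (block_mat k d X)"
  by (simp_all add: toeplitz_sys_def)

lemma circle_sys_simps [simp]:
  "os_carrier circle_sys = C_circle" "os_add circle_sys = (\<lambda>f g z. f z + g z)"
  "os_scale circle_sys = (\<lambda>c f z. c * f z)"
  "os_unit circle_sys = (\<lambda>z. if z \<in> sphere 0 1 then 1 else 0)"
  "os_pos circle_sys k F = (\<forall>z \<in> sphere 0 1. psd (Matrix.mat k k (\<lambda>(i, j). F i j z)))"
  by (simp_all add: circle_sys_def)

lemma one_toeplitz [simp]: "1\<^sub>m d \<in> toeplitz_mats d"
  by (simp add: toep_one)

lemma toeplitz_closed:
  assumes "S \<in> toeplitz_mats d" "T \<in> toeplitz_mats d"
  shows "S + T \<in> toeplitz_mats d" "S - T \<in> toeplitz_mats d" "c \<cdot>\<^sub>m T \<in> toeplitz_mats d"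
  using assms by (auto elim!: toeplitz_matsE simp: toep_add toep_diff toep_smult)

section \<open>The pull-back along the compression, and contractivity on both systems\<close>

definition pull :: "nat \<Rightarrow> nat \<Rightarrow> (complex mat \<Rightarrow> complex mat) \<Rightarrow> (complex \<Rightarrow> complex) \<Rightarrow> complex mat" where
  "pull d N \<phi> = (\<lambda>f\<in>C_circle. \<phi> (compr d N f))"

lemma C_circle_closed:
  "f \<in> C_circle \<Longrightarrow> g \<in> C_circle \<Longrightarrow> (\<lambda>z. f z + g z) \<in> C_circle"
  "f \<in> C_circle \<Longrightarrow> g \<in> C_circle \<Longrightarrow> (\<lambda>z. f z - g z) \<in> C_circle"
  "f \<in> C_circle \<Longrightarrow> (\<lambda>z. c * f z) \<in> C_circle"
  "f \<in> C_circle \<Longrightarrow> (\<lambda>z. cnj (f z)) \<in> C_circle"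
  by (auto simp: C_circle_def intro!: continuous_intros)

lemma circle_const_in: "(\<lambda>z. if z \<in> sphere 0 1 then c else 0) \<in> C_circle"
proof -
  have "continuous_on (sphere 0 1) (\<lambda>z::complex. if z \<in> sphere 0 1 then c else 0) \<longleftrightarrow>
        continuous_on (sphere 0 1) (\<lambda>z::complex. c)"
    by (rule continuous_on_cong) auto
  thus ?thesis by (auto simp: C_circle_def)
qed

lemma pull_UCP:
  assumes \<phi>: "\<phi> \<in> UCP (toeplitz_sys d) n" and d: "0 < d" "d \<le> N"
  shows "pull d N \<phi> \<in> UCP circle_sys n"
proof -
  note lin = UCP_D(2)[OF \<phi>]
  have "os_linear circle_sys n (pull d N \<phi>)"
    using lin by (auto simp: os_linear_def pull_def C_circle_closed compr_add compr_scale)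
  moreover have "psd (block_mat k n (\<lambda>i j. pull d N \<phi> (X i j)))"
    if X: "\<forall>i<k. \<forall>j<k. X i j \<in> C_circle" "\<forall>z\<in>sphere 0 1. psd (Matrix.mat k k (\<lambda>(i, j). X i j z))" for k X
  proof -
    have "psd (block_mat k n (\<lambda>i j. \<phi> (compr d N (X i j))))"
      using UCP_D(1)[OF \<phi>] psd_block_compr[OF X(2), of d N] unfolding completely_positive_def by simp
    thus ?thesis
      using X(1) unfolding psd_block_mat_iff by (simp add: pull_def)
  qed
  moreover have "pull d N \<phi> (os_unit circle_sys) = 1\<^sub>m n"
  proof -
    have "compr d N (os_unit circle_sys) = 1 \<cdot>\<^sub>m 1\<^sub>m d" by (rule compr_const) (use d in auto)
    moreover have "1 \<cdot>\<^sub>m 1\<^sub>m d = (1\<^sub>m d :: complex mat)" by (intro eq_matI) auto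
    ultimately show ?thesis using UCP_D(3)[OF \<phi>] circle_const_in[of 1] by (simp add: pull_def)
  qed
  ultimately show ?thesis
    by (auto simp: UCP_def CP_def completely_positive_def pull_def)
qed

text \<open>The adjoint of a Toeplitz matrix is Toeplitz with coefficients
  \<open>cnj (a (- k))\<close>; it is the \<open>y\<close> of the 2 x 2 trick.\<close>

lemma toeplitz_UCP_form_bound:
  assumes \<phi>: "\<phi> \<in> UCP (toeplitz_sys d) n" and fb: "form_bound d (entries (toep d a)) c"
  shows "form_bound n (entries (\<phi> (toep d a))) c"
proof (rule UCP_form_bound[OF \<phi>, where y = "toep d (\<lambda>k. cnj (a (- k)))"])
  let ?Y = "toep d (\<lambda>k. cnj (a (- k)))"
  have sym: "?Y $$ (p, q) = cnj (toep d a $$ (q, p))" if "p < d" "q < d" for p q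
    using that by (simp add: toep_index)
  have u: "sform d (entries (of_real c \<cdot>\<^sub>m 1\<^sub>m d)) z z = of_real (c * nsq d z)" for z
  proof -
    have "sform d (entries (of_real c \<cdot>\<^sub>m 1\<^sub>m d)) z z = sform d (\<lambda>a b. if a = b then of_real c else 0) z z"
      by (rule sform_cong) auto
    thus ?thesis by (simp add: sform_one nsq_eq)
  qed
  have "0 \<le> complex_of_real (c * (nsq d (x 0) + nsq d (x 1))) + sform d (entries (toep d a)) (x 0) (x 1)
         + sform d (entries ?Y) (x 1) (x 0)" for x
    by (rule psd_if_form_bound[OF fb]) (rule sym)
  thus "os_pos (toeplitz_sys d) 2
     (\<lambda>i j. if i = j then os_scale (toeplitz_sys d) (of_real c) (os_unit (toeplitz_sys d))
        else if i = 0 then toep d a else ?Y)"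
    by (auto simp: psd_block_mat_iff sum_lessThan_2 u algebra_simps simp flip: One_nat_def)
qed (simp_all add: toeplitz_closed(3)[OF one_toeplitz one_toeplitz])

lemma circle_UCP_form_bound:
  assumes \<phi>: "\<phi> \<in> UCP circle_sys n" and f: "f \<in> C_circle" and le: "\<And>z. cmod z = 1 \<Longrightarrow> cmod (f z) \<le> c"
  shows "form_bound n (entries (\<phi> f)) c"
proof (rule UCP_form_bound[OF \<phi>, where y = "\<lambda>z. cnj (f z)"])
  have cc: "os_scale circle_sys (of_real c) (os_unit circle_sys) = (\<lambda>z. if z \<in> sphere 0 1 then of_real c else 0)"
    by (auto simp: circle_sys_def)
  show "os_scale circle_sys (of_real c) (os_unit circle_sys) \<in> os_carrier circle_sys"
    unfolding cc using circle_const_in by simp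
  show "os_pos circle_sys 2
     (\<lambda>i j. if i = j then os_scale circle_sys (of_real c) (os_unit circle_sys)
        else if i = 0 then f else (\<lambda>z. cnj (f z)))"
    unfolding cc unfolding circle_sys_simps(5)
  proof
    fix z :: complex assume z: "z \<in> sphere 0 1"
    let ?M = "Matrix.mat 2 2 (\<lambda>(i, j). (if i = j then \<lambda>z. if z \<in> sphere 0 1 then complex_of_real c else 0
        else if i = 0 then f else (\<lambda>z. cnj (f z))) z)"
    have "form_bound 1 (\<lambda>_ _. f z) c"
      using form_bound_entries[of 1 "\<lambda>_ _. f z" c] le z by simp
    hence *: "0 \<le> complex_of_real (c * (nsq 1 (\<lambda>_. u)  + nsq 1 (\<lambda>_. v))) + sform 1 (\<lambda>_ _. f z) (\<lambda>_. u) (\<lambda>_. v)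
        + sform 1 (\<lambda>_ _. cnj (f z)) (\<lambda>_. v) (\<lambda>_. u)" for u v
      by (rule psd_if_form_bound) simp
    have "0 \<le> sform 2 (entries ?M) x x" for x
    proof -
      have "sform 2 (entries ?M) x x = complex_of_real (c * (nsq 1 (\<lambda>_. x 0)  + nsq 1 (\<lambda>_. x 1)))
        + sform 1 (\<lambda>_ _. f z) (\<lambda>_. x 0) (\<lambda>_. x 1) + sform 1 (\<lambda>_ _. cnj (f z)) (\<lambda>_. x 1) (\<lambda>_. x 0)"
        using z by (simp add: sform_def nsq_def sum_lessThan_2 complex_norm_square algebra_simps del: of_real_power)
      thus ?thesis using * by simp
    qed
    thus "psd ?M" using psd_iff_sform[of ?M 2] by simp
  qed
qed (use f circle_const_in[of 1] in \<open>auto simp: C_circle_closed\<close>)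

section \<open>Lipschitz functions on the circle\<close>

lemma vector_derivative_bound:
  fixes g :: "real \<Rightarrow> complex"
  assumes "\<And>x. (g has_vector_derivative g' x) (at x)" "\<And>x. x \<in> closed_segment s t \<Longrightarrow> cmod (g' x) \<le> B"
  shows "cmod (g s - g t) \<le> B * \<bar>s - t\<bar>"
proof -
  have "norm (g s - g t) \<le> B * norm (s - t)"
  proof (rule differentiable_bound[where S = "closed_segment s t"])
    fix x assume x: "x \<in> closed_segment s t"
    show "(g has_derivative (\<lambda>h. h *\<^sub>R g' x)) (at x within closed_segment s t)"
      using assms(1)[of x] by (simp add: has_vector_derivative_def has_derivative_at_withinI)
    show "onorm (\<lambda>h. h *\<^sub>R g' x) \<le> B"
      by (rule onorm_le) (simp add: mult.commute[of B] mult_left_mono assms(2)[OF x])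
  qed auto
  thus ?thesis by simp
qed

lemma has_vector_derivative_cis_linear:
  "((\<lambda>t. cis (k * t)) has_vector_derivative (\<i> * of_real k * cis (k * t))) (at t)"
  unfolding has_vector_derivative_def
  by (auto intro!: derivative_eq_intros simp: scaleR_conv_of_real)

lemma norm_cis_diff_le: "cmod (cis s - cis t) \<le> \<bar>s - t\<bar>"
  using vector_derivative_bound[of cis "\<lambda>t. \<i> * of_real 1 * cis (1 * t)" s t 1]
    has_vector_derivative_cis_linear[of 1] by (simp add: norm_mult)

lemma norm_cis_second_order: "cmod (cis s - 1 - \<i> * of_real s) \<le> s\<^sup>2"
proof -
  have "cmod ((cis s - \<i> * of_real s) - (cis 0 - \<i> * of_real 0)) \<le> \<bar>s\<bar> * \<bar>s - 0\<bar>"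
  proof (rule vector_derivative_bound[where g = "\<lambda>s. cis s - \<i> * of_real s"])
    show "((\<lambda>s. cis s - \<i> * of_real s) has_vector_derivative (\<i> * (cis x - 1))) (at x)" for x
      unfolding has_vector_derivative_def
      by (auto intro!: derivative_eq_intros simp: scaleR_conv_of_real algebra_simps)
    fix x assume "x \<in> closed_segment s 0"
    hence "\<bar>x\<bar> \<le> \<bar>s\<bar>" by (auto simp: closed_segment_eq_real_ivl split: if_splits)
    thus "cmod (\<i> * (cis x - 1)) \<le> \<bar>s\<bar>"
      using norm_cis_diff_le[of x 0] by (simp add: norm_mult)
  qed
  thus ?thesis by (simp add: power2_eq_square algebra_simps)
qed

lemma cmod_cis_minus_1: "cmod (cis s - 1) = 2 * \<bar>sin (s / 2)\<bar>"
proof -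
  have "cis s - 1 = cis (s / 2) * (cis (s / 2) - cis (- (s / 2)))"
    by (simp add: algebra_simps cis_mult)
  also have "cis (s / 2) - cis (- (s / 2)) = 2 * \<i> * of_real (sin (s / 2))"
    by (simp add: complex_eq_iff)
  finally show ?thesis by (simp add: norm_mult)
qed

text \<open>A weak form of Jordan's inequality. At a quarter of the angle cosines are at least
  \<open>sqrt 2 / 2\<close>, which bounds \<open>sin x\<close> below by the mean value theorem and
  then \<open>sin (2 * x)\<close> by duplication.\<close>

lemma abs_le_cmod_cis_minus_1:
  assumes "\<bar>s\<bar> \<le> pi" shows "\<bar>s\<bar> \<le> 2 * cmod (cis s - 1)"
proof -
  define x where "x = \<bar>s\<bar> / 4"
  have x: "0 \<le> x" "x \<le> pi / 4" using assms by (auto simp: x_def)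
  have cos_ge: "sqrt 2 / 2 \<le> cos y" if "0 \<le> y" "y \<le> x" for y
  proof -
    have "cos (pi / 4) \<le> cos y" using that x pi_gt_zero by (intro cos_monotone_0_pi_le) auto
    thus ?thesis by (simp add: cos_45)
  qed
  have sx: "sqrt 2 / 2 * x \<le> sin x"
  proof (cases "x = 0")
    case False
    then obtain z where z: "0 < z" "z < x" "sin x - sin 0 = (x - 0) * cos z"
      using MVT2[of 0 x sin cos] x DERIV_sin by auto
    thus ?thesis using cos_ge[of z] x mult_left_mono[of "sqrt 2 / 2" "cos z" x] by (simp add: mult.commute)
  qed auto
  have "x = x * (sqrt 2 * sqrt 2) / 2" by simp
  also have "\<dots> = 2 * (sqrt 2 / 2 * x) * (sqrt 2 / 2)" by (simp only: field_simps)
  also have "\<dots> \<le> 2 * sin x * cos x"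
    using sx cos_ge[of x] x sin_ge_zero[of x] by (intro mult_mono) auto
  also have "\<dots> = sin (\<bar>s\<bar> / 2)" using sin_double[of x] by (simp add: x_def)
  finally have "\<bar>s\<bar> / 4 \<le> sin (\<bar>s\<bar> / 2)" by (simp add: x_def)
  moreover have "\<bar>sin (s / 2)\<bar> = \<bar>sin (\<bar>s\<bar> / 2)\<bar>" by (cases "0 \<le> s") auto
  ultimately show ?thesis by (simp add: cmod_cis_minus_1)
qed

definition lip1 :: "(complex \<Rightarrow> complex) set" where
  "lip1 = {f \<in> C1_circle. \<forall>t. cmod (circle_deriv f t) \<le> 1}"

lemma lip1_arc:
  assumes "f \<in> lip1" shows "cmod (f (cis s) - f (cis t)) \<le> \<bar>s - t\<bar>"
proof -
  obtain D where D: "\<And>x. ((\<lambda>t. f (cis t)) has_vector_derivative D x) (at x)"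
    using assms unfolding lip1_def C1_circle_def C1_differentiable_on_def by auto
  have "circle_deriv f x = D x" for x
    unfolding circle_deriv_def by (rule vector_derivative_at[OF D])
  hence "cmod (D x) \<le> 1" for x using assms by (auto simp: lip1_def)
  thus ?thesis using vector_derivative_bound[OF D, of s t 1] by simp
qed

lemma unit_circle_cis:
  assumes "cmod w = 1" "cmod z = 1"
  obtains s t where "w = cis s" "z = cis t" "\<bar>s - t\<bar> \<le> 2 * cmod (z - w)"
proof -
  define u where "u = z * cnj w"
  have "cmod u = 1" using assms by (simp add: u_def norm_mult)
  have cis: "v = cis (Arg v)" if "cmod v = 1" for v
    using cis_Arg[of v] that by (cases "v = 0") (auto simp: sgn_div_norm)
  note u = cis[OF \<open>cmod u = 1\<close>] and w = cis[OF assms(1)]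
  have "w * cnj w = 1" by (rule unit_mult_cnj[OF assms(1)])
  hence z: "z = cis (Arg w + Arg u)"
    unfolding cis_mult[symmetric] using u w by (metis mult.assoc mult.commute mult_1 u_def)
  have "w * (u - 1) = z * (w * cnj w) - w" by (simp add: u_def algebra_simps)
  hence "cmod (z - w) = cmod (w * (u - 1))" by (simp add: \<open>w * cnj w = 1\<close>)
  also have "\<dots> = cmod (cis (Arg u) - 1)" using assms u by (simp add: norm_mult)
  finally have "\<bar>Arg w - (Arg w + Arg u)\<bar> \<le> 2 * cmod (z - w)"
    using abs_le_cmod_cis_minus_1[of "Arg u"] Arg_bounded[of u] by (simp add: abs_le_iff)
  thus ?thesis using that w z by blast
qed

text \<open>Derivative bounds live on arcs, Dirichlet bounds on chords. The factor 2 enters only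
  errors and crude bounds, never the leading constant 1 in the comparison of the two
  distances.\<close>

lemma lip1_chord:
  assumes "f \<in> lip1" "cmod w = 1" "cmod z = 1" shows "cmod (f w - f z) \<le> 2 * cmod (z - w)"
  using lip1_arc[OF assms(1)] unit_circle_cis[OF assms(2,3)] order_trans by metis

lemma lip1_in: "f \<in> lip1 \<Longrightarrow> f \<in> C_circle"
  by (simp add: lip1_def C1_circle_def)

lemma sum_lessThan_rotate:
  fixes h :: "nat \<Rightarrow> 'a :: ab_group_add"
  assumes "h N = h 0" shows "(\<Sum>j<N. h (Suc j)) = (\<Sum>j<N. h j)"
  using sum.lessThan_Suc_shift[of h N] assms by simp

text \<open>One grid step permutes the \<open>N\<close>-th roots of unity, so the substitution is a
  cyclic shift of the summation index; it closes up because \<open>k\<close> is an integer.\<close>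

lemma rcoef_rotate:
  assumes "0 < N"
  shows "cis (2 * pi * of_int k / real N) * rcoef N f k = rcoef N (\<lambda>z. f (z * cis (- (2 * pi / real N)))) k"
proof -
  define h where "h = (\<lambda>j. f (rou N j * cis (- (2 * pi / real N))) * cis (2 * pi * real j * of_int k / real N))"
  have N: "real N \<noteq> 0" using assms by simp
  have "h (Suc j) = cis (2 * pi * of_int k / real N) * (f (rou N j) * cis (2 * pi * real j * of_int k / real N))" for j
  proof -
    have "rou N (Suc j) * cis (- (2 * pi / real N)) = rou N j"
      unfolding rou_def cis_mult by (rule arg_cong[of _ _ cis]) (use N in \<open>simp add: field_simps\<close>)
    moreover have "cis (2 * pi * real (Suc j) * of_int k / real N) =
        cis (2 * pi * of_int k / real N) * cis (2 * pi * real j * of_int k / real N)"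
      unfolding cis_mult by (rule arg_cong[of _ _ cis]) (use N in \<open>simp add: field_simps\<close>)
    ultimately show ?thesis by (simp add: h_def)
  qed
  moreover have "h N = h 0"
    using N cis_multiple_2pi[of "of_int k"] by (simp add: h_def rou_def mult.assoc)
  ultimately show ?thesis
    using sum_lessThan_rotate[of h N]
    by (simp add: rcoef_def h_def sum_distrib_left)
qed

lemma rcoef_bound:
  assumes "0 < N" "\<And>j. j < N \<Longrightarrow> cmod (f (rou N j)) \<le> c"
  shows "cmod (rcoef N f k) \<le> c"
proof -
  have "cmod (\<Sum>j<N. f (rou N j) * cis (2 * pi * real j * of_int k / real N)) \<le> (\<Sum>j<N. c)"
    by (rule order_trans[OF norm_sum], rule sum_mono) (use assms in \<open>simp add: norm_mult\<close>)
  thus ?thesis using assms(1) by (simp add: rcoef_def norm_divide field_simps)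
qed

lemma rcoef_diff: "rcoef N (\<lambda>z. f z - g z) k = rcoef N f k - rcoef N g k"
  by (simp add: rcoef_def left_diff_distrib sum_subtractf diff_divide_distrib)

text \<open>Constants do not contribute to these coefficients, and \<open>f - f 1\<close> is at most
  twice a chord of length at most 2.\<close>

lemma lip1_rcoef_le:
  assumes "f \<in> lip1" "k \<noteq> 0" "\<bar>k\<bar> < int N" shows "cmod (rcoef N f k) \<le> 4"
proof -
  have "rcoef N f k = rcoef N (\<lambda>z. f z - f 1) k"
    using rcoef_const[of N "\<lambda>_. f 1" "f 1" k] assms(2,3) by (simp add: rcoef_diff)
  also have "cmod \<dots> \<le> 4"
  proof (rule rcoef_bound)
    fix j
    have "cmod (f (rou N j) - f 1) \<le> 2 * cmod (1 - rou N j)"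
      using lip1_chord[OF assms(1), of "rou N j" 1] by simp
    also have "cmod (1 - rou N j) \<le> 2" using norm_triangle_ineq4[of 1 "rou N j"] by simp
    finally show "cmod (f (rou N j) - f 1) \<le> 4" by simp
  qed (use assms in auto)
  finally show ?thesis .
qed

text \<open>
  The commutator with \<open>D\<close> is compared with the difference quotient of the rotation by \<open>2 \<pi> / N\<close>,
  which leaves the grid of \<open>N\<close>-th roots invariant.
\<close>

lemma form_bound_commutator_compr:
  assumes f: "f \<in> lip1" and d: "0 < d" "d \<le> N"
  shows "form_bound d (\<lambda>p q. of_int (int p - int q) * rcoef N f (int p - int q))
            (1 + 8 * pi * real d ^ 3 / real N)"
proof -
  define th where "th = 2 * pi / real N"
  have th: "0 < th" using d by (simp add: th_def)
  define b where "b = (\<lambda>k::int. (cis (th * of_int k) - 1) * rcoef N f k)"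
  define g where "g = (\<lambda>z. f (z * cis (- th)) - f z)"
  have b: "b k = rcoef N g k" for k
    using rcoef_rotate[of N k f] d
    by (simp add: b_def g_def rcoef_diff left_diff_distrib th_def)
  have "form_bound d (entries (compr d N g)) th"
  proof (rule form_bound_compr)
    fix j
    have "rou N j = cis (2 * pi * real j / real N)" by (simp add: rou_def)
    moreover from this have "rou N j * cis (- th) = cis (2 * pi * real j / real N + - th)"
      by (simp add: cis_mult)
    ultimately show "cmod (g (rou N j)) \<le> th"
      using lip1_arc[OF f, of "2 * pi * real j / real N + - th" "2 * pi * real j / real N"] th
      by (simp add: g_def)
  qed (use d in auto)
  from form_bound_scale[OF this, of "1 / (\<i> * of_real th)"]
  have 1: "form_bound d (\<lambda>p q. 1 / (\<i> * of_real th) * entries (compr d N g) p q) 1"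
    using th by (simp add: norm_divide norm_mult)
  \<comment> \<open>Division by \<open>\<i> * th\<close> makes the rotation difference an
    approximate derivative. The remainder \<open>(th * k)\<^sup>2\<close> and the coefficient bound
    4 leave \<open>4 * th * d\<^sup>2\<close> per entry, hence \<open>d\<close> times that in
    norm.\<close>
  define E where "E = (\<lambda>k::int. of_int k * rcoef N f k - 1 / (\<i> * of_real th) * b k)"
  have E: "cmod (E k) \<le> 4 * th * (real d)\<^sup>2" if k: "\<bar>k\<bar> < int d" for k
  proof (cases "k = 0")
    case True
    thus ?thesis using th by (simp add: E_def b_def)
  next
    case False
    have "E k = - (rcoef N f k / (\<i> * of_real th)) * (cis (th * of_int k) - 1 - \<i> * of_real (th * of_int k))"
      using th by (simp add: E_def b_def field_simps)
    hence "cmod (E k) = cmod (rcoef N f k) / th * cmod (cis (th * of_int k) - 1 - \<i> * of_real (th * of_int k))"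
      using th by (simp add: norm_mult norm_divide)
    also have "\<dots> \<le> 4 / th * (th * of_int k)\<^sup>2"
      using th lip1_rcoef_le[OF f False, of N] k d
      by (intro mult_mono norm_cis_second_order divide_right_mono) auto
    also have "\<dots> = 4 * th * (of_int k)\<^sup>2" using th by (simp add: power2_eq_square)
    also have "\<dots> \<le> 4 * th * (real d)\<^sup>2"
    proof -
      have "\<bar>real_of_int k\<bar> \<le> real d" using k by linarith
      hence "(real_of_int k)\<^sup>2 \<le> (real d)\<^sup>2" using abs_le_square_iff[of "real_of_int k" "real d"] by simp
      thus ?thesis using th by (intro mult_left_mono) auto
    qed
    finally show ?thesis .
  qed
  have 2: "form_bound d (\<lambda>p q. E (int p - int q)) (of_nat d * (4 * th * (real d)\<^sup>2))"
    by (rule form_bound_entries) (rule E, auto)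
  have "form_bound d (\<lambda>p q. 1 / (\<i> * of_real th) * entries (compr d N g) p q + E (int p - int q))
       (1 + of_nat d * (4 * th * (real d)\<^sup>2))"
    by (rule form_bound_add[OF 1 2])
  moreover have "of_nat d * (4 * th * (real d)\<^sup>2) = 8 * pi * real d ^ 3 / real N"
    by (simp add: th_def power2_eq_square power3_eq_cube)
  ultimately have 3: "form_bound d (\<lambda>p q. 1 / (\<i> * of_real th) * entries (compr d N g) p q + E (int p - int q))
       (1 + 8 * pi * real d ^ 3 / real N)" by simp
  show ?thesis
    by (rule form_bound_cong[OF _ 3]) (simp add: compr_def toep_index E_def b)
qed

section \<open>The symbol of a Toeplitz matrix\<close>

definition symb :: "nat \<Rightarrow> complex mat \<Rightarrow> complex \<Rightarrow> complex" where
  "symb d T z = (if cmod z = 1 then sform d (entries T) (evec z) (evec z) / of_nat d else 0)"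

lemma evec_cis: "cnj (evec (cis t) p) * evec (cis t) q = cis ((real q - real p) * t)"
  unfolding evec_def DeMoivre cis_cnj cis_mult by (rule arg_cong[of _ _ cis]) (simp add: algebra_simps)

lemma symb_cis:
  "symb d T (cis t) = (\<Sum>p<d. \<Sum>q<d. T $$ (p, q) / of_nat d * cis ((real q - real p) * t))"
proof -
  have "symb d T (cis t) = (\<Sum>p<d. \<Sum>q<d. cnj (evec (cis t) p) * T $$ (p, q) * evec (cis t) q / of_nat d)"
    by (simp add: symb_def sform_def sum_divide_distrib)
  also have "\<dots> = (\<Sum>p<d. \<Sum>q<d. T $$ (p, q) / of_nat d * cis ((real q - real p) * t))"
    by (intro sum.cong refl) (simp add: evec_cis[symmetric])
  finally show ?thesis .
qed

lemma symb_in_C_circle: "symb d T \<in> C_circle"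
proof -
  have "continuous_on (sphere 0 1) (symb d T) \<longleftrightarrow>
     continuous_on (sphere 0 1) (\<lambda>z. sform d (entries T) (evec z) (evec z) / of_nat d)"
    by (rule continuous_on_cong) (auto simp: symb_def)
  moreover have "continuous_on (sphere 0 1) (\<lambda>z. sform d (entries T) (evec z) (evec z) / of_nat d)"
    unfolding sform_def evec_def by (cases "d = 0") (auto intro!: continuous_intros)
  ultimately show ?thesis by (auto simp: C_circle_def symb_def)
qed

text \<open>Up to the factor \<open>- \<i>\<close> the derivative of the symbol is the symbol of the
  commutator. As \<open>evec\<close> has square norm \<open>d\<close>, the bound 1 is kept without
  loss.\<close>

lemma symb_lip1:
  assumes "0 < d" "form_bound d (\<lambda>p q. of_int (int p - int q) * T $$ (p, q)) 1"
  shows "symb d T \<in> lip1"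
proof -
  define D where "D = (\<lambda>t. \<Sum>p<d. \<Sum>q<d. T $$ (p, q) / of_nat d * (\<i> * of_real (real q - real p) * cis ((real q - real p) * t)))"
  have deriv: "((\<lambda>t. symb d T (cis t)) has_vector_derivative D t) (at t)" for t
    unfolding symb_cis D_def
    by (intro has_vector_derivative_sum has_vector_derivative_mult_right has_vector_derivative_cis_linear)
  have "continuous_on UNIV D" unfolding D_def by (intro continuous_intros)
  hence "(\<lambda>t. symb d T (cis t)) C1_differentiable_on UNIV"
    unfolding C1_differentiable_on_def using deriv by blast
  moreover have "circle_deriv (symb d T) t = D t" for t
    unfolding circle_deriv_def by (rule vector_derivative_at[OF deriv])
  moreover have "cmod (D t) \<le> 1" for t
  proof -
    let ?F = "\<lambda>p q. of_int (int p - int q) * T $$ (p, q)"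
    have "D t = - \<i> * sform d ?F (evec (cis t)) (evec (cis t)) / of_nat d"
      unfolding D_def sform_def sum_distrib_left sum_divide_distrib
    proof (intro sum.cong refl)
      fix p q
      show "T $$ (p, q) / of_nat d * (\<i> * of_real (real q - real p) * cis ((real q - real p) * t)) =
         - \<i> * (cnj (evec (cis t) p) * (of_int (int p - int q) * T $$ (p, q)) * evec (cis t) q) / of_nat d"
        by (simp add: evec_cis[symmetric]) (simp add: algebra_simps diff_divide_distrib)
    qed
    moreover have "cmod (sform d ?F (evec (cis t)) (evec (cis t))) \<le> 1 * (nsq d (evec (cis t)) + nsq d (evec (cis t))) / 2"
      using assms(2) unfolding form_bound_def by blast
    ultimately show ?thesis
      using assms(1) by (simp add: norm_mult norm_divide nsq_evec)
  qed
  ultimately show ?thesis using symb_in_C_circle by (auto simp: lip1_def C1_circle_def)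
qed

text \<open>The occurring exponents \<open>k - l\<close> stay below \<open>2 * d \<le> N\<close> in
  modulus, so the grid recovers coefficients exactly and only the Fejer weight
  \<open>1 - \<bar>k\<bar> / d\<close> remains.\<close>

lemma rcoef_symb:
  assumes "0 < d" "2 * d \<le> N" "\<bar>k\<bar> < int d"
  shows "rcoef N (symb d (toep d a)) k = of_int (int d - \<bar>k\<bar>) * a k / of_nat d"
proof -
  define c where "c = (\<lambda>l. a l * of_int (int d - \<bar>l\<bar>) / of_nat d)"
  have pow: "(if 0 \<le> l then cnj (rou N j) ^ nat l else rou N j ^ nat (- l)) = cis (- (2 * pi * real j * of_int l / real N))" for l j
    by (simp add: rou_power cis_cnj flip: complex_cnj_power)
  have s: "symb d (toep d a) (rou N j) = (\<Sum>l\<in>diags d. c l * cis (- (2 * pi * real j * of_int l / real N)))" for j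
  proof -
    have "symb d (toep d a) (rou N j) = (\<Sum>l\<in>diags d. a l * sform d (shift l) (evec (rou N j)) (evec (rou N j))) / of_nat d"
      by (simp only: symb_def norm_rou sform_entries_toep sform_toep if_True simp_thms)
    also have "\<dots> = (\<Sum>l\<in>diags d. c l * cis (- (2 * pi * real j * of_int l / real N)))"
      unfolding sum_divide_distrib
    proof (rule sum.cong[OF refl])
      fix l assume "l \<in> diags d"
      hence "\<bar>l\<bar> \<le> int d" by (auto simp: diags_def)
      thus "a l * sform d (shift l) (evec (rou N j)) (evec (rou N j)) / of_nat d = c l * cis (- (2 * pi * real j * of_int l / real N))"
        unfolding sform_shift_evec_diag[OF norm_rou \<open>\<bar>l\<bar> \<le> int d\<close>] pow c_def by simp
    qed
    finally show ?thesis .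
  qed
  have "(\<Sum>j<N. symb d (toep d a) (rou N j) * cis (2 * pi * real j * of_int k / real N)) =
     (\<Sum>j<N. \<Sum>l\<in>diags d. c l * cis (2 * pi * of_int (k - l) / real N) ^ j)"
    unfolding s sum_distrib_right
  proof (intro sum.cong refl)
    fix j l
    have "cis (- (2 * pi * real j * of_int l / real N)) * cis (2 * pi * real j * of_int k / real N) = cis (2 * pi * of_int (k - l) / real N) ^ j"
      unfolding cis_mult DeMoivre by (rule arg_cong[of _ _ cis]) (simp add: field_simps diff_divide_distrib)
    thus "c l * cis (- (2 * pi * real j * of_int l / real N)) * cis (2 * pi * real j * of_int k / real N) = c l * cis (2 * pi * of_int (k - l) / real N) ^ j"
      by (simp add: mult.assoc)
  qed
  also have "\<dots> = (\<Sum>l\<in>diags d. c l * (\<Sum>j<N. cis (2 * pi * of_int (k - l) / real N) ^ j))"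
    unfolding sum_distrib_left by (rule sum.swap)
  also have "\<dots> = (\<Sum>l\<in>diags d. if l = k then c l * of_nat N else 0)"
  proof (rule sum.cong[OF refl])
    fix l assume "l \<in> diags d"
    hence "\<bar>k - l\<bar> < int N" using assms by (auto simp: diags_def)
    thus "c l * (\<Sum>j<N. cis (2 * pi * of_int (k - l) / real N) ^ j) = (if l = k then c l * of_nat N else 0)"
      using sum_rou_powers[of "k - l" N] by auto
  qed
  also have "\<dots> = c k * of_nat N" using assms(3) by (auto simp: diags_def)
  finally show ?thesis using assms by (simp add: rcoef_def c_def)
qed

text \<open>The Fejer weights miss 1 by \<open>\<bar>k\<bar> / d\<close>, so in modulus the
  remainder has the coefficients of the commutator divided by \<open>d\<close>, and
  \<open>commutator_l1\<close> bounds their sum by \<open>2 * sqrt d / d\<close>.\<close>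

lemma compr_symb_bound:
  assumes d: "0 < d" "2 * d \<le> N"
    and fb: "form_bound d (\<lambda>p q. of_int (int p - int q) * a (int p - int q)) 1"
  obtains b where "toep d a = compr d N (symb d (toep d a)) + toep d b"
    "form_bound d (entries (toep d b)) (2 / sqrt (real d))"
proof
  let ?b = "\<lambda>k. of_int \<bar>k\<bar> * a k / of_nat d"
  show "toep d a = compr d N (symb d (toep d a)) + toep d ?b"
    unfolding compr_def toep_add
    by (rule toep_cong) (use d in \<open>simp add: rcoef_symb field_simps\<close>)
  have "(\<Sum>k\<in>diags d. cmod (?b k)) = (\<Sum>k\<in>diags d. cmod (of_int k * a k)) / real d"
    by (simp add: norm_mult norm_divide sum_divide_distrib)
  also have "\<dots> \<le> 2 * 1 * sqrt (real d) / real d"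
    by (intro divide_right_mono commutator_l1 fb) auto
  also have "\<dots> = 2 / sqrt (real d)" using d by (simp add: field_simps)
  finally show "form_bound d (entries (toep d ?b)) (2 / sqrt (real d))"
    using form_bound_toep form_bound_mono by blast
qed

section \<open>Gromov--Hausdorff distance\<close>

text \<open>Working with pseudo-metrics spares the proof that the two distances separate
  points.\<close>

definition pseudo_metric_on :: "'a set \<Rightarrow> ('a \<Rightarrow> 'a \<Rightarrow> real) \<Rightarrow> bool" where
  "pseudo_metric_on X d \<longleftrightarrow>
     (\<forall>x\<in>X. d x x = 0) \<and> (\<forall>x\<in>X. \<forall>y\<in>X. 0 \<le> d x y \<and> d x y = d y x) \<and>
     (\<forall>x\<in>X. \<forall>y\<in>X. \<forall>z\<in>X. d x z \<le> d x y + d y z)"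

text \<open>
  A pseudo-metric on the disjoint union suffices: choosing representatives turns it into a metric
  on a subset of the same type.
\<close>

lemma GH_dist_le_hausdorff:
  fixes X :: "'a set" and Y :: "'b set"
  assumes pm: "pseudo_metric_on (X <+> Y) \<delta>"
    and X: "\<And>x x'. x \<in> X \<Longrightarrow> x' \<in> X \<Longrightarrow> \<delta> (Inl x) (Inl x') = dX x x'"
    and Y: "\<And>y y'. y \<in> Y \<Longrightarrow> y' \<in> Y \<Longrightarrow> \<delta> (Inr y) (Inr y') = dY y y'"
    and XY: "\<And>x. x \<in> X \<Longrightarrow> \<exists>y\<in>Y. \<delta> (Inl x) (Inr y) \<le> r"
    and YX: "\<And>y. y \<in> Y \<Longrightarrow> \<exists>x\<in>X. \<delta> (Inl x) (Inr y) \<le> r"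
  shows "GH_dist X dX Y dY \<le> ennreal r"
proof -
  let ?W = "X <+> Y"
  define rep where "rep = (\<lambda>w. SOME w'. w' \<in> ?W \<and> \<delta> w w' = 0)"
  have rep: "rep w \<in> ?W \<and> \<delta> w (rep w) = 0" if "w \<in> ?W" for w
    unfolding rep_def by (rule someI[of _ w]) (use pm that in \<open>auto simp: pseudo_metric_on_def\<close>)
  have sym: "\<delta> u v = \<delta> v u" and nn: "0 \<le> \<delta> u v" if "u \<in> ?W" "v \<in> ?W" for u v
    using pm that by (auto simp: pseudo_metric_on_def)
  have tri: "\<delta> u w \<le> \<delta> u v + \<delta> v w" if "u \<in> ?W" "v \<in> ?W" "w \<in> ?W" for u v w
    using pm that by (auto simp: pseudo_metric_on_def)
  have rep_eq: "\<delta> (rep u) (rep v) = \<delta> u v" if "u \<in> ?W" "v \<in> ?W" for u v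
  proof (rule antisym)
    have r: "rep u \<in> ?W" "rep v \<in> ?W" "\<delta> u (rep u) = 0" "\<delta> v (rep v) = 0"
      using rep that by auto
    show "\<delta> (rep u) (rep v) \<le> \<delta> u v"
      using tri[OF r(1) that(1) r(2)] tri[OF that r(2)] r sym[OF that(1) r(1)] by simp
    show "\<delta> u v \<le> \<delta> (rep u) (rep v)"
      using tri[OF that(1) r(1) that(2)] tri[OF r(1) r(2) that(2)] r sym[OF that(2) r(2)] by simp
  qed
  have rep_same: "rep u = rep v" if "u \<in> ?W" "v \<in> ?W" "\<delta> u v = 0" for u v
  proof -
    have "\<delta> u w = 0 \<longleftrightarrow> \<delta> v w = 0" if "w \<in> ?W" for w
      using tri[OF \<open>u \<in> ?W\<close> \<open>v \<in> ?W\<close> that] tri[OF \<open>v \<in> ?W\<close> \<open>u \<in> ?W\<close> that] \<open>\<delta> u v = 0\<close>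
        sym[OF \<open>u \<in> ?W\<close> \<open>v \<in> ?W\<close>] nn[OF \<open>u \<in> ?W\<close> that] nn[OF \<open>v \<in> ?W\<close> that] by auto
    \<comment> \<open>Points at distance zero define the same predicate, so \<open>SOME\<close>
      chooses the same representative for them.\<close>
    hence "(\<lambda>w. w \<in> ?W \<and> \<delta> u w = 0) = (\<lambda>w. w \<in> ?W \<and> \<delta> v w = 0)" by auto
    thus ?thesis by (simp add: rep_def)
  qed
  let ?f = "\<lambda>x. rep (Inl x)" and ?g = "\<lambda>y. rep (Inr y)"
  \<comment> \<open>\<open>Metric_space\<close> asks for symmetry and nonnegativity outside the
    carrier too, whence the default value 0.\<close>
  define dd where "dd = (\<lambda>u v. if u \<in> ?W \<and> v \<in> ?W then \<delta> u v else 0)"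
  have dd: "dd (rep u) (rep v) = \<delta> u v" if "u \<in> ?W" "v \<in> ?W" for u v
    using rep[OF that(1)] rep[OF that(2)] rep_eq[OF that] by (simp add: dd_def)
  have metric: "Metric_space (rep ` ?W) dd"
  proof
    show "0 \<le> dd u v" for u v using nn by (simp add: dd_def)
    show "dd u v = dd v u" for u v using sym[of u v] by (simp add: dd_def)
    show "(dd u v = 0) = (u = v)" if uv: "u \<in> rep ` ?W" "v \<in> rep ` ?W" for u v
    proof -
      obtain u' v' where u': "u = rep u'" "u' \<in> ?W" and v': "v = rep v'" "v' \<in> ?W"
        using uv by blast
      have "\<delta> u' u' = 0" using pm u'(2) by (auto simp: pseudo_metric_on_def)
      thus ?thesis
        using dd[OF u'(2) v'(2)] dd[OF u'(2) u'(2)] rep_same[OF u'(2) v'(2)] u' v' by auto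
    qed
    show "dd u w \<le> dd u v + dd v w" if "u \<in> rep ` ?W" "v \<in> rep ` ?W" "w \<in> rep ` ?W" for u v w
    proof -
      have "u \<in> ?W" "v \<in> ?W" "w \<in> ?W" using that rep by blast+
      thus ?thesis using tri[of u v w] by (simp add: dd_def)
    qed
  qed
  have "isometric_embedding X dX (rep ` ?W) dd ?f" "isometric_embedding Y dY (rep ` ?W) dd ?g"
    using X Y by (auto simp: isometric_embedding_def dd InlI InrI)
  hence "GH_dist X dX Y dY \<le> hausdorff_dist dd (?f ` X) (?g ` Y)"
    unfolding GH_dist_def using metric by (intro Inf_lower) blast
  also have "\<dots> \<le> ennreal r"
    unfolding hausdorff_dist_def
  proof (intro max.boundedI SUP_least)
    have d: "dd (?f x) (?g y) = \<delta> (Inl x) (Inr y)" if "x \<in> X" "y \<in> Y" for x y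
      using that dd by auto
    show "(INF b\<in>?g ` Y. ennreal (dd a b)) \<le> ennreal r" if a: "a \<in> ?f ` X" for a
    proof -
      obtain x where x: "x \<in> X" "a = ?f x" using a by auto
      obtain y where y: "y \<in> Y" "\<delta> (Inl x) (Inr y) \<le> r" using XY[OF x(1)] by auto
      have "(INF b\<in>?g ` Y. ennreal (dd a b)) \<le> ennreal (dd a (?g y))"
        using y(1) by (intro INF_lower) auto
      also have "\<dots> \<le> ennreal r" unfolding x(2) d[OF x(1) y(1)] using y(2) by (rule ennreal_leI)
      finally show ?thesis .
    qed
    show "(INF a\<in>?f ` X. ennreal (dd a b)) \<le> ennreal r" if b: "b \<in> ?g ` Y" for b
    proof -
      obtain y where y: "y \<in> Y" "b = ?g y" using b by auto
      obtain x where x: "x \<in> X" "\<delta> (Inl x) (Inr y) \<le> r" using YX[OF y(1)] by auto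
      have "(INF a\<in>?f ` X. ennreal (dd a b)) \<le> ennreal (dd (?f x) b)"
        using x(1) by (intro INF_lower) auto
      also have "\<dots> \<le> ennreal r" unfolding y(2) d[OF x(1) y(1)] using x(2) by (rule ennreal_leI)
      finally show ?thesis .
    qed
  qed
  finally show ?thesis .
qed

text \<open>The spaces are glued by a segment of length \<open>e\<close> between each
  \<open>a\<close> and \<open>\<alpha> a\<close>. Since \<open>\<alpha>\<close> distorts distances
  by at most \<open>e\<close>, a detour through two segments never shortens a distance within
  \<open>X\<close> or \<open>Y\<close>. The bound \<open>2 * e\<close> is one segment plus the
  density error.\<close>

lemma GH_dist_le:
  fixes X :: "'a set" and Y :: "'b set"
  assumes pX: "pseudo_metric_on X dX" and pY: "pseudo_metric_on Y dY"
    and \<alpha>: "\<And>x. x \<in> X \<Longrightarrow> \<alpha> x \<in> Y" and e: "0 \<le> e"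
    and iso: "\<And>x x'. x \<in> X \<Longrightarrow> x' \<in> X \<Longrightarrow> \<bar>dX x x' - dY (\<alpha> x) (\<alpha> x')\<bar> \<le> e"
    and dense: "\<And>y. y \<in> Y \<Longrightarrow> \<exists>x\<in>X. dY (\<alpha> x) y \<le> e"
  shows "GH_dist X dX Y dY \<le> ennreal (2 * e)"
proof -
  define c where "c = (\<lambda>x y. INF a\<in>X. dX x a + e + dY (\<alpha> a) y)"
  define \<delta> where "\<delta> = (\<lambda>u v. case (u, v) of (Inl x, Inl x') \<Rightarrow> dX x x' | (Inr y, Inr y') \<Rightarrow> dY y y'
     | (Inl x, Inr y) \<Rightarrow> c x y | (Inr y, Inl x) \<Rightarrow> c x y)"
  note pX = pX[unfolded pseudo_metric_on_def] and pY = pY[unfolded pseudo_metric_on_def]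
  have X0: "dX x x = 0" if "x \<in> X" for x using pX that by blast
  have X1: "0 \<le> dX x y" if "x \<in> X" "y \<in> X" for x y using pX that by blast
  have X2: "dX x y = dX y x" if "x \<in> X" "y \<in> X" for x y using pX that by blast
  have X3: "dX x z \<le> dX x y + dX y z" if "x \<in> X" "y \<in> X" "z \<in> X" for x y z using pX that by blast
  have Y0: "dY x x = 0" if "x \<in> Y" for x using pY that by blast
  have Y1: "0 \<le> dY x y" if "x \<in> Y" "y \<in> Y" for x y using pY that by blast
  have Y2: "dY x y = dY y x" if "x \<in> Y" "y \<in> Y" for x y using pY that by blast
  have Y3: "dY x z \<le> dY x y + dY y z" if "x \<in> Y" "y \<in> Y" "z \<in> Y" for x y z using pY that by blast
  have bdd: "bdd_below ((\<lambda>a. dX x a + e + dY (\<alpha> a) y) ` X)" if "x \<in> X" "y \<in> Y" for x y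
    by (rule bdd_belowI2[of _ 0]) (use X1 Y1 \<alpha> that e in auto)
  have c_le: "c x y \<le> dX x a + e + dY (\<alpha> a) y" if "x \<in> X" "y \<in> Y" "a \<in> X" for x y a
    unfolding c_def by (rule cINF_lower[OF bdd]) (use that in auto)
  have le_c: "r \<le> c x y" if "x \<in> X" "\<And>a. a \<in> X \<Longrightarrow> r \<le> dX x a + e + dY (\<alpha> a) y" for x y r
    unfolding c_def by (rule cINF_greatest) (use that in auto)
  have c1: "c x y \<le> dX x x' + c x' y" if "x \<in> X" "x' \<in> X" "y \<in> Y" for x x' y
  proof -
    have "c x y - dX x x' \<le> c x' y"
    proof (rule le_c)
      fix a assume "a \<in> X"
      thus "c x y - dX x x' \<le> dX x' a + e + dY (\<alpha> a) y"
        using c_le[OF that(1,3) \<open>a \<in> X\<close>] X3[OF that(1,2) \<open>a \<in> X\<close>] by linarith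
    qed (use that in auto)
    thus ?thesis by simp
  qed
  have c2: "c x y \<le> c x y' + dY y' y" if "x \<in> X" "y \<in> Y" "y' \<in> Y" for x y y'
  proof -
    have "c x y - dY y' y \<le> c x y'"
    proof (rule le_c)
      fix a assume "a \<in> X"
      thus "c x y - dY y' y \<le> dX x a + e + dY (\<alpha> a) y'"
        using c_le[OF that(1,2) \<open>a \<in> X\<close>] Y3[OF \<alpha>[OF \<open>a \<in> X\<close>] that(3,2)] by linarith
    qed (use that in auto)
    thus ?thesis by simp
  qed
  have c3: "dX x x' \<le> c x y + c x' y" if "x \<in> X" "x' \<in> X" "y \<in> Y" for x x' y
  proof -
    have "dX x x' - c x y \<le> c x' y"
    proof (rule le_c)
      fix b assume b: "b \<in> X"
      have "dX x x' - (dX x' b + e + dY (\<alpha> b) y) \<le> c x y"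
      proof (rule le_c)
        fix a assume a: "a \<in> X"
        have "dX x x' \<le> dX x a + dX a b + dX b x'"
          using X3[OF that(1) a that(2)] X3[OF a b that(2)] by linarith
        moreover have "dX a b \<le> dY (\<alpha> a) (\<alpha> b) + e" using iso[OF a b] by linarith
        moreover have "dY (\<alpha> a) (\<alpha> b) \<le> dY (\<alpha> a) y + dY (\<alpha> b) y"
          using Y3[OF \<alpha>[OF a] that(3) \<alpha>[OF b]] Y2[OF that(3) \<alpha>[OF b]] by linarith
        ultimately show "dX x x' - (dX x' b + e + dY (\<alpha> b) y) \<le> dX x a + e + dY (\<alpha> a) y"
          using X2[OF b that(2)] e by linarith
      qed (use that in auto)
      thus "dX x x' - c x y \<le> dX x' b + e + dY (\<alpha> b) y" by linarith
    qed (use that in auto)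
    thus ?thesis by simp
  qed
  have c4: "dY y y' \<le> c x y + c x y'" if "x \<in> X" "y \<in> Y" "y' \<in> Y" for x y y'
  proof -
    have "dY y y' - c x y \<le> c x y'"
    proof (rule le_c)
      fix b assume b: "b \<in> X"
      have "dY y y' - (dX x b + e + dY (\<alpha> b) y') \<le> c x y"
      proof (rule le_c)
        fix a assume a: "a \<in> X"
        have "dY y y' \<le> dY (\<alpha> a) y + dY (\<alpha> a) (\<alpha> b) + dY (\<alpha> b) y'"
          using Y3[OF that(2) \<alpha>[OF a] that(3)] Y3[OF \<alpha>[OF a] \<alpha>[OF b] that(3)] Y2[OF that(2) \<alpha>[OF a]]
          by linarith
        moreover have "dY (\<alpha> a) (\<alpha> b) \<le> dX a b + e" using iso[OF a b] by linarith
        moreover have "dX a b \<le> dX x a + dX x b" using X3[OF a that(1) b] X2[OF a that(1)] by linarith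
        ultimately show "dY y y' - (dX x b + e + dY (\<alpha> b) y') \<le> dX x a + e + dY (\<alpha> a) y"
          using e by linarith
      qed (use that in auto)
      thus "dY y y' - c x y \<le> dX x b + e + dY (\<alpha> b) y'" by linarith
    qed (use that in auto)
    thus ?thesis by simp
  qed
  have c0: "0 \<le> c x y" if "x \<in> X" "y \<in> Y" for x y
    by (rule le_c) (use X1 Y1 \<alpha> e that in auto)
  have near: "c x y \<le> 2 * e" if "x \<in> X" "y \<in> Y" "dY (\<alpha> x) y \<le> e" for x y
    using c_le[OF that(1,2,1)] X0[OF that(1)] that by simp
  have pm: "pseudo_metric_on (X <+> Y) \<delta>"
    unfolding pseudo_metric_on_def
  proof (intro conjI ballI)
    fix u assume "u \<in> X <+> Y" thus "\<delta> u u = 0" using X0 Y0 by (auto simp: \<delta>_def)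
  next
    fix u v assume uv: "u \<in> X <+> Y" "v \<in> X <+> Y"
    show "0 \<le> \<delta> u v" "\<delta> u v = \<delta> v u" using uv X1 X2 Y1 Y2 c0 by (auto simp: \<delta>_def)
    fix w assume w: "w \<in> X <+> Y"
    show "\<delta> u w \<le> \<delta> u v + \<delta> v w"
      using uv w
    proof (elim PlusE)
      show ?thesis if "u = Inl x" "x \<in> X" "v = Inr y" "y \<in> Y" "w = Inr z" "z \<in> Y" for x y z
        using c2[of x z y] that by (simp add: \<delta>_def)
      show ?thesis if "u = Inr y" "y \<in> Y" "v = Inl x" "x \<in> X" "w = Inl z" "z \<in> X" for x y z
        using c1[of z x y] X2[of x z] that by (simp add: \<delta>_def)
    qed (use X3 Y2 Y3 c1 c2 c3 c4 in \<open>auto simp: \<delta>_def add.commute\<close>)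
  qed
  show ?thesis
  proof (rule GH_dist_le_hausdorff[OF pm])
    fix x assume x: "x \<in> X"
    thus "\<exists>y\<in>Y. \<delta> (Inl x) (Inr y) \<le> 2 * e"
      using near[OF x \<alpha>[OF x]] \<alpha>[OF x] Y0 e by (intro bexI[of _ "\<alpha> x"]) (auto simp: \<delta>_def)
  next
    fix y assume y: "y \<in> Y"
    obtain x where "x \<in> X" "dY (\<alpha> x) y \<le> e" using dense[OF y] by auto
    thus "\<exists>x\<in>X. \<delta> (Inl x) (Inr y) \<le> 2 * e" using near y by (auto simp: \<delta>_def)
  qed (auto simp: \<delta>_def)
qed

section \<open>Compressions by isometries\<close>

definition vmap :: "nat \<Rightarrow> nat \<Rightarrow> (nat \<Rightarrow> nat \<Rightarrow> complex) \<Rightarrow> complex mat \<Rightarrow> complex mat" where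
  "vmap d n V = (\<lambda>T\<in>toeplitz_mats d.
     Matrix.mat n n (\<lambda>(a, b). sform d (entries T) (\<lambda>p. V p a) (\<lambda>p. V p b)))"

definition isometry_mat :: "nat \<Rightarrow> nat \<Rightarrow> (nat \<Rightarrow> nat \<Rightarrow> complex) \<Rightarrow> bool" where
  "isometry_mat d n V \<longleftrightarrow>
     (\<forall>a<n. \<forall>b<n. (\<Sum>p<d. cnj (V p a) * V p b) = (if a = b then 1 else 0))"

lemma vmap_index:
  "T \<in> toeplitz_mats d \<Longrightarrow> a < n \<Longrightarrow> b < n \<Longrightarrow>
   vmap d n V T $$ (a, b) = sform d (entries T) (\<lambda>p. V p a) (\<lambda>p. V p b)"
  by (simp add: vmap_def)

lemma toeplitz_dims:
  "T \<in> toeplitz_mats d \<Longrightarrow> T \<in> carrier_mat d d"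
  by (auto elim!: toeplitz_matsE)

lemma sform_vmap:
  assumes "T \<in> toeplitz_mats d"
  shows "sform n (entries (vmap d n V T)) x y =
    sform d (entries T) (\<lambda>p. \<Sum>a<n. V p a * x a) (\<lambda>p. \<Sum>a<n. V p a * y a)"
proof -
  have "sform n (entries (vmap d n V T)) x y =
      (\<Sum>a<n. \<Sum>b<n. \<Sum>p<d. \<Sum>q<d. cnj (V p a * x a) * (T $$ (p, q) * (V q b * y b)))"
    unfolding sform_def by (intro sum.cong refl)
      (simp add: vmap_index[OF assms] sform_def sum_distrib_left sum_distrib_right mult_ac)
  also have "\<dots> = (\<Sum>a<n. \<Sum>p<d. \<Sum>b<n. \<Sum>q<d. cnj (V p a * x a) * (T $$ (p, q) * (V q b * y b)))"
    by (intro sum.cong refl sum.swap)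
  also have "\<dots> = (\<Sum>p<d. \<Sum>a<n. \<Sum>b<n. \<Sum>q<d. cnj (V p a * x a) * (T $$ (p, q) * (V q b * y b)))"
    by (rule sum.swap)
  also have "\<dots> = (\<Sum>p<d. \<Sum>a<n. \<Sum>q<d. \<Sum>b<n. cnj (V p a * x a) * (T $$ (p, q) * (V q b * y b)))"
    by (intro sum.cong refl sum.swap)
  also have "\<dots> = (\<Sum>p<d. \<Sum>q<d. \<Sum>a<n. \<Sum>b<n. cnj (V p a * x a) * (T $$ (p, q) * (V q b * y b)))"
    by (intro sum.cong refl sum.swap)
  also have "\<dots> = sform d (entries T) (\<lambda>p. \<Sum>a<n. V p a * x a) (\<lambda>p. \<Sum>a<n. V p a * y a)"
    by (simp add: sform_def sum_distrib_left sum_distrib_right mult_ac)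
  finally show ?thesis .
qed

lemma vmap_UCP:
  assumes V: "isometry_mat d n V"
  shows "vmap d n V \<in> UCP (toeplitz_sys d) n"
proof -
  have "os_linear (toeplitz_sys d) n (vmap d n V)"
    unfolding os_linear_def toeplitz_sys_simps
  proof (intro conjI ballI allI)
    show "vmap d n V \<in> toeplitz_mats d \<rightarrow> carrier_mat n n" by (simp add: vmap_def)
    fix T assume T: "T \<in> toeplitz_mats d"
    show "vmap d n V (c \<cdot>\<^sub>m T) = c \<cdot>\<^sub>m vmap d n V T" for c
    proof (rule eq_matI)
      fix a b assume "a < dim_row (c \<cdot>\<^sub>m vmap d n V T)" "b < dim_col (c \<cdot>\<^sub>m vmap d n V T)"
      hence ab: "a < n" "b < n" using T by (auto simp: vmap_def)
      have "sform d (entries (c \<cdot>\<^sub>m T)) x y = c * sform d (entries T) x y" for x y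
        unfolding sform_scale[symmetric] by (rule sform_cong) (use toeplitz_dims[OF T] in auto)
      thus "vmap d n V (c \<cdot>\<^sub>m T) $$ (a, b) = (c \<cdot>\<^sub>m vmap d n V T) $$ (a, b)"
        using ab T toeplitz_closed(3)[OF T T, of c] by (simp add: vmap_def)
    qed (use T toeplitz_closed(3)[OF T T, of c] in \<open>auto simp: vmap_def\<close>)
    fix S assume S: "S \<in> toeplitz_mats d"
    show "vmap d n V (T + S) = vmap d n V T + vmap d n V S"
    proof (rule eq_matI)
      fix a b assume "a < dim_row (vmap d n V T + vmap d n V S)" "b < dim_col (vmap d n V T + vmap d n V S)"
      hence ab: "a < n" "b < n" using S T by (auto simp: vmap_def)
      have "sform d (entries (T + S)) x y = sform d (entries T) x y + sform d (entries S) x y" for x y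
        unfolding sform_add[symmetric] by (rule sform_cong) (use toeplitz_dims[OF T] toeplitz_dims[OF S] in auto)
      thus "vmap d n V (T + S) $$ (a, b) = (vmap d n V T + vmap d n V S) $$ (a, b)"
        using ab S T toeplitz_closed(1)[OF T S] by (simp add: vmap_def)
    qed (use S T toeplitz_closed(1)[OF T S] in \<open>auto simp: vmap_def\<close>)
  qed
  moreover have "psd (block_mat k n (\<lambda>i j. vmap d n V (X i j)))"
    if X: "\<forall>i<k. \<forall>j<k. X i j \<in> toeplitz_mats d" "psd (block_mat k d X)" for k X
    unfolding psd_block_mat_iff
  proof
    fix x
    have "(\<Sum>i<k. \<Sum>j<k. sform n (entries (vmap d n V (X i j))) (x i) (x j)) =
      (\<Sum>i<k. \<Sum>j<k. sform d (entries (X i j)) (\<lambda>p. \<Sum>a<n. V p a * x i a) (\<lambda>p. \<Sum>a<n. V p a * x j a))"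
      using X(1) by (intro sum.cong refl sform_vmap) auto
    also have "\<dots> \<ge> 0"
      using X(2)[unfolded psd_block_mat_iff, rule_format, of "\<lambda>i p. \<Sum>a<n. V p a * x i a"] .
    finally show "0 \<le> (\<Sum>i<k. \<Sum>j<k. sform n (entries (vmap d n V (X i j))) (x i) (x j))" .
  qed
  moreover have "vmap d n V (1\<^sub>m d) = 1\<^sub>m n"
    using V by (intro eq_matI) (auto simp: vmap_index sform_entries_one isometry_mat_def, auto simp: vmap_def)
  ultimately show ?thesis
    by (auto simp: UCP_def CP_def completely_positive_def vmap_def)
qed

text \<open>The values on single diagonals determine a linear map; these finitely many numbers
  become the coefficients of \<open>symbpoly\<close>.\<close>

lemma os_linear_toep:
  assumes lin: "os_linear (toeplitz_sys d) n \<psi>" and ab: "a < n" "b < n"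
  shows "\<psi> (toep d f) $$ (a, b) = (\<Sum>k\<in>diags d. f k * \<psi> (toep d (\<lambda>j. if j = k then 1 else 0)) $$ (a, b))"
proof -
  have car: "\<psi> (toep d g) \<in> carrier_mat n n" for g
    using lin by (auto simp: os_linear_def)
  have add: "\<psi> (toep d (\<lambda>k. g k + h k)) $$ (a, b) = \<psi> (toep d g) $$ (a, b) + \<psi> (toep d h) $$ (a, b)" for g h
  proof -
    have "\<psi> (toep d g + toep d h) = \<psi> (toep d g) + \<psi> (toep d h)" using lin by (simp add: os_linear_def)
    thus ?thesis using ab car[of g] car[of h] by (simp add: toep_add)
  qed
  have scale: "\<psi> (toep d (\<lambda>k. c * g k)) $$ (a, b) = c * \<psi> (toep d g) $$ (a, b)" for g c
  proof -
    have "\<psi> (c \<cdot>\<^sub>m toep d g) = c \<cdot>\<^sub>m \<psi> (toep d g)" using lin by (simp add: os_linear_def)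
    thus ?thesis using ab car[of g] by (simp add: toep_smult)
  qed
  have fin: "\<psi> (toep d (\<lambda>j. if j \<in> K then f j else 0)) $$ (a, b) =
      (\<Sum>k\<in>K. f k * \<psi> (toep d (\<lambda>j. if j = k then 1 else 0)) $$ (a, b))" if "finite K" for K
    using that
  proof induction
    case empty
    show ?case using scale[of 0 "\<lambda>_. 0"] by simp
  next
    case (insert k K)
    have "(\<lambda>j. if j \<in> insert k K then f j else 0) =
       (\<lambda>j. f k * (if j = k then 1 else 0) + (if j \<in> K then f j else 0))"
      using insert.hyps by auto
    thus ?case by (simp only: add scale sum.insert[OF insert.hyps] insert.IH)
  qed
  have "toep d f = toep d (\<lambda>j. if j \<in> diags d then f j else 0)"
    by (rule toep_cong) (auto simp: diags_def)
  thus ?thesis using fin[of "diags d"] by simp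
qed

section \<open>Polynomials without common zeros\<close>

text \<open>A root of \<open>p\<close> is a root of \<open>q\<close>, because some
  \<open>f a\<close> does not vanish there; the linear factor is cancelled and the degree decreases.
  This replaces an appeal to Bezout's identity for the family \<open>f\<close>.\<close>

lemma dvd_no_common_root:
  fixes p q :: "complex poly"
  assumes "p \<noteq> 0" "\<And>a. a \<in> A \<Longrightarrow> p dvd q * f a" "\<And>z. \<exists>a\<in>A. poly (f a) z \<noteq> 0"
  shows "p dvd q"
  using assms(1,2)
proof (induction "degree p" arbitrary: p q rule: less_induct)
  case less
  show ?case
  proof (cases "degree p = 0")
    case True
    then obtain c where "p = [:c:]" by (rule degree_eq_zeroE)
    thus ?thesis using less.prems(1) by (simp add: const_poly_dvd_iff dvd_field_iff)
  next
    case False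
    hence "\<not> constant (poly p)" by (simp add: constant_degree)
    then obtain z where "poly p z = 0" using fundamental_theorem_of_algebra by blast
    then obtain p' where p': "p = [:- z, 1:] * p'" by (auto simp: poly_eq_0_iff_dvd)
    hence "p' \<noteq> 0" using less.prems(1) by auto
    hence deg: "degree p = Suc (degree p')" unfolding p' by (subst degree_mult_eq) auto
    obtain a where a: "a \<in> A" "poly (f a) z \<noteq> 0" using assms(3) by blast
    have "[:- z, 1:] dvd q * f a" using less.prems(2)[OF a(1)] p' dvd_mult_left by blast
    hence "poly q z = 0" using a(2) by (simp add: poly_eq_0_iff_dvd[symmetric])
    then obtain q' where q': "q = [:- z, 1:] * q'" by (auto simp: poly_eq_0_iff_dvd)
    have "p' dvd q' * f a" if "a \<in> A" for a
    proof -
      have "[:- z, 1:] * p' dvd [:- z, 1:] * (q' * f a)"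
        using less.prems(2)[OF that] by (simp only: p' q' mult.assoc)
      thus ?thesis by (subst (asm) dvd_mult_cancel_left) simp
    qed
    hence "p' dvd q'" using less.hyps[of p' q'] deg \<open>p' \<noteq> 0\<close> by simp
    thus ?thesis unfolding p' q' by (rule mult_dvd_mono[OF dvd_refl])
  qed
qed

lemma poly_eq_on_circle:
  fixes p q :: "complex poly"
  assumes "\<And>z. cmod z = 1 \<Longrightarrow> poly p z = poly q z" shows "p = q"
proof (rule ccontr)
  assume "p \<noteq> q"
  hence "finite {z. poly (p - q) z = 0}" by (intro poly_roots_finite) simp
  moreover have "cis ` {0..1} \<subseteq> {z. poly (p - q) z = 0}" using assms by auto
  ultimately have "finite (cis ` {0..1})" by (rule finite_subset[rotated])
  moreover have "inj_on cis {0..1}"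
  proof (rule inj_onI)
    fix s t :: real assume st: "s \<in> {0..1}" "t \<in> {0..1}" "cis s = cis t"
    hence "cos s = cos t" by (simp add: complex_eq_iff)
    moreover have "0 \<le> s" "s \<le> pi" "0 \<le> t" "t \<le> pi"
      using st(1,2) pi_ge_two unfolding atLeastAtMost_iff by linarith+
    ultimately show "s = t" using cos_inj_pi by blast
  qed
  ultimately have "finite {0..1::real}" by (rule finite_imageD)
  thus False using infinite_Icc[of "0::real" 1] by simp
qed

text \<open>The coefficients are conjugated so that on the circle this is the pairing of a column
  with \<open>e_z\<close>, which makes \<open>P a * cnj (P b)\<close> the symbol of the
  compression.\<close>

definition colpoly :: "nat \<Rightarrow> (nat \<Rightarrow> nat \<Rightarrow> complex) \<Rightarrow> nat \<Rightarrow> complex poly" where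
  "colpoly d V a = (\<Sum>p<d. monom (cnj (V p a)) p)"

lemma poly_colpoly: "poly (colpoly d V a) z = (\<Sum>p<d. cnj (V p a) * z ^ p)"
  by (simp add: colpoly_def poly_sum poly_monom)

lemma coeff_colpoly: "p < d \<Longrightarrow> coeff (colpoly d V a) p = cnj (V p a)"
  by (simp add: colpoly_def coeff_sum)

text \<open>The reciprocal polynomial \<open>z ^ (d - 1) * cnj (P (1 / cnj z))\<close> of \<open>P = colpoly d V a\<close>.\<close>

definition revpoly :: "nat \<Rightarrow> (nat \<Rightarrow> nat \<Rightarrow> complex) \<Rightarrow> nat \<Rightarrow> complex poly" where
  "revpoly d V a = (\<Sum>p<d. monom (V p a) (d - 1 - p))"

lemma poly_revpoly: "poly (revpoly d V a) z = (\<Sum>p<d. V p a * z ^ (d - 1 - p))"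
  by (simp add: revpoly_def poly_sum poly_monom)

lemma coeff_revpoly_top:
  assumes "0 < d" shows "coeff (revpoly d V a) (d - 1) = V 0 a"
proof -
  have "coeff (revpoly d V a) (d - 1) = (\<Sum>p<d. if p = 0 then V p a else 0)"
    unfolding revpoly_def coeff_sum by (intro sum.cong refl) (auto simp: coeff_monom)
  thus ?thesis using assms by simp
qed

lemma poly_revpoly_0:
  assumes "0 < d" shows "poly (revpoly d V a) 0 = V (d - 1) a"
proof -
  have "poly (revpoly d V a) 0 = (\<Sum>p<d. if p = d - 1 then V p a else 0)"
    unfolding poly_revpoly by (intro sum.cong refl) (auto simp: power_0_left)
  thus ?thesis using assms by simp
qed

lemma poly_revpoly_nonzero:
  assumes "z \<noteq> 0" shows "poly (revpoly d V a) z = z ^ (d - 1) * cnj (poly (colpoly d V a) (1 / cnj z))"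
  unfolding poly_revpoly poly_colpoly cnj_sum sum_distrib_left
proof (rule sum.cong[OF refl])
  fix p assume "p \<in> {..<d}"
  hence "z ^ (d - 1) = z ^ (d - 1 - p) * z ^ p" by (simp flip: power_add)
  thus "V p a * z ^ (d - 1 - p) = z ^ (d - 1) * cnj (cnj (V p a) * (1 / cnj z) ^ p)"
    using assms by (simp add: power_divide)
qed

lemma poly_revpoly_circle:
  assumes "cmod z = 1" shows "poly (revpoly d V a) z = z ^ (d - 1) * cnj (poly (colpoly d V a) z)"
proof -
  have "z \<noteq> 0" using assms by auto
  moreover from this have "1 / cnj z = z" using unit_mult_cnj[OF assms] by (simp add: divide_eq_eq)
  ultimately show ?thesis using poly_revpoly_nonzero[of z d V a] by simp
qed

section \<open>Pure maps\<close>

text \<open>For unimodular \<open>z\<close> this is \<open>e_z e_z*\<close>, a positive rank-one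
  matrix that is itself Toeplitz. The values of a map on these matrices are its symbol, and the
  purity proof uses positivity only through them.\<close>

definition ztoep :: "nat \<Rightarrow> complex \<Rightarrow> complex mat" where
  "ztoep d z = toep d (\<lambda>k. if 0 \<le> k then z ^ nat k else cnj z ^ nat (- k))"

lemma ztoep_entry:
  assumes "cmod z = 1" "p < d" "q < d"
  shows "entries (ztoep d z) p q = evec z p * cnj (evec z q)"
proof (cases "q \<le> p")
  case True
  moreover from this have "nat (int p - int q) = p - q" by linarith
  ultimately show ?thesis using unit_power_diff(1)[OF assms(1) True] assms(2,3)
    by (simp add: ztoep_def toep_index evec_def)
next
  case False
  hence "p \<le> q" "nat (- (int p - int q)) = q - p" by linarith+
  thus ?thesis using unit_power_diff(2)[OF assms(1) \<open>p \<le> q\<close>] assms(2,3) False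
    by (simp add: ztoep_def toep_index evec_def)
qed

lemma sform_ztoep:
  assumes "cmod z = 1"
  shows "sform d (entries (ztoep d z)) x y =
     cnj (\<Sum>p<d. cnj (evec z p) * x p) * (\<Sum>p<d. cnj (evec z p) * y p)"
  unfolding sform_rank1[symmetric] by (rule sform_cong) (use ztoep_entry[OF assms] in auto)

lemma ztoep_in [simp]: "ztoep d z \<in> toeplitz_mats d"
  by (simp add: ztoep_def)

lemma CP_ztoep:
  assumes "completely_positive (toeplitz_sys d) n \<psi>" "cmod z = 1"
  shows "psd_form n (entries (\<psi> (ztoep d z)))"
proof -
  have "0 \<le> cnj w * w" for w
  proof -
    have "cnj w * w = of_real ((cmod w)\<^sup>2)"
      by (simp add: complex_norm_square mult.commute del: of_real_power)
    thus ?thesis by (simp only: less_eq_complex_def) simp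
  qed
  hence "psd (block_mat 1 d (\<lambda>i j. ztoep d z))"
    unfolding psd_block_mat_iff by (simp add: sform_ztoep[OF assms(2)] del: cnj_sum)
  hence "psd (block_mat 1 n (\<lambda>i j. \<psi> (ztoep d z)))"
    using assms(1) unfolding completely_positive_def by simp
  thus ?thesis unfolding psd_block_mat_iff psd_form_def by (auto dest: spec[of _ "\<lambda>_. x" for x])
qed

text \<open>The symbol is a Laurent polynomial with exponents from \<open>1 - d\<close> to
  \<open>d - 1\<close>; the factor \<open>z ^ (d - 1)\<close> turns it into a polynomial.\<close>

definition symbpoly :: "nat \<Rightarrow> (complex mat \<Rightarrow> complex mat) \<Rightarrow> nat \<Rightarrow> nat \<Rightarrow> complex poly" where
  "symbpoly d \<psi> a b = (\<Sum>k\<in>diags d.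
     monom (\<psi> (toep d (\<lambda>j. if j = k then 1 else 0)) $$ (a, b)) (nat (k + int d - 1)))"

lemma poly_symbpoly:
  assumes "os_linear (toeplitz_sys d) n \<psi>" "a < n" "b < n" "cmod z = 1"
  shows "poly (symbpoly d \<psi> a b) z = z ^ (d - 1) * \<psi> (ztoep d z) $$ (a, b)"
proof -
  have "\<psi> (ztoep d z) $$ (a, b) = (\<Sum>k\<in>diags d. (if 0 \<le> k then z ^ nat k else cnj z ^ nat (- k)) *
      \<psi> (toep d (\<lambda>j. if j = k then 1 else 0)) $$ (a, b))"
    unfolding ztoep_def by (rule os_linear_toep[OF assms(1-3)])
  thus ?thesis
    unfolding symbpoly_def poly_sum poly_monom sum_distrib_left
  proof (simp only: sum_distrib_left, intro sum.cong[OF refl])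
  fix k assume "k \<in> diags d"
  have 1: "z ^ i * cnj z ^ i = 1" for i
    using unit_mult_cnj[OF assms(4)] by (simp flip: power_mult_distrib)
  have "z ^ nat (k + int d - 1) = z ^ (d - 1) * (if 0 \<le> k then z ^ nat k else cnj z ^ nat (- k))"
  proof (cases "0 \<le> k")
    case True
    hence "nat (k + int d - 1) = (d - 1) + nat k" using \<open>k \<in> diags d\<close> by (auto simp: diags_def)
    thus ?thesis using True by (simp add: power_add)
  next
    case False
    hence "nat (- k) \<le> d - 1" "nat (k + int d - 1) = d - 1 - nat (- k)" using \<open>k \<in> diags d\<close> by (auto simp: diags_def)
    thus ?thesis using False unit_power_diff(1)[OF assms(4), of "nat (- k)" "d - 1"] by simp
  qed
  thus "\<psi> (toep d (\<lambda>j. if j = k then 1 else 0)) $$ (a, b) * z ^ nat (k + int d - 1) =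
     z ^ (d - 1) * ((if 0 \<le> k then z ^ nat k else cnj z ^ nat (- k)) *
       \<psi> (toep d (\<lambda>j. if j = k then 1 else 0)) $$ (a, b))" by simp
  qed
qed

lemma coeff_symbpoly:
  assumes "k \<in> diags d"
  shows "coeff (symbpoly d \<psi> a b) (nat (k + int d - 1)) = \<psi> (toep d (\<lambda>j. if j = k then 1 else 0)) $$ (a, b)"
proof -
  have "coeff (symbpoly d \<psi> a b) (nat (k + int d - 1)) =
     (\<Sum>l\<in>diags d. if l = k then \<psi> (toep d (\<lambda>j. if j = l then 1 else 0)) $$ (a, b) else 0)"
    unfolding symbpoly_def coeff_sum
  proof (rule sum.cong[OF refl])
    fix l assume "l \<in> diags d"
    hence "nat (l + int d - 1) = nat (k + int d - 1) \<longleftrightarrow> l = k" using assms by (auto simp: diags_def)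
    thus "coeff (monom (\<psi> (toep d (\<lambda>j. if j = l then 1 else 0)) $$ (a, b)) (nat (l + int d - 1))) (nat (k + int d - 1))
       = (if l = k then \<psi> (toep d (\<lambda>j. if j = l then 1 else 0)) $$ (a, b) else 0)"
      by (simp add: coeff_monom)
  qed
  thus ?thesis using assms by simp
qed

lemma degree_symbpoly: "degree (symbpoly d \<psi> a b) \<le> 2 * (d - 1)"
  unfolding symbpoly_def
proof (rule degree_sum_le)
  fix k assume "k \<in> diags d"
  hence "nat (k + int d - 1) \<le> 2 * (d - 1)" by (auto simp: diags_def)
  thus "degree (monom (\<psi> (toep d (\<lambda>j. if j = k then 1 else 0)) $$ (a, b)) (nat (k + int d - 1))) \<le> 2 * (d - 1)"
    using degree_monom_le order_trans by blast
qed auto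

text \<open>
  On the circle the symbol of \<open>\<psi> \<le> \<phi>\<close> is a scalar multiple \<open>h\<close> of the rank-one symbol of \<open>\<phi>\<close>.
  The absence of common zeros makes \<open>h\<close> a polynomial, and the degree bound makes it constant.
\<close>

lemma vmap_pure:
  assumes V: "isometry_mat d n V" and dn: "0 < d" "0 < n"
    and roots: "\<And>z. \<exists>a<n. poly (colpoly d V a) z \<noteq> 0" and top: "\<exists>a<n. V (d - 1) a \<noteq> 0"
  shows "vmap d n V \<in> PureUCP (toeplitz_sys d) n"
proof -
  define \<phi> where "\<phi> = vmap d n V"
  have \<phi>: "\<phi> \<in> UCP (toeplitz_sys d) n" unfolding \<phi>_def by (rule vmap_UCP[OF V])
  define P where "P = colpoly d V"
  define R where "R = revpoly d V"
  have \<phi>z: "\<phi> (ztoep d z) $$ (a, b) = poly (P a) z * cnj (poly (P b) z)"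
    if "a < n" "b < n" "cmod z = 1" for a b z
    using that by (simp add: \<phi>_def vmap_index sform_ztoep P_def poly_colpoly evec_def mult.commute)
  have P_ex: "\<exists>a\<in>{..<n}. poly (P a) z \<noteq> 0" for z using roots[of z] by (auto simp: P_def)
  \<comment> \<open>A common zero of \<open>R\<close> at the origin would be one of the columns at
    infinity, excluded by \<open>top\<close>; its other zeros are reflections in the circle of zeros
    of \<open>P\<close>.\<close>
  have R_ex: "\<exists>a\<in>{..<n}. poly (R a) z \<noteq> 0" for z
  proof (cases "z = 0")
    case True
    thus ?thesis using top dn by (auto simp: R_def poly_revpoly_0)
  next
    case False
    thus ?thesis using roots[of "1 / cnj z"] by (auto simp: R_def poly_revpoly_nonzero)
  qed
  have "\<exists>t\<in>{0..1::real}. \<forall>x\<in>toeplitz_mats d. \<psi> x = complex_of_real t \<cdot>\<^sub>m \<phi> x"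
    if \<psi>: "\<psi> \<in> CP (toeplitz_sys d) n" and le: "cp_le (toeplitz_sys d) n \<psi> \<phi>" for \<psi>
  proof -
    have cp: "completely_positive (toeplitz_sys d) n \<psi>" and lin: "os_linear (toeplitz_sys d) n \<psi>"
      using \<psi> by (auto simp: CP_def completely_positive_def)
    note lin\<phi> = UCP_D(2)[OF \<phi>]
    have car: "\<psi> x \<in> carrier_mat n n" "\<phi> x \<in> carrier_mat n n" if "x \<in> toeplitz_mats d" for x
      using that lin lin\<phi> by (auto simp: os_linear_def)
    have F1: "psd_form n (entries (\<psi> (ztoep d z)))" if "cmod z = 1" for z
      by (rule CP_ztoep[OF cp that])
    have F2: "psd_form n (\<lambda>a b. poly (P a) z * cnj (poly (P b) z) - entries (\<psi> (ztoep d z)) a b)"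
      if z: "cmod z = 1" for z
    proof -
      have "psd_form n (entries (\<phi> (ztoep d z) - \<psi> (ztoep d z)))"
        using CP_ztoep[OF _ z, of d n "\<lambda>x. \<phi> x - \<psi> x"] le by (simp add: cp_le_def)
      moreover have "sform n (entries (\<phi> (ztoep d z) - \<psi> (ztoep d z))) x x =
          sform n (\<lambda>a b. poly (P a) z * cnj (poly (P b) z) - entries (\<psi> (ztoep d z)) a b) x x" for x
        by (rule sform_cong) (use car[OF ztoep_in, of z] \<phi>z z in auto)
      ultimately show ?thesis by (simp add: psd_form_def)
    qed
    define Q where "Q = symbpoly d \<psi>"
    \<comment> \<open>Columns of the symbol of \<open>\<psi>\<close> are proportional to
      \<open>P\<close>, as this symbol lies below a rank-one form.\<close>
    have QP: "Q a b * P c = Q c b * P a" if "a < n" "b < n" "c < n" for a b c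
    proof (rule poly_eq_on_circle)
      fix z :: complex assume z: "cmod z = 1"
      show "poly (Q a b * P c) z = poly (Q c b * P a) z"
        using psd_form_below_rank1[OF F1[OF z] F2[OF z] that] poly_symbpoly[OF lin _ _ z] that
        by (simp add: Q_def mult.assoc)
    qed
    \<comment> \<open>Rows follow by Hermitian symmetry; \<open>R\<close> takes the place of the
      conjugate of \<open>P\<close>, which is not a polynomial.\<close>
    have QR: "Q a b * R c = Q a c * R b" if "a < n" "b < n" "c < n" for a b c
    proof (rule poly_eq_on_circle)
      fix z :: complex assume z: "cmod z = 1"
      have herm: "entries (\<psi> (ztoep d z)) i j = cnj (entries (\<psi> (ztoep d z)) j i)" if "i < n" "j < n" for i j
        using psd_form_hermitian[OF F1[OF z], of "\<lambda>l. if l = i then 1 else 0" "\<lambda>l. if l = j then 1 else 0"]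
        by (simp add: psd_form_entry that)
      have "entries (\<psi> (ztoep d z)) b a * poly (P c) z = entries (\<psi> (ztoep d z)) c a * poly (P b) z"
        using psd_form_below_rank1[OF F1[OF z] F2[OF z], of b a c] that by simp
      hence "entries (\<psi> (ztoep d z)) a b * cnj (poly (P c) z) = entries (\<psi> (ztoep d z)) a c * cnj (poly (P b) z)"
        using herm[of a b] herm[of a c] that by (metis complex_cnj_mult)
      thus "poly (Q a b * R c) z = poly (Q a c * R b) z"
        using poly_symbpoly[OF lin _ _ z] that
        by (simp add: Q_def R_def poly_revpoly_circle[OF z] P_def[symmetric] mult_ac)
    qed
    obtain a0 where a0: "a0 < n" "P a0 \<noteq> 0" using P_ex[of 0] by (metis lessThan_iff poly_0)
    have "\<exists>S. Q a0 b = P a0 * S" if "b < n" for b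
    proof -
      have "P a0 dvd Q a0 b"
        by (rule dvd_no_common_root[OF a0(2) _ P_ex]) (use QP[OF a0(1) that] in auto)
      thus ?thesis by (auto simp: dvd_def)
    qed
    then obtain S where S: "Q a0 b = P a0 * S b" if "b < n" for b by metis
    have QS: "Q a b = P a * S b" if "a < n" "b < n" for a b
    proof -
      have "P a0 * Q a b = P a0 * (P a * S b)"
        using QP[OF a0(1) that(2,1)] S[OF that(2)] by (metis mult.assoc mult.commute)
      thus ?thesis using a0(2) by simp
    qed
    have SR: "S b * R c = S c * R b" if "b < n" "c < n" for b c
    proof -
      have "P a0 * (S b * R c) = P a0 * (S c * R b)"
        using QR[OF a0(1) that] QS[OF a0(1)] that by (simp add: mult_ac)
      thus ?thesis using a0(2) by simp
    qed
    obtain b0 where b0: "b0 < n" "R b0 \<noteq> 0" using R_ex[of 0] by (metis lessThan_iff poly_0)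
    have "R b0 dvd S b0"
      by (rule dvd_no_common_root[OF b0(2) _ R_ex]) (use SR[OF b0(1)] in auto)
    then obtain s where s: "S b0 = R b0 * s" by (auto simp: dvd_def)
    have Ss: "S b = R b * s" if "b < n" for b
    proof -
      have "R b0 * S b = R b0 * (R b * s)" using SR[OF b0(1) that] s by (metis mult.assoc mult.commute)
      thus ?thesis using b0(2) by simp
    qed
    \<comment> \<open>\<open>P a1\<close> has degree at least \<open>d - 1\<close> by
      \<open>top\<close>, and so has \<open>R b1\<close>, whose top coefficient is conjugate to the
      constant one of \<open>P b1\<close>. Together they use up the degree
      \<open>2 * (d - 1)\<close> of the symbol.\<close>
    have "degree s = 0"
    proof (cases "s = 0")
      case False
      obtain a1 where a1: "a1 < n" "V (d - 1) a1 \<noteq> 0" using top by auto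
      obtain b1 where b1: "b1 < n" "poly (P b1) 0 \<noteq> 0" using P_ex[of 0] by auto
      have "coeff (P a1) (d - 1) \<noteq> 0" using a1(2) dn by (simp add: P_def coeff_colpoly)
      hence 1: "P a1 \<noteq> 0" "d - 1 \<le> degree (P a1)" using le_degree by auto
      have "V 0 b1 \<noteq> 0" using b1(2) dn by (auto simp: P_def poly_0_coeff_0 coeff_colpoly)
      hence "coeff (R b1) (d - 1) \<noteq> 0" using coeff_revpoly_top[OF dn(1), of V b1] by (simp add: R_def)
      hence 2: "R b1 \<noteq> 0" "d - 1 \<le> degree (R b1)" using le_degree by auto
      have "degree (Q a1 b1) = degree (P a1) + (degree (R b1) + degree s)"
        using 1 2 False QS[OF a1(1) b1(1)] Ss[OF b1(1)] by (simp add: degree_mult_eq)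
      thus ?thesis using 1 2 degree_symbpoly[of d \<psi> a1 b1] unfolding Q_def by linarith
    qed simp
    then obtain t where t: "s = [:t:]" by (rule degree_eq_zeroE)
    have Q\<phi>: "symbpoly d \<phi> a b = P a * R b" if "a < n" "b < n" for a b
    proof (rule poly_eq_on_circle)
      fix z :: complex assume z: "cmod z = 1"
      show "poly (symbpoly d \<phi> a b) z = poly (P a * R b) z"
        using poly_symbpoly[OF lin\<phi> that z] \<phi>z[OF that z]
        by (simp add: R_def poly_revpoly_circle[OF z] P_def mult_ac)
    qed
    have Qt: "Q a b = smult t (symbpoly d \<phi> a b)" if "a < n" "b < n" for a b
      using QS[OF that] Ss[OF that(2)] Q\<phi>[OF that] by (simp add: t mult_ac)
    have eq: "\<psi> x = t \<cdot>\<^sub>m \<phi> x" if x: "x \<in> toeplitz_mats d" for x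
    proof (rule eq_matI)
      obtain f where f: "x = toep d f" by (rule toeplitz_matsE[OF x])
      fix a b assume "a < dim_row (t \<cdot>\<^sub>m \<phi> x)" "b < dim_col (t \<cdot>\<^sub>m \<phi> x)"
      hence ab: "a < n" "b < n" using car[OF x] by auto
      have "\<psi> (toep d (\<lambda>j. if j = k then 1 else 0)) $$ (a, b) = t * \<phi> (toep d (\<lambda>j. if j = k then 1 else 0)) $$ (a, b)"
        if "k \<in> diags d" for k
        using arg_cong[OF Qt[OF ab], of "\<lambda>p. coeff p (nat (k + int d - 1))"]
        by (simp add: Q_def coeff_symbpoly[OF that])
      hence "\<psi> x $$ (a, b) = t * \<phi> x $$ (a, b)"
        unfolding f os_linear_toep[OF lin ab, of f] os_linear_toep[OF lin\<phi> ab, of f] sum_distrib_left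
        by (intro sum.cong refl) simp
      thus "\<psi> x $$ (a, b) = (t \<cdot>\<^sub>m \<phi> x) $$ (a, b)" using ab car[OF x] by simp
    qed (use car[OF x] in auto)
    \<comment> \<open>So far \<open>t\<close> is complex. Positivity of both symbols at the point 1,
      on a diagonal entry where that of \<open>\<phi>\<close> is nonzero, puts it into the unit
      interval.\<close>
    obtain a1 where a1: "a1 < n" "poly (P a1) 1 \<noteq> 0" using P_ex[of 1] by auto
    define m where "m = (cmod (poly (P a1) 1))\<^sup>2"
    have m: "0 < m" "poly (P a1) 1 * cnj (poly (P a1) 1) = of_real m"
      using a1(2) by (simp_all add: m_def complex_norm_square del: of_real_power)
    have \<psi>1: "\<psi> (ztoep d 1) $$ (a1, a1) = t * of_real m"
      using eq[OF ztoep_in[of d 1]] \<phi>z[OF a1(1) a1(1), of 1] car(2)[OF ztoep_in[of d 1]] a1(1) m(2) by simp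
    let ?e = "\<lambda>l. if l = a1 then 1 else (0::complex)"
    have "0 \<le> sform n (entries (\<psi> (ztoep d 1))) ?e ?e"
      using F1[OF norm_one] unfolding psd_form_def by blast
    hence "0 \<le> \<psi> (ztoep d 1) $$ (a1, a1)" unfolding psd_form_entry[OF a1(1) a1(1)] .
    moreover have "0 \<le> sform n (\<lambda>a b. poly (P a) 1 * cnj (poly (P b) 1) - entries (\<psi> (ztoep d 1)) a b) ?e ?e"
      using F2[OF norm_one] unfolding psd_form_def by blast
    hence "0 \<le> of_real m - \<psi> (ztoep d 1) $$ (a1, a1)" unfolding psd_form_entry[OF a1(1) a1(1)] m(2) .
    ultimately have "0 \<le> t * of_real m" "0 \<le> of_real m - t * of_real m" by (simp_all add: \<psi>1)
    hence "Im t = 0" "0 \<le> Re t" "Re t \<le> 1"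
      using m(1) by (auto simp: less_eq_complex_def zero_le_mult_iff)
    hence "t = of_real (Re t)" "Re t \<in> {0..1}" by (auto simp: complex_eq_iff)
    thus ?thesis using eq by metis
  qed
  moreover have "\<phi> (1\<^sub>m d) \<noteq> 0\<^sub>m n n"
  proof
    assume "\<phi> (1\<^sub>m d) = 0\<^sub>m n n"
    hence "(1\<^sub>m n :: complex mat) $$ (0, 0) = 0\<^sub>m n n $$ (0, 0)" using UCP_D(3)[OF \<phi>] by simp
    thus False using dn by simp
  qed
  ultimately have "pure_cp (toeplitz_sys d) n \<phi>"
    unfolding pure_cp_def using \<phi> one_toeplitz[of d] by (auto simp: UCP_def)
  thus ?thesis using \<phi> by (simp add: PureUCP_def \<phi>_def)
qed

section \<open>Isometries in coordinates with respect to roots of unity\<close>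

definition ip :: "nat \<Rightarrow> (nat \<Rightarrow> complex) \<Rightarrow> (nat \<Rightarrow> complex) \<Rightarrow> complex" where
  "ip d x y = (\<Sum>j<d. cnj (x j) * y j)"

definition orthonormal_rows :: "nat \<Rightarrow> nat \<Rightarrow> (nat \<Rightarrow> nat \<Rightarrow> complex) \<Rightarrow> bool" where
  "orthonormal_rows d n c \<longleftrightarrow> (\<forall>a<n. \<forall>b<n. ip d (c a) (c b) = (if a = b then 1 else 0))"

text \<open>Coordinates with respect to the orthonormal basis of normalized geometric vectors; as
  inner products are preserved, isometries can be built and perturbed row by row.\<close>

definition synth :: "nat \<Rightarrow> (nat \<Rightarrow> complex) \<Rightarrow> nat \<Rightarrow> complex" where
  "synth d x p = (\<Sum>j<d. x j * evec (rou d j) p) / of_real (sqrt (real d))"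

lemma ip_cnj: "ip d y x = cnj (ip d x y)"
  by (simp add: ip_def mult.commute)

lemma ip_comb_right: "ip d x (\<lambda>j. k * y j + l * z j) = k * ip d x y + l * ip d x z"
  by (simp add: ip_def distrib_left sum.distrib sum_distrib_left mult_ac)

lemma ip_comb_left: "ip d (\<lambda>j. k * y j + l * z j) x = cnj k * ip d y x + cnj l * ip d z x"
  by (simp add: ip_def algebra_simps sum.distrib sum_distrib_left)

lemma ip_self: "ip d x x = of_real (nsq d x)"
  by (simp add: ip_def nsq_eq)

lemma sform_synth:
  assumes "0 < d"
  shows "sform d F (synth d x) (synth d y) =
     (\<Sum>i<d. \<Sum>j<d. cnj (x i) * y j * (sform d F (evec (rou d i)) (evec (rou d j)) / of_nat d))"
proof -
  have left: "sform d F (\<lambda>p. \<Sum>j\<in>J. x j * u j p) v = (\<Sum>j\<in>J. cnj (x j) * sform d F (u j) v)"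
    if "finite J" for J x u v
    using that
    by induction (simp_all add: sform_add_left sform_scale_left, simp add: sform_def)
  have right: "sform d F v (\<lambda>p. \<Sum>j\<in>J. x j * u j p) = (\<Sum>j\<in>J. x j * sform d F v (u j))"
    if "finite J" for J x u v
    using that
    by induction (simp_all add: sform_add_right sform_scale_right, simp add: sform_def)
  define r where "r = complex_of_real (1 / sqrt (real d))"
  have r: "cnj r * r = 1 / of_nat d"
    using assms by (simp add: r_def flip: of_real_mult)
  have eq: "synth d x = (\<lambda>p. r * (\<Sum>j<d. x j * evec (rou d j) p))" for x
    by (rule ext) (simp add: synth_def r_def)
  have "sform d F (synth d x) (synth d y) =
     cnj r * r * (\<Sum>i<d. cnj (x i) * (\<Sum>j<d. y j * sform d F (evec (rou d i)) (evec (rou d j))))"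
    unfolding eq sform_scale_left sform_scale_right by (simp add: left right)
  also have "\<dots> = (\<Sum>i<d. \<Sum>j<d. cnj (x i) * y j * (sform d F (evec (rou d i)) (evec (rou d j)) / of_nat d))"
    unfolding r by (simp add: sum_distrib_left mult_ac)
  finally show ?thesis .
qed

lemma ip_synth:
  assumes "0 < d" shows "ip d (synth d x) (synth d y) = ip d x y"
proof -
  have "ip d (synth d x) (synth d y) = sform d (\<lambda>a b. if a = b then 1 else 0) (synth d x) (synth d y)"
    by (simp add: ip_def sform_one)
  also have "\<dots> = (\<Sum>i<d. \<Sum>j<d. cnj (x i) * y j * ((\<Sum>p<d. rou d j ^ p * cnj (rou d i) ^ p) / of_nat d))"
    by (subst sform_synth[OF assms]) (simp add: sform_one evec_def mult.commute)
  also have "\<dots> = (\<Sum>i<d. \<Sum>j<d. if j = i then cnj (x i) * y i else 0)"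
    using assms by (intro sum.cong refl) (auto simp: sum_rou_exponent)
  also have "\<dots> = ip d x y" by (simp add: ip_def)
  finally show ?thesis .
qed

lemma isometry_synth:
  assumes "0 < d" "orthonormal_rows d n c"
  shows "isometry_mat d n (\<lambda>p a. synth d (c a) p)"
  using assms ip_synth[OF assms(1), of "c a" "c b" for a b]
  by (simp add: isometry_mat_def orthonormal_rows_def ip_def)

text \<open>Rotating a row towards a unit vector orthogonal to all rows stays exactly within the
  isometries, so the perturbation needs no later correction.\<close>

lemma rotate_row:
  fixes k l :: real
  assumes c: "orthonormal_rows d n c" and "r < n" and q: "ip d q q = 1" "\<And>b. b < n \<Longrightarrow> ip d (c b) q = 0"
    and kl: "k\<^sup>2 + l\<^sup>2 = 1"
  shows "orthonormal_rows d n (c(r := \<lambda>j. of_real k * c r j + of_real l * q j))"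
proof -
  have q': "ip d q (c b) = 0" if "b < n" for b
    using q(2)[OF that] by (subst ip_cnj) simp
  have "(of_real k * of_real k + of_real l * of_real l :: complex) = 1"
    using kl by (simp flip: of_real_mult of_real_add add: power2_eq_square)
  thus ?thesis
    using assms(1,2) q q' unfolding orthonormal_rows_def
    by (auto simp: ip_comb_left ip_comb_right)
qed

definition rowval :: "nat \<Rightarrow> (nat \<Rightarrow> complex) \<Rightarrow> complex \<Rightarrow> complex" where
  "rowval d x z = (\<Sum>p<d. cnj (synth d x p) * z ^ p)"

lemma synth_comb: "synth d (\<lambda>j. k * x j + l * y j) p = k * synth d x p + l * synth d y p"
  by (simp add: synth_def algebra_simps sum.distrib add_divide_distrib sum_distrib_left)

lemma rowval_comb:
  "rowval d (\<lambda>j. of_real k * x j + of_real l * y j) z = of_real k * rowval d x z + of_real l * rowval d y z"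
  unfolding rowval_def synth_comb
  by (simp add: algebra_simps sum.distrib sum_distrib_left)

text \<open>By orthogonality only one coordinate survives at a grid point, so common zeros on the
  grid are visible in the coordinates.\<close>

lemma rowval_rou:
  assumes "i < d" shows "rowval d x (rou d i) = of_real (sqrt (real d)) * cnj (x i)"
proof -
  have "rowval d x (rou d i) = (\<Sum>p<d. \<Sum>j<d. cnj (x j) * (rou d i ^ p * cnj (rou d j) ^ p)) / of_real (sqrt (real d))"
    unfolding rowval_def sum_divide_distrib
    by (intro sum.cong refl) (simp add: synth_def cnj_evec sum_distrib_right sum_distrib_left mult_ac flip: sum_divide_distrib)
  also have "(\<Sum>p<d. \<Sum>j<d. cnj (x j) * (rou d i ^ p * cnj (rou d j) ^ p)) =
     (\<Sum>j<d. \<Sum>p<d. cnj (x j) * (rou d i ^ p * cnj (rou d j) ^ p))"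
    by (rule sum.swap)
  also have "\<dots> = (\<Sum>j<d. if j = i then of_nat d * cnj (x i) else 0)"
    unfolding sum_distrib_left[symmetric] using assms
    by (intro sum.cong refl) (auto simp: sum_rou_exponent)
  also have "\<dots> = of_nat d * cnj (x i)" using assms by simp
  also have "of_nat d * cnj (x i) / of_real (sqrt (real d)) = of_real (sqrt (real d)) * cnj (x i)"
  proof -
    have "of_nat d = complex_of_real (sqrt (real d)) * of_real (sqrt (real d))"
      by (simp flip: of_real_mult)
    thus ?thesis using assms by simp
  qed
  finally show ?thesis .
qed

text \<open>A single basis vector gives a Dirichlet kernel, and by telescoping each of its zeros in
  the plane satisfies \<open>z ^ d = 1\<close>; at its own centre it is nonzero.\<close>

lemma rowval_single_zero:
  assumes "j < d" "rowval d (\<lambda>i. if i = j then 1 else 0) z = 0"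
  obtains i where "i < d" "z = rou d i" "i \<noteq> j"
proof -
  have d: "0 < d" using assms by simp
  have "synth d (\<lambda>i. if i = j then 1 else 0) p = evec (rou d j) p / of_real (sqrt (real d))" for p
  proof -
    have "(\<Sum>i<d. (if i = j then 1 else 0) * evec (rou d i) p) = (\<Sum>i<d. if i = j then evec (rou d j) p else 0)"
      by (intro sum.cong refl) auto
    thus ?thesis using assms(1) by (simp add: synth_def)
  qed
  hence "rowval d (\<lambda>i. if i = j then 1 else 0) z = (\<Sum>p<d. cnj (evec (rou d j) p) * evec z p) / of_real (sqrt (real d))"
    by (simp add: rowval_def evec_def sum_divide_distrib)
  hence "(\<Sum>p<d. cnj (evec (rou d j) p) * evec z p) = 0" using assms d by simp
  hence "rou d j * (cnj (rou d j) ^ d * z ^ d - 1) = 0"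
    using dirichlet_telescope[OF norm_rou, of z d j d] by simp
  moreover have "rou d j \<noteq> 0" using norm_rou[of d j] by (metis norm_zero zero_neq_one)
  moreover have "cnj (rou d j) ^ d = 1" using rou_pow_N[OF d, of j] by (metis complex_cnj_one complex_cnj_power)
  ultimately have "z ^ d = 1" by simp
  then obtain i where i: "i < d" "z = rou d i"
    using bij_betw_roots_unity[OF d] unfolding bij_betw_def rou_def by blast
  moreover have "i \<noteq> j" using rowval_rou[OF i(1), of "\<lambda>i. if i = j then 1 else 0"] assms(2) i d by auto
  ultimately show ?thesis using that by blast
qed

text \<open>The rational parametrization of the circle by the tangent of the half angle. With it,
  vanishing of a rotated value is a quadratic equation in \<open>t\<close>, so only finitely many
  parameters are bad.\<close>

lemma half_angle_coeffs:
  fixes t :: real assumes "0 < t" "t < 1"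
  shows "((1 - t\<^sup>2) / (1 + t\<^sup>2))\<^sup>2 + (2 * t / (1 + t\<^sup>2))\<^sup>2 = 1"
    "\<bar>(1 - t\<^sup>2) / (1 + t\<^sup>2) - 1\<bar> \<le> 2 * t" "\<bar>2 * t / (1 + t\<^sup>2)\<bar> \<le> 2 * t" "(1 - t\<^sup>2) / (1 + t\<^sup>2) \<noteq> 0"
proof -
  have "t\<^sup>2 \<le> t" using assms by (simp add: power2_eq_square mult_left_le)
  hence t: "0 < 1 + t\<^sup>2" "t\<^sup>2 \<le> t" "t\<^sup>2 < 1" using assms by (auto simp: add_pos_nonneg)
  show "((1 - t\<^sup>2) / (1 + t\<^sup>2))\<^sup>2 + (2 * t / (1 + t\<^sup>2))\<^sup>2 = 1"
    using t(1) by (simp add: power_divide add_divide_distrib[symmetric]) (simp add: power2_eq_square algebra_simps)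
  have "(1 - t\<^sup>2) / (1 + t\<^sup>2) - 1 = - (2 * t\<^sup>2 / (1 + t\<^sup>2))" using t(1) by (simp add: field_simps)
  moreover have "2 * t\<^sup>2 / (1 + t\<^sup>2) \<le> 2 * t\<^sup>2 / 1" using t by (intro divide_left_mono) auto
  ultimately show "\<bar>(1 - t\<^sup>2) / (1 + t\<^sup>2) - 1\<bar> \<le> 2 * t" using t by simp
  have "2 * t / (1 + t\<^sup>2) \<le> 2 * t / 1" using t assms by (intro divide_left_mono) auto
  thus "\<bar>2 * t / (1 + t\<^sup>2)\<bar> \<le> 2 * t" using t assms by simp
  show "(1 - t\<^sup>2) / (1 + t\<^sup>2) \<noteq> 0" using t by simp
qed

lemma entry_le_1:
  assumes "orthonormal_rows d n c" "a < n" "j < d" shows "cmod (c a j) \<le> 1"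
proof -
  have "complex_of_real (nsq d (c a)) = 1" using assms ip_self[of d "c a"] by (simp add: orthonormal_rows_def)
  hence "nsq d (c a) = 1" by simp
  moreover have "(cmod (c a j))\<^sup>2 \<le> nsq d (c a)"
    unfolding nsq_def using assms(3) by (intro member_le_sum) auto
  ultimately show ?thesis by (simp add: power_le_one_iff abs_square_le_1)
qed

text \<open>
  Two rotations, of the rows \<open>0\<close> and \<open>1\<close>, destroy all common zeros. The first gives row \<open>0\<close> a
  nonzero value at every unoccupied root of unity but \<open>m\<close>, the second mixes into row \<open>1\<close> the
  kernel at \<open>m\<close>, which vanishes at the other roots of unity only. At each of the finitely many
  zeros of row \<open>0\<close> only finitely many parameters \<open>t\<close> of the second rotation are bad.
\<close>

lemma perturb_isometry:
  assumes c: "orthonormal_rows d n c" and n: "2 \<le> n" and \<epsilon>: "0 < \<epsilon>"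
    and un: "m < d" "m' < d" "m \<noteq> m'" "\<And>a. a < n \<Longrightarrow> c a m = 0" "\<And>a. a < n \<Longrightarrow> c a m' = 0"
  obtains c' where "orthonormal_rows d n c'"
    "\<And>a j. a < n \<Longrightarrow> j < d \<Longrightarrow> cmod (c' a j - c a j) \<le> \<epsilon>"
    "vmap d n (\<lambda>p a. synth d (c' a) p) \<in> PureUCP (toeplitz_sys d) n"
proof -
  have d: "0 < d" using un by simp
  define h where "h = min (\<epsilon> / 4) (1 / 2)"
  have h: "0 < h" "h < 1" "4 * h \<le> \<epsilon>" using \<epsilon> by (auto simp: h_def)
  \<comment> \<open>The unoccupied roots other than \<open>m\<close>; \<open>m'\<close> ensures that
    there is one, so that \<open>q1\<close> can be normalized.\<close>
  define U where "U = {j. j < d \<and> j \<noteq> m \<and> (\<forall>a<n. c a j = 0)}"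
  have U: "finite U" "m' \<in> U" "m \<notin> U" "U \<subseteq> {..<d}" using un by (auto simp: U_def)
  hence cU: "0 < card U" by (auto simp: card_gt_0_iff)
  define u where "u = 1 / sqrt (real (card U))"
  have u: "0 < u" "u \<le> 1" "u * u = 1 / real (card U)" using cU by (auto simp: u_def)
  define q1 where "q1 = (\<lambda>j. if j \<in> U then complex_of_real u else 0)"
  define q2 where "q2 = (\<lambda>j. if j = m then 1 else (0::complex))"
  define k1 where "k1 = (1 - h\<^sup>2) / (1 + h\<^sup>2)"
  define l1 where "l1 = 2 * h / (1 + h\<^sup>2)"
  note hc = half_angle_coeffs[OF h(1,2), folded k1_def l1_def]
  have l1: "0 < l1" using h by (simp add: l1_def add_pos_nonneg)
  define c1 where "c1 = c(0 := \<lambda>j. of_real k1 * c 0 j + of_real l1 * q1 j)"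
  have "ip d q1 q1 = (\<Sum>j<d. if j \<in> U then of_real (u * u) else 0)"
    unfolding ip_def q1_def by (intro sum.cong refl) auto
  also have "\<dots> = (\<Sum>j\<in>U. of_real (u * u))"
    using U by (simp add: sum.If_cases Int_absorb1)
  also have "\<dots> = 1" using u cU by simp
  finally have q1: "ip d q1 q1 = 1" .
  have q1c: "ip d (c b) q1 = 0" if "b < n" for b
    unfolding ip_def q1_def by (intro sum.neutral) (use that in \<open>auto simp: U_def\<close>)
  have on1: "orthonormal_rows d n c1"
    unfolding c1_def by (rule rotate_row[OF c _ q1 q1c hc(1)]) (use n in auto)
  have "ip d q2 q2 = (\<Sum>j<d. if j = m then 1 else 0)"
    unfolding ip_def q2_def by (intro sum.cong refl) auto
  hence q2: "ip d q2 q2 = 1" using un by simp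
  have c1m: "c1 b m = 0" if "b < n" for b
    using un(4)[OF that] U(3) n by (auto simp: c1_def q1_def un(4))
  have q2c: "ip d (c1 b) q2 = 0" if "b < n" for b
    unfolding ip_def q2_def by (intro sum.neutral) (use c1m[OF that] in auto)
  define V1 where "V1 = (\<lambda>p a. synth d (c1 a) p)"
  have pc: "poly (colpoly d (\<lambda>p a. synth d (e a) p) a) z = rowval d (e a) z" for e a z
    by (simp add: poly_colpoly rowval_def)
  have "rowval d (c1 0) (rou d m') \<noteq> 0"
    using un U(2) l1 u(1) n d by (simp add: rowval_rou c1_def q1_def)
  hence "colpoly d V1 0 \<noteq> 0" using pc[of c1 0] unfolding V1_def by (metis poly_0)
  hence "finite {z. poly (colpoly d V1 0) z = 0}" by (rule poly_roots_finite)
  hence finZ: "finite {z. rowval d (c1 0) z = 0}" unfolding V1_def pc .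
  define bad where "bad = (\<lambda>A q. {t::real. (1 - of_real t ^ 2) * A + 2 * of_real t * q = (0::complex)})"
  have finbad: "finite (bad A q)" if "A \<noteq> 0 \<or> q \<noteq> 0" for A q
  proof -
    have "[:A, 2 * q, - A:] \<noteq> 0" using that by auto
    hence "finite {z. poly [:A, 2 * q, - A:] z = 0}" by (rule poly_roots_finite)
    moreover have "of_real ` bad A q \<subseteq> {z. poly [:A, 2 * q, - A:] z = 0}"
      by (auto simp: bad_def algebra_simps power2_eq_square)
    ultimately have "finite (complex_of_real ` bad A q)" by (rule finite_subset[rotated])
    thus ?thesis by (rule finite_imageD) (simp add: inj_on_def)
  qed
  define Z where "Z = {z. rowval d (c1 0) z = 0 \<and> (rowval d (c1 1) z \<noteq> 0 \<or> rowval d q2 z \<noteq> 0)}"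
  \<comment> \<open>The last set guards the top coefficient of row 1, that is, the common zero at
    infinity.\<close>
  define B where "B = (\<Union>z\<in>Z. bad (rowval d (c1 1) z) (rowval d q2 z)) \<union> bad (synth d (c1 1) (d - 1)) (synth d q2 (d - 1))"
  have q2top: "synth d q2 (d - 1) \<noteq> 0"
  proof -
    have "(\<Sum>j<d. q2 j * evec (rou d j) (d - 1)) = (\<Sum>j<d. if j = m then evec (rou d m) (d - 1) else 0)"
      unfolding q2_def by (intro sum.cong refl) auto
    moreover have "rou d m \<noteq> 0" using norm_rou[of d m] by (metis norm_zero zero_neq_one)
    ultimately show ?thesis using d un by (simp add: synth_def evec_def)
  qed
  have "finite Z" using finZ by (rule finite_subset[rotated]) (auto simp: Z_def)
  hence "finite B" unfolding B_def using q2top by (auto intro!: finbad simp: Z_def)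
  moreover have "infinite {0<..<h}" using h by simp
  ultimately have "\<not> {0<..<h} \<subseteq> B" using finite_subset by blast
  then obtain t where "t \<in> {0<..<h}" "t \<notin> B" by blast
  hence t: "0 < t" "t < h" "t \<notin> B" by auto
  hence t1: "t < 1" using h by simp
  define k2 where "k2 = (1 - t\<^sup>2) / (1 + t\<^sup>2)"
  define l2 where "l2 = 2 * t / (1 + t\<^sup>2)"
  note tc = half_angle_coeffs[OF t(1) t1, folded k2_def l2_def]
  have good: "of_real k2 * A + of_real l2 * q \<noteq> 0" if "t \<notin> bad A q" for A q
  proof -
    have "0 < 1 + t\<^sup>2" by (simp add: add_pos_nonneg)
    hence p: "1 + t\<^sup>2 \<noteq> 0" by simp
    have "of_real k2 * A + of_real l2 * q = ((1 - of_real t ^ 2) * A + 2 * of_real t * q) / of_real (1 + t\<^sup>2)"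
      by (simp add: k2_def l2_def add_divide_distrib)
    thus ?thesis using that p unfolding bad_def by (simp del: of_real_add)
  qed
  define c' where "c' = c1(1 := \<lambda>j. of_real k2 * c1 1 j + of_real l2 * q2 j)"
  have on': "orthonormal_rows d n c'"
    unfolding c'_def by (rule rotate_row[OF on1 _ q2 q2c tc(1)]) (use n in auto)
  have row0: "c' 0 = c1 0" by (simp add: c'_def)
  have row1: "c1 1 = c 1" by (simp add: c1_def)
  have close: "cmod (of_real k * c a j + of_real l * q - c a j) \<le> 4 * s"
    if "\<bar>k - 1\<bar> \<le> 2 * s" "\<bar>l\<bar> \<le> 2 * s" "cmod q \<le> 1" "a < n" "j < d" for k l s q a j
  proof -
    have "of_real k * c a j + of_real l * q - c a j = of_real (k - 1) * c a j + of_real l * q"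
      by (simp add: algebra_simps)
    also have "cmod \<dots> \<le> \<bar>k - 1\<bar> * cmod (c a j) + \<bar>l\<bar> * cmod q"
      by (rule order_trans[OF norm_triangle_ineq]) (simp only: norm_mult norm_of_real order_refl)
    also have "\<dots> \<le> 2 * s * 1 + 2 * s * 1"
      using that entry_le_1[OF c that(4,5)] by (intro add_mono mult_mono) auto
    finally show ?thesis by simp
  qed
  have "cmod (c' a j - c a j) \<le> \<epsilon>" if aj: "a < n" "j < d" for a j
  proof -
    consider "a = 0" | "a = 1" | "a \<noteq> 0" "a \<noteq> 1" by blast
    thus ?thesis
    proof cases
      case 1
      have "cmod (q1 j) \<le> 1" using u by (simp add: q1_def)
      from close[OF hc(2,3) this aj] have "cmod (c' a j - c a j) \<le> 4 * h"
        using 1 by (simp add: row0 c1_def)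
      thus ?thesis using h by simp
    next
      case 2
      have "cmod (q2 j) \<le> 1" by (simp add: q2_def)
      from close[OF tc(2,3) this aj] have "cmod (c' a j - c a j) \<le> 4 * t"
        using 2 by (simp add: c'_def row1[simplified])
      thus ?thesis using t h by simp
    next
      case 3
      thus ?thesis using \<epsilon> by (simp add: c'_def c1_def)
    qed
  qed
  moreover have "vmap d n (\<lambda>p a. synth d (c' a) p) \<in> PureUCP (toeplitz_sys d) n"
  proof (rule vmap_pure[OF isometry_synth[OF d on'] d])
    show "0 < n" using n by simp
    have "t \<notin> bad (synth d (c1 1) (d - 1)) (synth d q2 (d - 1))" using t(3) by (simp add: B_def)
    from good[OF this] have "synth d (c' 1) (d - 1) \<noteq> 0"
      by (simp add: c'_def synth_comb)
    thus "\<exists>a<n. synth d (c' a) (d - 1) \<noteq> 0" using n by (intro exI[of _ 1]) auto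
    show "\<exists>a<n. poly (colpoly d (\<lambda>p a. synth d (c' a) p) a) z \<noteq> 0" for z
      unfolding pc
    proof (cases "rowval d (c1 0) z = 0")
      case False
      thus "\<exists>a<n. rowval d (c' a) z \<noteq> 0" using n by (intro exI[of _ 0]) (simp add: row0)
    next
      case z0: True
      show "\<exists>a<n. rowval d (c' a) z \<noteq> 0"
      proof (cases "rowval d (c1 1) z \<noteq> 0 \<or> rowval d q2 z \<noteq> 0")
        case True
        hence "t \<notin> bad (rowval d (c1 1) z) (rowval d q2 z)" using t(3) z0 by (auto simp: B_def Z_def)
        from good[OF this] have "rowval d (c' 1) z \<noteq> 0"
          by (simp add: c'_def rowval_comb)
        thus ?thesis using n by (intro exI[of _ 1]) auto
      next
        case False
        \<comment> \<open>No \<open>t\<close> helps here, since row 1 stays zero at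
          \<open>z\<close>. But \<open>z\<close> is then a grid point other than \<open>m\<close> at
          which row 0 vanishes, hence an occupied one. The occupying row is not 0, as
          \<open>k1 \<noteq> 0\<close>, and not 1, so it was left unchanged.\<close>
        then obtain i where i: "i < d" "z = rou d i" "i \<noteq> m"
          using rowval_single_zero[OF un(1), of z] unfolding q2_def by blast
        have sd: "complex_of_real (sqrt (real d)) \<noteq> 0" using d by simp
        have c10: "c1 0 i = 0" using z0 rowval_rou[OF i(1), of "c1 0"] sd i(2) by simp
        have "i \<notin> U"
        proof
          assume "i \<in> U"
          hence "c1 0 i = of_real l1 * of_real u" using n by (simp add: c1_def q1_def U_def)
          thus False using c10 l1 u(1) by simp
        qed
        then obtain a where a: "a < n" "c a i \<noteq> 0" using i by (auto simp: U_def)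
        have "a \<noteq> 0"
        proof
          assume "a = 0"
          hence "c1 0 i = of_real k1 * c 0 i" using \<open>i \<notin> U\<close> by (simp add: c1_def q1_def)
          thus False using c10 a \<open>a = 0\<close> hc(4) by simp
        qed
        moreover have "a \<noteq> 1"
          using False rowval_rou[OF i(1), of "c1 1"] row1 a i(2) sd by auto
        ultimately have "rowval d (c' a) z \<noteq> 0"
          using rowval_rou[OF i(1), of "c' a"] a i(2) sd by (simp add: c'_def c1_def)
        thus ?thesis using a by blast
      qed
    qed
  qed
  ultimately show ?thesis using that on' by blast
qed

section \<open>Approximation of unital completely positive maps on the circle by pure maps\<close>

lemma circle_linearD:
  assumes "os_linear circle_sys n \<Psi>" "f \<in> C_circle"
  shows "g \<in> C_circle \<Longrightarrow> \<Psi> (\<lambda>z. f z + g z) = \<Psi> f + \<Psi> g" "\<Psi> (\<lambda>z. k * f z) = k \<cdot>\<^sub>m \<Psi> f"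
    "\<Psi> f \<in> carrier_mat n n"
  using assms by (auto simp: os_linear_def)

lemma circle_linear_sum:
  assumes lin: "os_linear circle_sys n \<Psi>" and ab: "a < n" "b < n" and g: "\<And>l. l \<in> I \<Longrightarrow> g l \<in> C_circle"
    and "finite I"
  shows "(\<lambda>z. \<Sum>l\<in>I. k l * g l z) \<in> C_circle \<and>
         \<Psi> (\<lambda>z. \<Sum>l\<in>I. k l * g l z) $$ (a, b) = (\<Sum>l\<in>I. k l * \<Psi> (g l) $$ (a, b))"
  using \<open>finite I\<close> g
proof induction
  case empty
  have z: "(\<lambda>z. 0) \<in> C_circle" by (simp add: C_circle_def)
  have "\<Psi> (\<lambda>z. 0) = 0 \<cdot>\<^sub>m \<Psi> (\<lambda>z. 0)"
    using circle_linearD(2)[OF lin z, of 0] by simp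
  hence "\<Psi> (\<lambda>z. 0) $$ (a, b) = (0 \<cdot>\<^sub>m \<Psi> (\<lambda>z. 0)) $$ (a, b)" by simp
  thus ?case using ab circle_linearD(3)[OF lin z] z by simp
next
  case (insert l I)
  have IH: "(\<lambda>z. \<Sum>l\<in>I. k l * g l z) \<in> C_circle"
    "\<Psi> (\<lambda>z. \<Sum>l\<in>I. k l * g l z) $$ (a, b) = (\<Sum>l\<in>I. k l * \<Psi> (g l) $$ (a, b))"
    using insert by auto
  have gl: "g l \<in> C_circle" "(\<lambda>z. k l * g l z) \<in> C_circle" using insert.prems by (auto intro: C_circle_closed)
  have eq: "(\<lambda>z. \<Sum>l\<in>insert l I. k l * g l z) = (\<lambda>z. k l * g l z + (\<Sum>l\<in>I. k l * g l z))"
    using insert.hyps by simp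
  have "\<Psi> (\<lambda>z. k l * g l z + (\<Sum>l\<in>I. k l * g l z)) =
      k l \<cdot>\<^sub>m \<Psi> (g l) + \<Psi> (\<lambda>z. \<Sum>l\<in>I. k l * g l z)"
    using circle_linearD(1)[OF lin gl(2) IH(1)] circle_linearD(2)[OF lin gl(1), of "k l"] by simp
  moreover have "\<Psi> (g l) \<in> carrier_mat n n" "\<Psi> (\<lambda>z. \<Sum>l\<in>I. k l * g l z) \<in> carrier_mat n n"
    using circle_linearD(3)[OF lin] gl(1) IH(1) by auto
  ultimately show ?case
    unfolding eq using C_circle_closed(1)[OF gl(2) IH(1)] ab IH(2) insert.hyps by simp
qed

lemma os_linear_diff:
  assumes "os_linear circle_sys n \<Psi>" "f \<in> C_circle" "g \<in> C_circle"
  shows "\<Psi> (\<lambda>z. f z - g z) = \<Psi> f - \<Psi> g"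
proof -
  have "\<Psi> (\<lambda>z. f z - g z) = \<Psi> f + (- 1) \<cdot>\<^sub>m \<Psi> g"
    using circle_linearD(1)[OF assms(1,2) C_circle_closed(3)[OF assms(3), of "- 1"]]
      circle_linearD(2)[OF assms(1,3), of "- 1"] by simp
  moreover have "\<Psi> f \<in> carrier_mat n n" "\<Psi> g \<in> carrier_mat n n"
    using circle_linearD(3)[OF assms(1)] assms by auto
  ultimately show ?thesis by (intro eq_matI) auto
qed

lemma psd_form_UCP_circle:
  assumes \<Psi>: "\<Psi> \<in> UCP circle_sys n" and f: "f \<in> C_circle" "\<And>z. cmod z = 1 \<Longrightarrow> 0 \<le> f z"
  shows "psd_form n (entries (\<Psi> f))"
proof -
  have "psd (Matrix.mat 1 1 (\<lambda>(i, j). f z))" if "z \<in> sphere 0 1" for z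
  proof -
    have "0 \<le> sform 1 (entries (Matrix.mat 1 1 (\<lambda>(i, j). f z))) x x" for x
    proof -
      have "sform 1 (entries (Matrix.mat 1 1 (\<lambda>(i, j). f z))) x x = of_real ((cmod (x 0))\<^sup>2) * f z"
        by (simp add: sform_def complex_norm_square mult_ac del: of_real_power)
      moreover have "0 \<le> f z" using f(2) that by simp
      ultimately show ?thesis by (auto simp: less_eq_complex_def)
    qed
    thus ?thesis using psd_iff_sform[of "Matrix.mat 1 1 (\<lambda>(i, j). f z)" 1] by simp
  qed
  hence "psd (block_mat 1 n (\<lambda>i j. \<Psi> f))"
    using UCP_D(1)[OF \<Psi>] f(1) unfolding completely_positive_def circle_sys_simps by auto
  thus ?thesis unfolding psd_block_mat_iff psd_form_def by (auto dest: spec[of _ "\<lambda>_. x" for x])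
qed

text \<open>The Fejer kernel centred at an \<open>M\<close>-th root of unity, with \<open>M\<close>
  both the number of frequencies and the size of the grid.\<close>

definition hat :: "nat \<Rightarrow> nat \<Rightarrow> complex \<Rightarrow> complex" where
  "hat M l z = (if cmod z = 1 then of_real (fejer M (rou M l) z / (real M)\<^sup>2) else 0)"

lemma hat_in: "hat M l \<in> C_circle"
proof -
  have "continuous_on (sphere 0 1) (hat M l) \<longleftrightarrow>
     continuous_on (sphere 0 1) (\<lambda>z. of_real (fejer M (rou M l) z / (real M)\<^sup>2) :: complex)"
    by (rule continuous_on_cong) (auto simp: hat_def)
  moreover have "continuous_on (sphere 0 1) (\<lambda>z. of_real (fejer M (rou M l) z / (real M)\<^sup>2) :: complex)"
    unfolding fejer_def evec_def by (cases "M = 0") (auto intro!: continuous_intros)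
  ultimately show ?thesis by (auto simp: C_circle_def hat_def)
qed

lemma hat_nonneg: "0 \<le> hat M l z"
  by (simp add: hat_def fejer_nonneg less_eq_complex_def)

lemma hat_sum:
  assumes "0 < M" shows "(\<Sum>l<M. 1 * hat M l z) = (if z \<in> sphere 0 1 then 1 else 0)"
proof (cases "cmod z = 1")
  case True
  have "(\<Sum>l<M. hat M l z) = of_real ((\<Sum>l<M. fejer M (rou M l) z) / (real M)\<^sup>2)"
    using True by (simp add: hat_def sum_divide_distrib)
  thus ?thesis using True assms fejer_sum[of M M z] by (simp add: power2_eq_square)
qed (simp add: hat_def)

text \<open>Fejer interpolation has uniform error \<open>2 * L / sqrt M\<close> with chordal
  Lipschitz constant \<open>L = 2\<close>, and contractivity passes it on to \<open>\<Psi>\<close>.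
  Each matrix \<open>\<Psi> (hat M l)\<close> takes \<open>n\<close> rank-one terms, hence the
  second index of \<open>v\<close>.\<close>

lemma UCP_circle_discretize:
  assumes \<Psi>: "\<Psi> \<in> UCP circle_sys n" and M: "0 < M"
  obtains v where
    "\<And>a b. a < n \<Longrightarrow> b < n \<Longrightarrow> (\<Sum>l<M. \<Sum>r<n. v l r a * cnj (v l r b)) = (if a = b then 1 else 0)"
    "\<And>f. f \<in> lip1 \<Longrightarrow> form_bound n (\<lambda>a b. \<Psi> f $$ (a, b) -
        (\<Sum>l<M. f (rou M l) * (\<Sum>r<n. v l r a * cnj (v l r b)))) (4 / sqrt (real M))"
proof -
  note lin = UCP_D(2)[OF \<Psi>]
  have "\<exists>v. \<forall>a<n. \<forall>b<n. \<Psi> (hat M l) $$ (a, b) = (\<Sum>r<n. v r a * cnj (v r b))" for l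
    using psd_form_decomp[OF psd_form_UCP_circle[OF \<Psi> hat_in hat_nonneg], of M l] by metis
  hence "\<forall>l. \<exists>v. \<forall>a<n. \<forall>b<n. \<Psi> (hat M l) $$ (a, b) = (\<Sum>r<n. v r a * cnj (v r b))" by blast
  from choice[OF this] obtain v where
    v: "\<And>l a b. a < n \<Longrightarrow> b < n \<Longrightarrow> \<Psi> (hat M l) $$ (a, b) = (\<Sum>r<n. v l r a * cnj (v l r b))"
    by blast
  show ?thesis
  proof (rule that[of v])
    fix a b assume ab: "a < n" "b < n"
    have "\<Psi> (\<lambda>z. \<Sum>l<M. 1 * hat M l z) $$ (a, b) = (\<Sum>l<M. 1 * \<Psi> (hat M l) $$ (a, b))"
      using circle_linear_sum[OF lin ab, of "{..<M}" "hat M" "\<lambda>_. 1"] hat_in by blast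
    moreover have "\<Psi> (\<lambda>z. \<Sum>l<M. 1 * hat M l z) = 1\<^sub>m n"
      using UCP_D(3)[OF \<Psi>] unfolding hat_sum[OF M] by simp
    ultimately show "(\<Sum>l<M. \<Sum>r<n. v l r a * cnj (v l r b)) = (if a = b then 1 else 0)"
      using ab v[OF ab] by simp
  next
    fix f assume f: "f \<in> lip1"
    define g where "g = (\<lambda>z. \<Sum>l<M. f (rou M l) * hat M l z)"
    have g: "g \<in> C_circle" "\<And>a b. a < n \<Longrightarrow> b < n \<Longrightarrow> \<Psi> g $$ (a, b) = (\<Sum>l<M. f (rou M l) * \<Psi> (hat M l) $$ (a, b))"
    proof -
      show "g \<in> C_circle"
        unfolding g_def using hat_in by (auto simp: C_circle_def intro!: continuous_intros sum.neutral)
      show "\<Psi> g $$ (a, b) = (\<Sum>l<M. f (rou M l) * \<Psi> (hat M l) $$ (a, b))" if "a < n" "b < n" for a b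
        using circle_linear_sum[OF lin that, of "{..<M}" "hat M" "\<lambda>l. f (rou M l)"] hat_in unfolding g_def by blast
    qed
    have "cmod (f z - g z) \<le> 4 / sqrt (real M)" if z: "cmod z = 1" for z
    proof -
      have "g z = (\<Sum>l<M. f (rou M l) * of_real (fejer M (rou M l) z)) / (of_nat M * of_nat M)"
        using z by (simp add: g_def hat_def sum_divide_distrib power2_eq_square)
      moreover have "cmod (f w - f z) \<le> 2 * cmod (z - w)" if "cmod w = 1" for w
        using lip1_chord[OF f that z] .
      ultimately show ?thesis
        using fejer_approx[of M M z f 2] M z by (simp add: norm_minus_commute)
    qed
    hence "form_bound n (entries (\<Psi> (\<lambda>z. f z - g z))) (4 / sqrt (real M))"
      by (intro circle_UCP_form_bound[OF \<Psi>] C_circle_closed lip1_in f g(1))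
    moreover have "entries (\<Psi> (\<lambda>z. f z - g z)) a b = \<Psi> f $$ (a, b) -
        (\<Sum>l<M. f (rou M l) * (\<Sum>r<n. v l r a * cnj (v l r b)))" if "a < n" "b < n" for a b
      using that g(2)[OF that] v[OF that] UCP_D(4)[OF \<Psi>, of f] UCP_D(4)[OF \<Psi>, of g] g(1) lip1_in[OF f]
      by (simp add: os_linear_diff[OF lin lip1_in[OF f] g(1)])
    ultimately show "form_bound n (\<lambda>a b. \<Psi> f $$ (a, b) -
        (\<Sum>l<M. f (rou M l) * (\<Sum>r<n. v l r a * cnj (v l r b)))) (4 / sqrt (real M))"
      by (auto intro: form_bound_cong[rotated])
  qed
qed

section \<open>Moving the sample points to the \<open>d\<close>-th roots of unity\<close>

text \<open>Both arcs between the points have to be long: the gap \<open>L\<close> controls one,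
  \<open>i + L \<le> d\<close> and \<open>j + L \<le> d\<close> the one across the point 1. Each is
  at least \<open>2 * pi * L / d\<close>, and the chord is at least half of the shorter arc.\<close>

lemma rou_separation:
  assumes "i < d" "j < d" "i \<noteq> j" "L \<le> i - j \<or> L \<le> j - i" "i + L \<le> d" "j + L \<le> d"
  shows "real L / real d \<le> cmod (rou d i - rou d j)"
proof -
  have main: "real L / real d \<le> cmod (rou d i - rou d j)"
    if ij: "j < i" "i < d" "j + L \<le> i" "i + L \<le> d" for i j
  proof -
    define s where "s = 2 * pi * (real i - real j) / real d"
    have d: "0 < real d" using ij by simp
    have "rou d i = rou d j * cis s"
      unfolding rou_def s_def cis_mult by (rule arg_cong[of _ _ cis]) (simp add: field_simps diff_divide_distrib)
    hence "rou d i - rou d j = rou d j * (cis s - 1)" by (simp add: algebra_simps)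
    hence eq: "cmod (rou d i - rou d j) = cmod (cis s - 1)" by (simp add: norm_mult)
    have lo: "2 * pi * real L / real d \<le> s"
      unfolding s_def using ij d by (intro divide_right_mono mult_left_mono) auto
    have hi: "s \<le> 2 * pi - 2 * pi * real L / real d"
    proof -
      have "real i - real j \<le> real d - real L" using ij by linarith
      hence "s \<le> 2 * pi * (real d - real L) / real d"
        unfolding s_def using d by (intro divide_right_mono mult_left_mono) auto
      also have "\<dots> = 2 * pi - 2 * pi * real L / real d" using d by (simp add: field_simps)
      finally show ?thesis .
    qed
    have pi1: "real L / real d \<le> pi * real L / real d"
      using d pi_ge_two by (intro divide_right_mono) (auto simp: mult_le_cancel_right1)
    have s0: "0 \<le> s" using lo d pi_gt_zero by (auto intro: order_trans[rotated])
    show ?thesis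
    proof (cases "s \<le> pi")
      case True
      hence "s \<le> 2 * cmod (cis s - 1)" using abs_le_cmod_cis_minus_1[of s] s0 by simp
      thus ?thesis using lo pi1 by (simp add: eq)
    next
      case False
      have "cis (s - 2 * pi) = cis s"
        by (simp flip: cis_divide)
      moreover have "\<bar>s - 2 * pi\<bar> \<le> pi" 
      proof -
        have "0 \<le> 2 * pi * real L / real d" by simp
        thus ?thesis using False hi pi_gt_zero unfolding abs_le_iff by linarith
      qed
      ultimately have "\<bar>s - 2 * pi\<bar> \<le> 2 * cmod (cis s - 1)" using abs_le_cmod_cis_minus_1[of "s - 2 * pi"] by simp
      thus ?thesis using hi pi1 by (simp add: eq abs_le_iff)
    qed
  qed
  consider "j < i" "j + L \<le> i" | "i < j" "i + L \<le> j" using assms by linarith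
  thus ?thesis
  proof cases
    case 1
    thus ?thesis using main[of j i] assms by simp
  next
    case 2
    thus ?thesis using main[of i j] assms by (simp add: norm_minus_commute)
  qed
qed

lemma bounded_combination:
  assumes "\<And>i. i \<in> I \<Longrightarrow> cmod (x i) \<le> e" "0 \<le> e"
    "(\<Sum>i\<in>I. (cmod (v i))\<^sup>2) = 1" "(\<Sum>i\<in>I. (cmod (w i))\<^sup>2) = 1"
  shows "cmod (\<Sum>i\<in>I. v i * cnj (w i) * x i) \<le> e"
proof -
  have "cmod (\<Sum>i\<in>I. v i * cnj (w i) * x i) \<le> (\<Sum>i\<in>I. e * (((cmod (v i))\<^sup>2 + (cmod (w i))\<^sup>2) / 2))"
  proof (rule order_trans[OF norm_sum], rule sum_mono)
    fix i assume "i \<in> I"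
    have "cmod (v i) * cmod (w i) \<le> ((cmod (v i))\<^sup>2 + (cmod (w i))\<^sup>2) / 2"
      using two_mult_le_sum_squares[of "cmod (v i)" "cmod (w i)"] by simp
    thus "cmod (v i * cnj (w i) * x i) \<le> e * (((cmod (v i))\<^sup>2 + (cmod (w i))\<^sup>2) / 2)"
      using assms(1)[OF \<open>i \<in> I\<close>] assms(2) unfolding norm_mult complex_mod_cnj
      by (subst mult.commute) (intro mult_mono, auto)
  qed
  also have "\<dots> = e * ((\<Sum>i\<in>I. (cmod (v i))\<^sup>2) + (\<Sum>i\<in>I. (cmod (w i))\<^sup>2)) / 2"
    by (simp add: sum_distrib_left[symmetric] sum_divide_distrib[symmetric] sum.distrib)
  finally show ?thesis using assms(3,4) by simp
qed

lemma compr_fejer: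
  "sform d (entries (compr d N f)) (evec w) (evec w) / of_nat d =
     (\<Sum>j<N. f (rou N j) * of_real (fejer d (rou N j) w)) / (of_nat N * of_nat d)"
proof -
  have "cnj X * X = of_real ((cmod X)\<^sup>2)" for X
    by (simp add: complex_norm_square mult.commute del: of_real_power)
  thus ?thesis unfolding sform_compr fejer_def by (simp only: divide_divide_eq_left)
qed

text \<open>The diagonal part is a multiple of the identity, so under an isometry its contribution
  is known exactly, however large the coefficient.\<close>

lemma toep_split_diagonal:
  "sform d (entries (toep d f)) x y =
     f 0 * ip d x y + sform d (entries (toep d (\<lambda>k. if k = 0 then 0 else f k))) x y"
proof -
  have "sform d (entries (toep d f)) x y =
    sform d (\<lambda>p q. (if p = q then f 0 else 0) + (if int p - int q = 0 then 0 else f (int p - int q))) x y"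
    unfolding sform_entries_toep by (rule sform_cong) auto
  thus ?thesis unfolding sform_add sform_one sform_entries_toep ip_def .
qed

text \<open>
  The diagonal coefficient is removed in \<open>T'\<close> because \<open>f\<close> is only controlled up to a constant.
\<close>

lemma compr_estimates:
  assumes f: "f \<in> lip1" and d: "32 \<le> d" and N: "N = d ^ 4"
  defines "T' \<equiv> toep d (\<lambda>k. if k = 0 then 0 else rcoef N f k)"
  shows "cmod (sform d (entries T') (evec (rou d i)) (evec (rou d j)) / of_nat d) \<le> 4 * sqrt (real d)"
    and "cmod (rou d i - rou d j) * cmod (sform d (entries T') (evec (rou d i)) (evec (rou d j)) / of_nat d)
           \<le> 8 / sqrt (real d)"
    and "cmod (sform d (entries (compr d N f)) (evec (rou d i)) (evec (rou d i)) / of_nat d - f (rou d i))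
           \<le> 4 / sqrt (real d)"
proof -
  have d0: "0 < d" "real d \<noteq> 0" using d by auto
  have dN: "d \<le> N" unfolding N using d self_le_power[of d 4] by simp
  define a where "a = (\<lambda>k. if k = 0 then 0 else rcoef N f k)"
  have T': "T' = toep d a" by (simp add: T'_def a_def)
  \<comment> \<open>The exponent in \<open>N = d ^ 4\<close> is chosen for this: the grid error
    becomes \<open>8 * pi / d\<close>, at most 1 for \<open>32 \<le> d\<close> because
    \<open>pi < 4\<close>.\<close>
  have "8 * pi * real d ^ 3 / real N = 8 * pi / real d"
    using d0 by (simp add: N power_def numeral_eq_Suc)
  also have "\<dots> \<le> 1"
    using d pi_less_4 by (simp add: field_simps)
  finally have "1 + 8 * pi * real d ^ 3 / real N \<le> 2" by simp
  hence "form_bound d (\<lambda>p q. of_int (int p - int q) * rcoef N f (int p - int q)) 2"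
    by (rule form_bound_mono[OF form_bound_commutator_compr[OF f d0(1) dN]])
  hence "(\<Sum>k\<in>diags d. cmod (of_int k * rcoef N f k)) \<le> 2 * 2 * sqrt (real d)"
    by (rule commutator_l1) simp
  moreover have "(\<Sum>k\<in>diags d. cmod (a k)) \<le> (\<Sum>k\<in>diags d. cmod (of_int k * rcoef N f k))"
  proof (rule sum_mono)
    fix k
    have "k \<noteq> 0 \<Longrightarrow> 1 \<le> cmod (of_int k :: complex)"
      by (simp add: norm_of_int)
    thus "cmod (a k) \<le> cmod (of_int k * rcoef N f k)"
      by (auto simp: a_def norm_mult mult_le_cancel_right1)
  qed
  ultimately have l1: "(\<Sum>k\<in>diags d. cmod (a k)) \<le> 4 * sqrt (real d)" by simp
  have "cmod (sform d (entries T') (evec (rou d i)) (evec (rou d j))) \<le>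
     (\<Sum>k\<in>diags d. cmod (a k)) * (nsq d (evec (rou d i)) + nsq d (evec (rou d j))) / 2"
    using form_bound_toep[of d a] unfolding form_bound_def T' by blast
  hence "cmod (sform d (entries T') (evec (rou d i)) (evec (rou d j))) \<le> (\<Sum>k\<in>diags d. cmod (a k)) * real d"
    by (simp add: nsq_evec)
  also have "\<dots> \<le> 4 * sqrt (real d) * real d" using l1 by (intro mult_right_mono) auto
  finally show "cmod (sform d (entries T') (evec (rou d i)) (evec (rou d j)) / of_nat d) \<le> 4 * sqrt (real d)"
    using d0 by (simp add: norm_divide field_simps)
  \<comment> \<open>The distance of the two roots makes the bound 2 available for every diagonal,
    which leaves twice the l1 norm of the coefficients.\<close>
  have "cmod (rou d i - rou d j) * cmod (sform d (entries T') (evec (rou d i)) (evec (rou d j)))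
     \<le> (\<Sum>k\<in>diags d. cmod (a k) * 2)"
  proof -
    have "cmod (sform d (entries T') (evec (rou d i)) (evec (rou d j))) \<le>
       (\<Sum>k\<in>diags d. cmod (a k) * cmod (sform d (shift k) (evec (rou d i)) (evec (rou d j))))"
      unfolding T' sform_entries_toep sform_toep
      by (rule order_trans[OF norm_sum]) (simp add: norm_mult)
    hence "cmod (rou d i - rou d j) * cmod (sform d (entries T') (evec (rou d i)) (evec (rou d j))) \<le>
       cmod (rou d i - rou d j) * (\<Sum>k\<in>diags d. cmod (a k) * cmod (sform d (shift k) (evec (rou d i)) (evec (rou d j))))"
      by (intro mult_left_mono) auto
    also have "\<dots> = (\<Sum>k\<in>diags d. cmod (a k) * (cmod (rou d j - rou d i) * cmod (sform d (shift k) (evec (rou d i)) (evec (rou d j)))))"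
      by (simp add: sum_distrib_left mult_ac norm_minus_commute)
    also have "\<dots> \<le> (\<Sum>k\<in>diags d. cmod (a k) * 2)"
      by (intro sum_mono mult_left_mono sform_shift_evec_offdiag) auto
    finally show ?thesis .
  qed
  also have "\<dots> \<le> 8 * sqrt (real d)" using l1 by (simp flip: sum_distrib_right)
  also have "\<dots> = 8 / sqrt (real d) * real d"
    using real_div_sqrt[of "real d"] by (simp add: times_divide_eq_right[symmetric] del: times_divide_eq_right)
  finally show "cmod (rou d i - rou d j) * cmod (sform d (entries T') (evec (rou d i)) (evec (rou d j)) / of_nat d)
           \<le> 8 / sqrt (real d)"
    using d0 by (simp add: norm_divide pos_divide_le_eq)
  show "cmod (sform d (entries (compr d N f)) (evec (rou d i)) (evec (rou d i)) / of_nat d - f (rou d i))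
           \<le> 4 / sqrt (real d)"
    unfolding compr_fejer
    using fejer_approx[OF d0(1) dN norm_rou[of d i], of f 2] lip1_chord[OF f _ norm_rou[of d i]] by simp
qed

lemma sum_multiples:
  fixes g :: "nat \<Rightarrow> complex"
  assumes "K * L \<le> d" "0 < L" "\<And>j. j < d \<Longrightarrow> \<not> (j < K * L \<and> L dvd j) \<Longrightarrow> g j = 0"
  shows "(\<Sum>j<d. g j) = (\<Sum>J<K. g (J * L))"
proof -
  have "(\<Sum>j<d. g j) = (\<Sum>j\<in>(\<lambda>J. J * L) ` {..<K}. g j)"
  proof (rule sum.mono_neutral_right)
    show "(\<lambda>J. J * L) ` {..<K} \<subseteq> {..<d}"
    proof (rule image_subsetI)
      fix J assume "J \<in> {..<K}"
      hence "J < K" by simp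
      hence "J * L < K * L" using assms(2) by (intro mult_strict_right_mono) auto
      hence "J * L < d" using assms(1) by (rule less_le_trans)
      thus "J * L \<in> {..<d}" by simp
    qed
    show "\<forall>j\<in>{..<d} - (\<lambda>J. J * L) ` {..<K}. g j = 0"
    proof
      fix j assume j: "j \<in> {..<d} - (\<lambda>J. J * L) ` {..<K}"
      have "\<not> (j < K * L \<and> L dvd j)"
      proof
        assume *: "j < K * L \<and> L dvd j"
        then obtain J where "j = J * L" by (metis dvd_def mult.commute)
        thus False using * j by auto
      qed
      thus "g j = 0" using assms(3) j by auto
    qed
  qed auto
  also have "\<dots> = (\<Sum>J<K. g (J * L))"
    using assms(2) by (subst sum.reindex) (auto simp: inj_on_def)
  finally show ?thesis .
qed

lemma sum_div_mod:
  fixes h :: "nat \<Rightarrow> nat \<Rightarrow> complex"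
  shows "(\<Sum>J<M * n. h (J div n) (J mod n)) = (\<Sum>l<M. \<Sum>r<n. h l r)"
  unfolding sum_blocks by (intro sum.cong refl) simp

text \<open>Put \<open>K = M * n\<close>. As \<open>L\<close> is \<open>d / K\<close> rounded down,
  \<open>J * L / d\<close> is within \<open>K / d\<close> of \<open>J / K\<close>; and
  \<open>J / K\<close> is within \<open>1 / M\<close> of the sample point, because \<open>n\<close>
  consecutive positions share it.\<close>

lemma arc_estimate:
  assumes "0 < M" "0 < n" "J < M * n" "M * n * L \<le> d" "d < M * n * L + M * n" "0 < d"
  shows "\<bar>2 * pi * real (J * L) / real d - 2 * pi * real (J div n) / real M\<bar>
     \<le> 2 * pi * (real (M * n) / real d + 1 / real M)"
proof -
  define K where "K = real M * real n"
  define l where "l = J div n"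
  have K: "0 < K" using assms by (simp add: K_def)
  have d: "0 < real d" using assms by simp
  have KL: "K * real L \<le> real d" "real d \<le> K * real L + K"
    using assms(4,5) unfolding K_def by (simp_all flip: of_nat_mult of_nat_add)
  have J: "real J \<le> K" using assms(3) unfolding K_def by (simp flip: of_nat_mult)
  have l: "real l * real n \<le> real J" "real J \<le> real l * real n + real n"
  proof -
    have "J = l * n + J mod n" by (simp add: l_def)
    moreover have "J mod n \<le> n" using assms(2) by simp
    ultimately have "l * n \<le> J" "J \<le> l * n + n" by linarith+
    thus "real l * real n \<le> real J" "real J \<le> real l * real n + real n"
      by (simp_all flip: of_nat_mult of_nat_add)
  qed
  have e1: "real l / real M \<le> real J / K" "real J / K \<le> real l / real M + 1 / real M"
    using l assms(1,2) unfolding K_def by (simp_all add: field_simps)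
  have e2: "real J * real L / real d \<le> real J / K"
    using mult_left_mono[OF KL(1), of "real J"] K d by (simp add: field_simps)
  have e3: "real J / K \<le> real J * real L / real d + K / real d"
  proof -
    have "real J * real d \<le> real J * (K * real L + K)" using KL(2) by (intro mult_left_mono) auto
    also have "\<dots> \<le> real J * K * real L + K * K" using J K by (simp add: distrib_left mult_right_mono mult.assoc)
    finally show ?thesis using K d by (simp add: field_simps)
  qed
  have KM: "K / real d = real (M * n) / real d" by (simp add: K_def)
  have "\<bar>real J * real L / real d - real l / real M\<bar> \<le> K / real d + 1 / real M"
    using e1 e2 e3 divide_nonneg_nonneg[of K "real d"] K d assms(1) by (simp add: abs_le_iff)
  hence "2 * pi * \<bar>real J * real L / real d - real l / real M\<bar> \<le> 2 * pi * (K / real d + 1 / real M)"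
    by (intro mult_left_mono) auto
  moreover have "2 * pi * real (J * L) / real d - 2 * pi * real l / real M =
      2 * pi * (real J * real L / real d - real l / real M)" by (simp add: right_diff_distrib mult.assoc)
  ultimately show ?thesis unfolding KM l_def[symmetric] by (simp add: abs_mult)
qed

text \<open>The first summand is the discretization error. The others are entrywise, hence the
  factor \<open>n\<close>: Fejer error 4 and perturbation error 8 over \<open>sqrt d\<close>, the
  off-diagonal terms, and the displacement of the sample points.\<close>

definition approx_error :: "nat \<Rightarrow> nat \<Rightarrow> nat \<Rightarrow> real" where
  "approx_error n M d = 4 / sqrt (real M) +
     real n * (12 / sqrt (real d) + 16 * real (M * n) ^ 3 / sqrt (real d)
        + 2 * pi * (real (M * n) / real d + 1 / real M))"

lemma pure_approx:
  assumes n: "2 \<le> n" and \<Psi>: "\<Psi> \<in> UCP circle_sys n" and M: "0 < M"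
    and d: "2 * (M * n) + 2 \<le> d" "32 \<le> d" and N: "N = d ^ 4"
  obtains \<phi> where "\<phi> \<in> PureUCP (toeplitz_sys d) n"
    "\<And>f. f \<in> lip1 \<Longrightarrow> form_bound n (\<lambda>a b. \<Psi> f $$ (a, b) - \<phi> (compr d N f) $$ (a, b)) (approx_error n M d)"
proof -
  obtain v where vsum: "\<And>a b. a < n \<Longrightarrow> b < n \<Longrightarrow>
        (\<Sum>l<M. \<Sum>r<n. v l r a * cnj (v l r b)) = (if a = b then 1 else 0)"
    and vapp: "\<And>f. f \<in> lip1 \<Longrightarrow> form_bound n (\<lambda>a b. \<Psi> f $$ (a, b) -
        (\<Sum>l<M. f (rou M l) * (\<Sum>r<n. v l r a * cnj (v l r b)))) (4 / sqrt (real M))"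
    using UCP_circle_discretize[OF \<Psi> M] by blast
  define K where "K = M * n"
  define L where "L = d div K"
  have K: "2 \<le> K" using n M unfolding K_def by (metis One_nat_def Suc_leI le_trans mult.commute mult_le_mono nat_mult_1_right)
  have L: "2 \<le> L"
  proof -
    have "2 * K div K \<le> d div K" by (rule div_le_mono) (use d in \<open>simp add: K_def\<close>)
    thus ?thesis using K by (simp add: L_def)
  qed
  have "d = K * L + d mod K" "d mod K < K" using K by (simp_all add: L_def)
  hence KL: "K * L \<le> d" "d < K * L + K" by linarith+
  have d0: "0 < d" using d by simp
  define w where "w = (\<lambda>J. v (J div n) (J mod n))"
  \<comment> \<open>Each vector \<open>w J\<close> receives its own root of unity, at the multiple
    \<open>J * L\<close>; the conjugate makes the compression produce
    \<open>w J a * cnj (w J b)\<close>.\<close>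
  define c where "c = (\<lambda>a j. if j < K * L \<and> L dvd j then cnj (w (j div L) a) else 0)"
  have cJ: "c a (J * L) = cnj (w J a)" if "J < K" for a J
    using that L by (simp add: c_def)
  have wsum: "(\<Sum>J<K. w J a * cnj (w J b)) = (if a = b then 1 else 0)" if "a < n" "b < n" for a b
    using sum_div_mod[of "\<lambda>l r. v l r a * cnj (v l r b)" n M] vsum[OF that] by (simp add: w_def K_def)
  have csum: "(\<Sum>j<d. cnj (c a j) * g j) = (\<Sum>J<K. w J a * g (J * L))" for a g
    by (subst sum_multiples[OF KL(1)]) (use L cJ in \<open>auto simp: c_def\<close>)
  have csum': "(\<Sum>j<d. c a j * g j) = (\<Sum>J<K. cnj (w J a) * g (J * L))" for a g
    by (subst sum_multiples[OF KL(1)]) (use L cJ in \<open>auto simp: c_def\<close>)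
  have on: "orthonormal_rows d n c"
    unfolding orthonormal_rows_def ip_def using wsum cJ by (auto simp: csum)
  have LK: "L + 1 < K * L"
  proof -
    have "L + 1 < 2 * L" using L by simp
    also have "\<dots> \<le> K * L" using K by (intro mult_le_mono1)
    finally show ?thesis .
  qed
  \<comment> \<open>As \<open>L \<ge> 2\<close>, the positions 1 and \<open>L + 1\<close> are
    unoccupied; they serve as \<open>m\<close> and \<open>m'\<close> in the perturbation.\<close>
  have c1: "c a 1 = 0" for a using L by (simp add: c_def)
  have cL1: "c a (L + 1) = 0" for a
  proof -
    have "\<not> L dvd L + 1" using L by (metis dvd_add_right_iff dvd_refl nat_dvd_1_iff_1 numeral_le_one_iff semiring_norm(69))
    thus ?thesis by (simp add: c_def)
  qed
  \<comment> \<open>There are \<open>d\<^sup>2\<close> terms, each changed by at most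
    \<open>2 * \<epsilon> * (4 * sqrt d)\<close>; the cube brings the total to
    \<open>8 / sqrt d\<close>.\<close>
  define \<epsilon> where "\<epsilon> = 1 / real d ^ 3"
  have \<epsilon>: "0 < \<epsilon>" using d0 by (simp add: \<epsilon>_def)
  obtain c' where c': "orthonormal_rows d n c'"
    "\<And>a j. a < n \<Longrightarrow> j < d \<Longrightarrow> cmod (c' a j - c a j) \<le> \<epsilon>"
    "vmap d n (\<lambda>p a. synth d (c' a) p) \<in> PureUCP (toeplitz_sys d) n"
    by (rule perturb_isometry[OF on n \<epsilon>, of 1 "L + 1"]) (use LK KL L c1 cL1 in auto)
  define \<phi> where "\<phi> = vmap d n (\<lambda>p a. synth d (c' a) p)"
  have main: "cmod ((\<Sum>l<M. f (rou M l) * (\<Sum>r<n. v l r a * cnj (v l r b))) - \<phi> (compr d N f) $$ (a, b))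
     \<le> 12 / sqrt (real d) + 16 * real (M * n) ^ 3 / sqrt (real d) + 2 * pi * (real (M * n) / real d + 1 / real M)"
    if f: "f \<in> lip1" and ab: "a < n" "b < n" for f a b
  proof -
    define T' where "T' = toep d (\<lambda>k. if k = 0 then 0 else rcoef N f k)"
    define \<tau> where "\<tau> = (\<lambda>i j. sform d (entries T') (evec (rou d i)) (evec (rou d j)) / of_nat d)"
    define r0 where "r0 = rcoef N f 0"
    note est = compr_estimates[OF f d(2) N, folded T'_def]
    have \<tau>1: "cmod (\<tau> i j) \<le> 4 * sqrt (real d)" for i j using est(1) by (simp add: \<tau>_def)
    have \<tau>2: "cmod (rou d i - rou d j) * cmod (\<tau> i j) \<le> 8 / sqrt (real d)" for i j
      using est(2) by (simp add: \<tau>_def)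
    have \<tau>3: "cmod (r0 + \<tau> i i - f (rou d i)) \<le> 4 / sqrt (real d)" for i
    proof -
      have "ip d (evec (rou d i)) (evec (rou d i)) = of_nat d" by (simp add: ip_self nsq_evec)
      hence "sform d (entries (compr d N f)) (evec (rou d i)) (evec (rou d i)) / of_nat d = r0 + \<tau> i i"
        unfolding compr_def toep_split_diagonal[of d "rcoef N f"] using d0
        by (simp add: \<tau>_def T'_def r0_def add_divide_distrib)
      thus ?thesis using est(3)[of i] by simp
    qed
    define B where "B = (\<lambda>c::nat \<Rightarrow> nat \<Rightarrow> complex. \<Sum>i<d. \<Sum>j<d. cnj (c a i) * c b j * \<tau> i j)"
    have ipc: "ip d (c' a) (c' b) = (if a = b then 1 else 0)" using c'(1) ab by (simp add: orthonormal_rows_def)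
    have \<phi>ab: "\<phi> (compr d N f) $$ (a, b) = r0 * (if a = b then 1 else 0) + B c'"
    proof -
      have "\<phi> (compr d N f) $$ (a, b) = sform d (entries (compr d N f)) (synth d (c' a)) (synth d (c' b))"
        unfolding \<phi>_def using ab by (simp add: vmap_index)
      also have "\<dots> = r0 * ip d (synth d (c' a)) (synth d (c' b)) + sform d (entries T') (synth d (c' a)) (synth d (c' b))"
        unfolding compr_def T'_def r0_def by (rule toep_split_diagonal)
      finally show ?thesis
        unfolding ip_synth[OF d0] ipc sform_synth[OF d0] B_def \<tau>_def .
    qed
    have t1: "cmod (B c' - B c) \<le> 8 / sqrt (real d)"
    proof -
      have "B c' - B c = (\<Sum>i<d. \<Sum>j<d. (cnj (c' a i) * c' b j - cnj (c a i) * c b j) * \<tau> i j)"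
        by (simp add: B_def sum_subtractf left_diff_distrib)
      also have "cmod \<dots> \<le> (\<Sum>i<d. \<Sum>j<d. (2 * \<epsilon>) * (4 * sqrt (real d)))"
      proof (intro order_trans[OF norm_sum] sum_mono)
        fix i j assume ij: "i \<in> {..<d}" "j \<in> {..<d}"
        have "cnj (c' a i) * c' b j - cnj (c a i) * c b j = cnj (c' a i) * (c' b j - c b j) + cnj (c' a i - c a i) * c b j"
          by (simp add: algebra_simps)
        also have "cmod \<dots> \<le> cmod (c' a i) * cmod (c' b j - c b j) + cmod (c' a i - c a i) * cmod (c b j)"
          by (rule order_trans[OF norm_triangle_ineq]) (simp only: norm_mult complex_mod_cnj order_refl)
        also have "\<dots> \<le> 1 * \<epsilon> + \<epsilon> * 1"
          using ij ab \<epsilon> c'(2) entry_le_1[OF c'(1)] entry_le_1[OF on] by (intro add_mono mult_mono) auto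
        finally have "cmod (cnj (c' a i) * c' b j - cnj (c a i) * c b j) \<le> 2 * \<epsilon>" by simp
        thus "cmod ((cnj (c' a i) * c' b j - cnj (c a i) * c b j) * \<tau> i j) \<le> (2 * \<epsilon>) * (4 * sqrt (real d))"
          unfolding norm_mult using \<tau>1 \<epsilon> by (intro mult_mono) auto
      qed
      also have "\<dots> = 8 / sqrt (real d)"
      proof -
        have "sqrt (real d) * sqrt (real d) = real d" by simp
        thus ?thesis using d0 by (simp add: \<epsilon>_def field_simps power3_eq_cube)
      qed
      finally show ?thesis .
    qed
    have Bc: "B c = (\<Sum>I<K. \<Sum>J<K. w I a * cnj (w J b) * \<tau> (I * L) (J * L))"
    proof -
      have "B c = (\<Sum>i<d. cnj (c a i) * (\<Sum>j<d. c b j * \<tau> i j))"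
        by (simp add: B_def sum_distrib_left mult.assoc)
      also have "\<dots> = (\<Sum>I<K. w I a * (\<Sum>J<K. cnj (w J b) * \<tau> (I * L) (J * L)))"
        unfolding csum csum' ..
      finally show ?thesis by (simp add: sum_distrib_left mult.assoc)
    qed
    have w1: "(\<Sum>J<K. (cmod (w J a))\<^sup>2) = 1" if "a < n" for a
    proof -
      have "complex_of_real (\<Sum>J<K. (cmod (w J a))\<^sup>2) = 1"
        using wsum[OF that that] by (simp add: complex_norm_square del: of_real_power)
      thus ?thesis by (simp only: of_real_eq_1_iff)
    qed
    have wle: "cmod (w J a) \<le> 1" if "a < n" "J < K" for a J
    proof -
      have "(cmod (w J a))\<^sup>2 \<le> (\<Sum>J<K. (cmod (w J a))\<^sup>2)"
        using that(2) by (intro member_le_sum) auto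
      thus ?thesis using w1[OF that(1)] by (simp add: abs_square_le_1)
    qed
    define D where "D = (\<Sum>I<K. w I a * cnj (w I b) * \<tau> (I * L) (I * L))"
    have t2: "cmod (B c - D) \<le> 16 * real K ^ 3 / sqrt (real d)"
    proof -
      have "D = (\<Sum>I<K. \<Sum>J<K. if J = I then w I a * cnj (w J b) * \<tau> (I * L) (J * L) else 0)"
        unfolding D_def by (intro sum.cong refl) simp
      hence "B c - D = (\<Sum>I<K. \<Sum>J<K. if J = I then 0 else w I a * cnj (w J b) * \<tau> (I * L) (J * L))"
        unfolding Bc by (simp only: sum_subtractf[symmetric]) (intro sum.cong refl, simp)
      also have "cmod \<dots> \<le> (\<Sum>I<K. \<Sum>J<K. 16 * real K / sqrt (real d))"
      proof (intro order_trans[OF norm_sum] sum_mono)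
        fix I J assume IJ: "I \<in> {..<K}" "J \<in> {..<K}"
        show "cmod (if J = I then 0 else w I a * cnj (w J b) * \<tau> (I * L) (J * L)) \<le> 16 * real K / sqrt (real d)"
        proof (cases "J = I")
          case False
          have lt: "X * L + L \<le> d" if "X < K" for X
          proof -
            have "X * L + L = Suc X * L" by simp
            also have "\<dots> \<le> K * L" using that by (intro mult_le_mono1) simp
            finally show ?thesis using KL by simp
          qed
          have IJd: "I * L + L \<le> d" "J * L + L \<le> d" using lt IJ by auto
          have "real L / real d \<le> cmod (rou d (I * L) - rou d (J * L))"
          proof (rule rou_separation)
            have "L \<le> (I - J) * L \<or> L \<le> (J - I) * L" using False by (cases "I < J") auto
            thus "L \<le> I * L - J * L \<or> L \<le> J * L - I * L" by (simp add: diff_mult_distrib)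
          qed (use False L IJd in auto)
          \<comment> \<open>Rounding down loses at most a factor 2, so the separation does not
            depend on \<open>d\<close> and the off-diagonal terms decay for fixed
            \<open>M\<close>.\<close>
          moreover have "1 / (2 * real K) \<le> real L / real d"
          proof -
            have "K \<le> K * L" using L by simp
            hence "d \<le> 2 * K * L" using KL(2) by linarith
            hence "real d \<le> real (2 * K * L)" by (simp only: of_nat_le_iff)
            hence "real d \<le> 2 * real K * real L" by simp
            thus ?thesis using d0 K by (simp add: field_simps)
          qed
          ultimately have sep: "1 / (2 * real K) \<le> cmod (rou d (I * L) - rou d (J * L))" by simp
          have "1 / (2 * real K) * cmod (\<tau> (I * L) (J * L)) \<le> 8 / sqrt (real d)"
            using mult_right_mono[OF sep norm_ge_zero] \<tau>2 order_trans by blast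
          hence "cmod (\<tau> (I * L) (J * L)) \<le> 16 * real K / sqrt (real d)"
            using K by (simp add: field_simps)
          moreover have "cmod (w I a) * cmod (w J b) \<le> 1 * 1"
            using wle ab IJ by (intro mult_mono) auto
          ultimately have "cmod (w I a) * cmod (w J b) * cmod (\<tau> (I * L) (J * L)) \<le> 1 * 1 * (16 * real K / sqrt (real d))"
            using mult_mono[of "cmod (w I a) * cmod (w J b)" "1 * 1" "cmod (\<tau> (I * L) (J * L))"] by simp
          thus ?thesis using False by (simp add: norm_mult)
        qed simp
      qed
      also have "\<dots> = 16 * real K ^ 3 / sqrt (real d)" by (simp add: power3_eq_cube)
      finally show ?thesis .
    qed
    define E where "E = (\<Sum>I<K. w I a * cnj (w I b) * f (rou M (I div n)))"
    have E: "(\<Sum>l<M. f (rou M l) * (\<Sum>r<n. v l r a * cnj (v l r b))) = E"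
      using sum_div_mod[of "\<lambda>l r. v l r a * cnj (v l r b) * f (rou M l)" n M]
      by (simp add: E_def w_def K_def sum_distrib_left mult_ac)
    have t3: "cmod (r0 * (if a = b then 1 else 0) + D - E) \<le> 4 / sqrt (real d) + 2 * pi * (real K / real d + 1 / real M)"
    proof -
      \<comment> \<open>The weights \<open>w I a * cnj (w I b)\<close> sum to the identity matrix,
        so \<open>r0\<close> can be distributed over the terms, where \<open>r0 + \<tau> i i\<close>
        is a Fejer mean of \<open>f\<close>.\<close>
      have "r0 * (if a = b then 1 else 0) + D - E =
         (\<Sum>I<K. w I a * cnj (w I b) * (r0 + \<tau> (I * L) (I * L) - f (rou M (I div n))))"
        unfolding wsum[OF ab, symmetric] D_def E_def
        by (simp add: sum_distrib_left sum.distrib sum_subtractf algebra_simps)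
      also have "cmod \<dots> \<le> 4 / sqrt (real d) + 2 * pi * (real K / real d + 1 / real M)"
      proof (rule bounded_combination)
        fix I assume "I \<in> {..<K}"
        hence I: "I < M * n" by (simp add: K_def)
        have "cmod (f (rou d (I * L)) - f (rou M (I div n))) \<le> \<bar>2 * pi * real (I * L) / real d - 2 * pi * real (I div n) / real M\<bar>"
          unfolding rou_def by (rule lip1_arc[OF f])
        also have "\<dots> \<le> 2 * pi * (real K / real d + 1 / real M)"
          using arc_estimate[OF M _ I _ _ d0, of L] KL n unfolding K_def by simp
        finally have "cmod (f (rou d (I * L)) - f (rou M (I div n))) \<le> 2 * pi * (real K / real d + 1 / real M)" .
        moreover have "r0 + \<tau> (I * L) (I * L) - f (rou M (I div n)) =
          (r0 + \<tau> (I * L) (I * L) - f (rou d (I * L))) + (f (rou d (I * L)) - f (rou M (I div n)))" by simp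
        ultimately show "cmod (r0 + \<tau> (I * L) (I * L) - f (rou M (I div n))) \<le> 4 / sqrt (real d) + 2 * pi * (real K / real d + 1 / real M)"
          using \<tau>3[of "I * L"] norm_triangle_le add_mono by metis
      qed (use w1 ab in auto)
      finally show ?thesis .
    qed
    have "E - \<phi> (compr d N f) $$ (a, b) = - ((r0 * (if a = b then 1 else 0) + D - E) + (B c - D) + (B c' - B c))"
      unfolding \<phi>ab by simp
    moreover have "cmod (- (x + y + z)) \<le> cmod x + cmod y + cmod z" for x y z
      unfolding norm_minus_cancel using norm_triangle_ineq[of "x + y" z] norm_triangle_ineq[of x y] by simp
    ultimately have "cmod (E - \<phi> (compr d N f) $$ (a, b)) \<le>
       cmod (r0 * (if a = b then 1 else 0) + D - E) + cmod (B c - D) + cmod (B c' - B c)"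
      by (simp only:)
    also have "\<dots> \<le> (4 / sqrt (real d) + 2 * pi * (real K / real d + 1 / real M)) + 16 * real K ^ 3 / sqrt (real d) + 8 / sqrt (real d)"
      by (intro add_mono t1 t2 t3)
    also have "\<dots> = 12 / sqrt (real d) + 16 * real (M * n) ^ 3 / sqrt (real d) + 2 * pi * (real (M * n) / real d + 1 / real M)"
      unfolding K_def by simp
    finally show ?thesis unfolding E .
  qed
  show ?thesis
  proof (rule that)
    show "\<phi> \<in> PureUCP (toeplitz_sys d) n" using c'(3) by (simp add: \<phi>_def)
    fix f assume f: "f \<in> lip1"
    have "form_bound n (\<lambda>a b. (\<Psi> f $$ (a, b) - (\<Sum>l<M. f (rou M l) * (\<Sum>r<n. v l r a * cnj (v l r b)))) +
       ((\<Sum>l<M. f (rou M l) * (\<Sum>r<n. v l r a * cnj (v l r b))) - \<phi> (compr d N f) $$ (a, b)))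
       (approx_error n M d)"
      unfolding approx_error_def
      by (rule form_bound_add[OF vapp[OF f] form_bound_entries]) (rule main[OF f])
    thus "form_bound n (\<lambda>a b. \<Psi> f $$ (a, b) - \<phi> (compr d N f) $$ (a, b)) (approx_error n M d)"
      by simp
  qed
qed

section \<open>Convergence\<close>

lemma form_bound_uminus: "form_bound m F c \<Longrightarrow> form_bound m (\<lambda>a b. - F a b) c"
  using form_bound_scale[of m F c "- 1"] by simp

lemma form_bound_diff:
  "form_bound m F c \<Longrightarrow> form_bound m G c' \<Longrightarrow> form_bound m (\<lambda>a b. F a b - G a b) (c + c')"
  using form_bound_add[OF _ form_bound_uminus, of m F c G c'] by simp

lemma op_norm_diff_le_iff:
  assumes "A \<in> carrier_mat n n" "B \<in> carrier_mat n n" "0 < n"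
  shows "op_norm (A - B) \<le> c \<longleftrightarrow> form_bound n (\<lambda>a b. A $$ (a, b) - B $$ (a, b)) c"
proof -
  have "op_norm (A - B) \<le> c \<longleftrightarrow> form_bound n (entries (A - B)) c"
    using assms by (intro op_norm_le_iff) (auto intro: minus_carrier_mat)
  also have "\<dots> \<longleftrightarrow> form_bound n (\<lambda>a b. A $$ (a, b) - B $$ (a, b)) c"
    using assms form_bound_cong[of n "entries (A - B)" "\<lambda>a b. A $$ (a, b) - B $$ (a, b)" c]
      form_bound_cong[of n "\<lambda>a b. A $$ (a, b) - B $$ (a, b)" "entries (A - B)" c] by auto
  finally show ?thesis .
qed

lemma op_norm_diff_facts:
  assumes "A \<in> carrier_mat n n" "B \<in> carrier_mat n n" "C \<in> carrier_mat n n" "0 < n"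
  shows "op_norm (A - A) = 0" "0 \<le> op_norm (A - B)" "op_norm (A - B) = op_norm (B - A)"
    "op_norm (A - C) \<le> op_norm (A - B) + op_norm (B - C)"
proof -
  have fb: "form_bound n (\<lambda>a b. X $$ (a, b) - Y $$ (a, b)) (op_norm (X - Y))"
    if "X \<in> carrier_mat n n" "Y \<in> carrier_mat n n" for X Y
    using op_norm_diff_le_iff[OF that assms(4), of "op_norm (X - Y)"] by simp
  have nn: "0 \<le> op_norm (X - Y)" if "X \<in> carrier_mat n n" "Y \<in> carrier_mat n n" for X Y
    using op_norm_nonneg[OF minus_carrier_mat[OF that(2)] assms(4)] .
  have le: "op_norm (X - Y) \<le> op_norm (Y - X)" if "X \<in> carrier_mat n n" "Y \<in> carrier_mat n n" for X Y
    unfolding op_norm_diff_le_iff[OF that assms(4)] using form_bound_uminus[OF fb[OF that(2,1)]] by simp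
  show "0 \<le> op_norm (A - B)" by (rule nn[OF assms(1,2)])
  show "op_norm (A - B) = op_norm (B - A)" using le[OF assms(1,2)] le[OF assms(2,1)] by simp
  have "op_norm (A - A) \<le> 0"
    unfolding op_norm_diff_le_iff[OF assms(1,1,4)] using form_bound_entries[of n "\<lambda>_ _. 0" 0] by simp
  thus "op_norm (A - A) = 0" using nn[OF assms(1,1)] by simp
  show "op_norm (A - C) \<le> op_norm (A - B) + op_norm (B - C)"
    unfolding op_norm_diff_le_iff[OF assms(1,3,4)]
    using form_bound_add[OF fb[OF assms(1,2)] fb[OF assms(2,3)]] by simp
qed

lemma pseudo_metric_SUP:
  fixes X :: "('f \<Rightarrow> complex mat) set"
  assumes F: "F \<noteq> {}" and n: "0 < n"
    and car: "\<And>x f. x \<in> X \<Longrightarrow> f \<in> F \<Longrightarrow> x f \<in> carrier_mat n n"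
    and bdd: "\<And>x y f. x \<in> X \<Longrightarrow> y \<in> X \<Longrightarrow> f \<in> F \<Longrightarrow> op_norm (x f - y f) \<le> B"
  shows "pseudo_metric_on X (\<lambda>x y. SUP f\<in>F. op_norm (x f - y f))"
proof -
  have up: "op_norm (x f - y f) \<le> (SUP f\<in>F. op_norm (x f - y f))" if "x \<in> X" "y \<in> X" "f \<in> F" for x y f
    using that bdd by (intro cSUP_upper bdd_aboveI2[of _ _ B]) auto
  obtain f0 where f0: "f0 \<in> F" using F by auto
  show ?thesis
    unfolding pseudo_metric_on_def
  proof (intro conjI ballI)
    show "(SUP f\<in>F. op_norm (x f - x f)) = 0" if x: "x \<in> X" for x
    proof -
      have "op_norm (x f - x f) = 0" if "f \<in> F" for f
        using op_norm_diff_facts(1)[OF car[OF x that] car[OF x that] car[OF x that] n] .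
      thus ?thesis using F by simp
    qed
    fix x y assume xy: "x \<in> X" "y \<in> X"
    have "0 \<le> op_norm (x f0 - y f0)"
      by (rule op_norm_diff_facts(2)[OF car[OF xy(1) f0] car[OF xy(2) f0] car[OF xy(2) f0] n])
    thus "0 \<le> (SUP f\<in>F. op_norm (x f - y f))" using up[OF xy f0] by simp
    show "(SUP f\<in>F. op_norm (x f - y f)) = (SUP f\<in>F. op_norm (y f - x f))"
    proof (rule SUP_cong[OF refl])
      fix f assume f: "f \<in> F"
      show "op_norm (x f - y f) = op_norm (y f - x f)"
        by (rule op_norm_diff_facts(3)[OF car[OF xy(1) f] car[OF xy(2) f] car[OF xy(2) f] n])
    qed
    fix z assume z: "z \<in> X"
    show "(SUP f\<in>F. op_norm (x f - z f)) \<le> (SUP f\<in>F. op_norm (x f - y f)) + (SUP f\<in>F. op_norm (y f - z f))"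
      using F
    proof (rule cSUP_least)
      fix f assume f: "f \<in> F"
      have "op_norm (x f - z f) \<le> op_norm (x f - y f) + op_norm (y f - z f)"
        by (rule op_norm_diff_facts(4)[OF car[OF xy(1) f] car[OF xy(2) f] car[OF z f] n])
      thus "op_norm (x f - z f) \<le> (SUP f\<in>F. op_norm (x f - y f)) + (SUP f\<in>F. op_norm (y f - z f))"
        using up[OF xy f] up[OF xy(2) z f] by linarith
    qed
  qed
qed

text \<open>Unital maps agree on constants, so \<open>f\<close> can be replaced by
  \<open>f - f 1\<close>, which is at most 4 on the circle; two contractions give 8. This bounds the
  set whose supremum defines \<open>rho_circle\<close>.\<close>

lemma UCP_circle_diff_form_bound:
  assumes \<Phi>: "\<Phi> \<in> UCP circle_sys n" "\<Phi>' \<in> UCP circle_sys n" and f: "f \<in> lip1"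
  shows "form_bound n (\<lambda>a b. \<Phi> f $$ (a, b) - \<Phi>' f $$ (a, b)) 8"
proof -
  define one where "one = (\<lambda>z::complex. if z \<in> sphere 0 1 then 1 else (0::complex))"
  define g where "g = (\<lambda>z. f z - f 1 * one z)"
  have one: "one \<in> C_circle" unfolding one_def by (rule circle_const_in)
  have g: "g \<in> C_circle" unfolding g_def by (intro C_circle_closed lip1_in f one)
  have "cmod (g z) \<le> 4" if z: "cmod z = 1" for z
  proof -
    have "cmod (g z) \<le> 2 * cmod (1 - z)" using lip1_chord[OF f z, of 1] z by (simp add: g_def one_def)
    also have "cmod (1 - z) \<le> 2" using norm_triangle_ineq4[of 1 z] z by simp
    finally show ?thesis by simp
  qed
  hence fb: "form_bound n (entries (\<Psi> g)) 4" if "\<Psi> \<in> UCP circle_sys n" for \<Psi>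
    using circle_UCP_form_bound[OF that g] by blast
  have ent: "\<Psi> g $$ (a, b) = \<Psi> f $$ (a, b) - f 1 * (if a = b then 1 else 0)"
    if "\<Psi> \<in> UCP circle_sys n" "a < n" "b < n" for \<Psi> a b
  proof -
    note lin = UCP_D(2)[OF that(1)]
    have "\<Psi> g = \<Psi> f - f 1 \<cdot>\<^sub>m 1\<^sub>m n"
      unfolding g_def os_linear_diff[OF lin lip1_in[OF f] C_circle_closed(3)[OF one]]
        circle_linearD(2)[OF lin one] using UCP_D(3)[OF that(1)] by (simp add: one_def)
    thus ?thesis using that by simp
  qed
  have "form_bound n (\<lambda>a b. \<Phi> g $$ (a, b) - \<Phi>' g $$ (a, b)) (4 + 4)"
    by (intro form_bound_diff fb \<Phi>)
  hence "form_bound n (\<lambda>a b. \<Phi> g $$ (a, b) - \<Phi>' g $$ (a, b)) 8" by simp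
  thus ?thesis by (rule form_bound_cong[rotated]) (simp add: ent[OF \<Phi>(1)] ent[OF \<Phi>(2)])
qed

definition connes_ball :: "nat \<Rightarrow> complex mat set" where
  "connes_ball d = {T \<in> toeplitz_mats d. op_norm (D_mat d * T - T * D_mat d) \<le> 1}"

lemma connes_ball_iff:
  assumes "0 < d"
  shows "toep d a \<in> connes_ball d \<longleftrightarrow> form_bound d (\<lambda>p q. of_int (int p - int q) * a (int p - int q)) 1"
proof -
  have "toep d a \<in> connes_ball d \<longleftrightarrow> form_bound d (entries (toep d (\<lambda>k. of_int k * a k))) 1"
    unfolding connes_ball_def mem_Collect_eq toep_commutator using assms by (simp add: op_norm_le_iff)
  also have "\<dots> \<longleftrightarrow> form_bound d (\<lambda>p q. of_int (int p - int q) * a (int p - int q)) 1"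
    using form_bound_cong[of d "entries (toep d (\<lambda>k. of_int k * a k))" "\<lambda>p q. of_int (int p - int q) * a (int p - int q)" 1]
      form_bound_cong[of d "\<lambda>p q. of_int (int p - int q) * a (int p - int q)" "entries (toep d (\<lambda>k. of_int k * a k))" 1]
    by (auto simp: toep_index)
  finally show ?thesis .
qed

lemma toeplitz_linearD:
  assumes "os_linear (toeplitz_sys d) n \<phi>"
  shows "\<phi> (toep d a + toep d b) = \<phi> (toep d a) + \<phi> (toep d b)"
    "\<phi> (k \<cdot>\<^sub>m toep d a) = k \<cdot>\<^sub>m \<phi> (toep d a)" "\<phi> (toep d a) \<in> carrier_mat n n"
  using assms by (auto simp: os_linear_def)

text \<open>Unitality removes the diagonal coefficient, and \<open>commutator_l1\<close> bounds the
  rest. The growth with \<open>d\<close> is harmless: apart from making the supremum meaningful, the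
  bound is only multiplied by a relative error \<open>32 / d\<close>.\<close>

lemma UCP_toeplitz_diff_form_bound:
  assumes \<phi>: "\<phi> \<in> UCP (toeplitz_sys d) n" "\<phi>' \<in> UCP (toeplitz_sys d) n"
    and T: "T \<in> connes_ball d" and d: "0 < d"
  shows "form_bound n (\<lambda>a b. \<phi> T $$ (a, b) - \<phi>' T $$ (a, b)) (4 * sqrt (real d))"
proof -
  obtain f where f: "T = toep d f" using T toeplitz_matsE unfolding connes_ball_def by blast
  define g where "g = (\<lambda>k::int. if k = 0 then 0 else f k)"
  have "(\<Sum>k\<in>diags d. cmod (g k)) \<le> (\<Sum>k\<in>diags d. cmod (of_int k * f k))"
  proof (rule sum_mono)
    fix k
    have "k \<noteq> 0 \<Longrightarrow> 1 \<le> cmod (of_int k :: complex)" by (simp add: norm_of_int)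
    thus "cmod (g k) \<le> cmod (of_int k * f k)" by (auto simp: g_def norm_mult mult_le_cancel_right1)
  qed
  also have "\<dots> \<le> 2 * 1 * sqrt (real d)"
    using T connes_ball_iff[OF d] unfolding f by (intro commutator_l1) auto
  finally have "form_bound d (entries (toep d g)) (2 * sqrt (real d))"
    using form_bound_mono[OF form_bound_toep] by simp
  hence fb: "form_bound n (entries (\<psi> (toep d g))) (2 * sqrt (real d))" if "\<psi> \<in> UCP (toeplitz_sys d) n" for \<psi>
    by (rule toeplitz_UCP_form_bound[OF that])
  have Tg: "T = toep d g + f 0 \<cdot>\<^sub>m toep d (\<lambda>k. if k = 0 then 1 else 0)"
    unfolding f toep_smult toep_add by (rule toep_cong) (simp add: g_def)
  have ent: "\<psi> T $$ (a, b) = \<psi> (toep d g) $$ (a, b) + f 0 * (if a = b then 1 else 0)"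
    if "\<psi> \<in> UCP (toeplitz_sys d) n" "a < n" "b < n" for \<psi> a b
  proof -
    note lin = UCP_D(2)[OF that(1)]
    have "\<psi> T = \<psi> (toep d g) + f 0 \<cdot>\<^sub>m 1\<^sub>m n"
      using UCP_D(3)[OF that(1)] toeplitz_linearD(1)[OF lin, of g "\<lambda>k. f 0 * (if k = 0 then 1 else 0)"]
        toeplitz_linearD(2)[OF lin, of "f 0" "\<lambda>k. if k = 0 then 1 else 0"]
      unfolding Tg by (simp add: toep_smult toep_one)
    thus ?thesis using that by simp
  qed
  have "form_bound n (\<lambda>a b. \<phi> (toep d g) $$ (a, b) - \<phi>' (toep d g) $$ (a, b)) (2 * sqrt (real d) + 2 * sqrt (real d))"
    by (intro form_bound_diff fb \<phi>)
  hence "form_bound n (\<lambda>a b. \<phi> (toep d g) $$ (a, b) - \<phi>' (toep d g) $$ (a, b)) (4 * sqrt (real d))" by simp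
  thus ?thesis by (rule form_bound_cong[rotated]) (simp add: ent[OF \<phi>(1)] ent[OF \<phi>(2)])
qed

lemma zero_lip1: "(\<lambda>z. 0) \<in> lip1"
  by (auto simp: lip1_def C1_circle_def C_circle_def circle_deriv_def)

lemma zero_connes_ball: "0 < d \<Longrightarrow> toep d (\<lambda>k. 0) \<in> connes_ball d"
  unfolding connes_ball_iff using form_bound_entries[of d "\<lambda>_ _. 0" 0] form_bound_mono[of d _ 0 1] by simp

lemma rho_circle_eq: "rho_circle = (\<lambda>\<phi> \<psi>. SUP f\<in>lip1. op_norm (\<phi> f - \<psi> f))"
  by (intro ext) (simp add: rho_circle_def lip1_def)

lemma rho_toeplitz_eq: "rho_toeplitz d = (\<lambda>\<phi> \<psi>. SUP T\<in>connes_ball d. op_norm (\<phi> T - \<psi> T))"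
  by (intro ext) (simp add: rho_toeplitz_def connes_ball_def)

lemma UCP_circle_diff_le:
  assumes "\<Phi> \<in> UCP circle_sys n" "\<Phi>' \<in> UCP circle_sys n" "f \<in> lip1" "0 < n"
  shows "op_norm (\<Phi> f - \<Phi>' f) \<le> 8"
proof -
  have "\<Phi> f \<in> carrier_mat n n" "\<Phi>' f \<in> carrier_mat n n"
    using UCP_D(4)[OF assms(1)] UCP_D(4)[OF assms(2)] lip1_in[OF assms(3)] by auto
  thus ?thesis
    using op_norm_diff_le_iff[OF _ _ assms(4)] UCP_circle_diff_form_bound[OF assms(1-3)] by blast
qed

lemma UCP_toeplitz_diff_le:
  assumes "\<phi> \<in> UCP (toeplitz_sys d) n" "\<phi>' \<in> UCP (toeplitz_sys d) n" "T \<in> connes_ball d" "0 < n" "0 < d"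
  shows "op_norm (\<phi> T - \<phi>' T) \<le> 4 * sqrt (real d)"
proof -
  have "\<phi> T \<in> carrier_mat n n" "\<phi>' T \<in> carrier_mat n n"
    using UCP_D(4)[OF assms(1)] UCP_D(4)[OF assms(2)] assms(3) by (auto simp: connes_ball_def)
  thus ?thesis
    using op_norm_diff_le_iff[OF _ _ assms(4)] UCP_toeplitz_diff_form_bound[OF assms(1-3,5)] by blast
qed

lemma pseudo_metric_rho_circle:
  assumes "0 < n" shows "pseudo_metric_on (UCP circle_sys n) rho_circle"
proof -
  have "lip1 \<noteq> {}" using zero_lip1 by auto
  moreover have "x f \<in> carrier_mat n n" if "x \<in> UCP circle_sys n" "f \<in> lip1" for x f
    using UCP_D(4)[OF that(1), of f] lip1_in[OF that(2)] by simp
  ultimately show ?thesis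
    unfolding rho_circle_eq using assms UCP_circle_diff_le
    by (intro pseudo_metric_SUP[where n = n and B = 8]) blast+
qed

lemma pseudo_metric_rho_toeplitz:
  assumes "0 < n" "0 < d" "X \<subseteq> UCP (toeplitz_sys d) n" shows "pseudo_metric_on X (rho_toeplitz d)"
proof -
  have "connes_ball d \<noteq> {}" using zero_connes_ball[OF assms(2)] by auto
  moreover have "x T \<in> carrier_mat n n" if "x \<in> X" "T \<in> connes_ball d" for x T
    using that UCP_D(4)[of x "toeplitz_sys d" n T] assms(3) by (auto simp: connes_ball_def)
  ultimately show ?thesis
    unfolding rho_toeplitz_eq using assms UCP_toeplitz_diff_le
    by (intro pseudo_metric_SUP[where n = n and B = "4 * sqrt (real d)"]) blast+
qed

lemma op_norm_le_rho_circle: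
  assumes "\<Phi> \<in> UCP circle_sys n" "\<Phi>' \<in> UCP circle_sys n" "f \<in> lip1" "0 < n"
  shows "op_norm (\<Phi> f - \<Phi>' f) \<le> rho_circle \<Phi> \<Phi>'"
  unfolding rho_circle_eq
  using assms UCP_circle_diff_le by (intro cSUP_upper bdd_aboveI2[of _ _ 8]) blast+

lemma op_norm_le_rho_toeplitz:
  assumes "\<phi> \<in> UCP (toeplitz_sys d) n" "\<phi>' \<in> UCP (toeplitz_sys d) n" "T \<in> connes_ball d" "0 < n" "0 < d"
  shows "op_norm (\<phi> T - \<phi>' T) \<le> rho_toeplitz d \<phi> \<phi>'" "rho_toeplitz d \<phi> \<phi>' \<le> 4 * sqrt (real d)"
proof -
  have le: "op_norm (\<phi> S - \<phi>' S) \<le> 4 * sqrt (real d)" if "S \<in> connes_ball d" for S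
    using UCP_toeplitz_diff_le[OF assms(1,2) that assms(4,5)] .
  show "op_norm (\<phi> T - \<phi>' T) \<le> rho_toeplitz d \<phi> \<phi>'"
    unfolding rho_toeplitz_eq using le assms(3) by (intro cSUP_upper bdd_aboveI2[of _ _ "4 * sqrt (real d)"])
  show "rho_toeplitz d \<phi> \<phi>' \<le> 4 * sqrt (real d)"
    unfolding rho_toeplitz_eq using le assms(3) by (intro cSUP_least) auto
qed

text \<open>In one direction, a matrix of the Connes ball is the compression of its symbol up to
  \<open>2 / sqrt d\<close>, and the symbol is in \<open>lip1\<close>. In the other, the compression
  of a function in \<open>lip1\<close> enters the ball after division by
  \<open>k = 1 + 32 / d\<close>.\<close>

lemma pull_near_isometry:
  assumes \<phi>: "\<phi> \<in> UCP (toeplitz_sys d) n" "\<phi>' \<in> UCP (toeplitz_sys d) n"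
    and d: "2 \<le> d" and N: "N = d ^ 4" and n: "0 < n"
  shows "\<bar>rho_toeplitz d \<phi> \<phi>' - rho_circle (pull d N \<phi>) (pull d N \<phi>')\<bar> \<le> 128 / sqrt (real d)"
proof -
  have d0: "0 < d" using d by simp
  have dN: "2 * d \<le> N"
  proof -
    have "2 * d \<le> d * d" using d by simp
    also have "\<dots> \<le> (d * d) * (d * d)" using d by simp
    finally show ?thesis by (simp add: N power_def numeral_eq_Suc)
  qed
  hence dN': "d \<le> N" by simp
  note pU = pull_UCP[OF \<phi>(1) d0 dN'] pull_UCP[OF \<phi>(2) d0 dN']
  have car: "\<phi> T \<in> carrier_mat n n" "\<phi>' T \<in> carrier_mat n n" if "T \<in> toeplitz_mats d" for T
    using UCP_D(4)[OF \<phi>(1)] UCP_D(4)[OF \<phi>(2)] that by auto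
  have fbd: "form_bound n (\<lambda>a b. A $$ (a, b) - B $$ (a, b)) (op_norm (A - B))"
    if "A \<in> carrier_mat n n" "B \<in> carrier_mat n n" for A B
    using op_norm_diff_le_iff[OF that n, of "op_norm (A - B)"] by simp
  have pull: "pull d N \<psi> f = \<psi> (compr d N f)" if "f \<in> lip1" for \<psi> f
    using lip1_in[OF that] by (simp add: pull_def)
  define s where "s = sqrt (real d)"
  have s: "0 < s" "s * s = real d" using d0 by (simp_all add: s_def)
  have upper: "rho_toeplitz d \<phi> \<phi>' \<le> rho_circle (pull d N \<phi>) (pull d N \<phi>') + 4 / s"
    unfolding rho_toeplitz_eq
  proof (rule cSUP_least)
    show "connes_ball d \<noteq> {}" using zero_connes_ball[OF d0] by auto
    fix T assume T: "T \<in> connes_ball d"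
    then obtain a where a: "T = toep d a" using toeplitz_matsE unfolding connes_ball_def by blast
    have fb: "form_bound d (\<lambda>p q. of_int (int p - int q) * a (int p - int q)) 1"
      using T connes_ball_iff[OF d0] by (simp add: a)
    define f where "f = symb d T"
    obtain b where b: "T = compr d N f + toep d b" "form_bound d (entries (toep d b)) (2 / s)"
      using compr_symb_bound[OF d0 dN fb] unfolding a f_def s_def by blast
    have f: "f \<in> lip1"
      unfolding f_def a
      by (rule symb_lip1[OF d0]) (rule form_bound_cong[OF _ fb], simp add: toep_index)
    have split: "\<psi> T $$ (i, j) = \<psi> (compr d N f) $$ (i, j) + \<psi> (toep d b) $$ (i, j)"
      if "\<psi> \<in> UCP (toeplitz_sys d) n" "i < n" "j < n" for \<psi> i j
    proof -
      note lin = UCP_D(2)[OF that(1)]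
      have "\<psi> T = \<psi> (compr d N f) + \<psi> (toep d b)"
        unfolding b(1) compr_def by (rule toeplitz_linearD(1)[OF lin])
      thus ?thesis using that(2,3) toeplitz_linearD(3)[OF lin, of b] by simp
    qed
    have 1: "form_bound n (\<lambda>i j. \<phi> (compr d N f) $$ (i, j) - \<phi>' (compr d N f) $$ (i, j)) (rho_circle (pull d N \<phi>) (pull d N \<phi>'))"
      using form_bound_mono[OF fbd op_norm_le_rho_circle[OF pU f n, unfolded pull[OF f]]] car by simp
    have 2: "form_bound n (\<lambda>i j. \<phi> (toep d b) $$ (i, j) - \<phi>' (toep d b) $$ (i, j)) (2 / s + 2 / s)"
      by (intro form_bound_diff toeplitz_UCP_form_bound[OF \<phi>(1)] toeplitz_UCP_form_bound[OF \<phi>(2)] b(2))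
    have "form_bound n (\<lambda>i j. \<phi> T $$ (i, j) - \<phi>' T $$ (i, j)) (rho_circle (pull d N \<phi>) (pull d N \<phi>') + (2 / s + 2 / s))"
      by (rule form_bound_cong[OF _ form_bound_add[OF 1 2]]) (simp add: split[OF \<phi>(1)] split[OF \<phi>(2)])
    moreover have "T \<in> toeplitz_mats d" by (simp add: a)
    ultimately show "op_norm (\<phi> T - \<phi>' T) \<le> rho_circle (pull d N \<phi>) (pull d N \<phi>') + 4 / s"
      using op_norm_diff_le_iff[OF car n] by simp
  qed
  define k where "k = 1 + 32 / real d"
  have k: "1 \<le> k" using d0 by (simp add: k_def)
  have lower: "rho_circle (pull d N \<phi>) (pull d N \<phi>') \<le> k * rho_toeplitz d \<phi> \<phi>'"
    unfolding rho_circle_eq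
  proof (rule cSUP_least)
    show "lip1 \<noteq> {}" using zero_lip1 by auto
    fix f assume f: "f \<in> lip1"
    have "8 * pi * real d ^ 3 / real N = 8 * pi / real d"
      using d0 by (simp add: N power_def numeral_eq_Suc)
    also have "\<dots> \<le> 32 / real d" using pi_less_4 by (intro divide_right_mono) auto
    finally have "form_bound d (\<lambda>p q. of_int (int p - int q) * rcoef N f (int p - int q)) k"
      by (intro form_bound_mono[OF form_bound_commutator_compr[OF f d0 dN']]) (simp add: k_def)
    from form_bound_scale[OF this, of "of_real (1 / k)"]
    have "form_bound d (\<lambda>p q. of_int (int p - int q) * (of_real (1 / k) * rcoef N f (int p - int q))) 1"
      using k by (simp add: norm_divide mult_ac)
    moreover define S where "S = toep d (\<lambda>l. of_real (1 / k) * rcoef N f l)"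
    ultimately have ball: "S \<in> connes_ball d" by (simp add: connes_ball_iff[OF d0])
    have ent: "\<psi> (compr d N f) $$ (i, j) = of_real k * \<psi> S $$ (i, j)"
      if "\<psi> \<in> UCP (toeplitz_sys d) n" "i < n" "j < n" for \<psi> i j
    proof -
      note lin = UCP_D(2)[OF that(1)]
      have "compr d N f = of_real k \<cdot>\<^sub>m S"
        unfolding compr_def S_def toep_smult by (rule toep_cong) (use k in simp)
      hence "\<psi> (compr d N f) = of_real k \<cdot>\<^sub>m \<psi> S" using toeplitz_linearD(2)[OF lin] by (simp add: S_def)
      moreover have "\<psi> S \<in> carrier_mat n n" unfolding S_def by (rule toeplitz_linearD(3)[OF lin])
      ultimately show ?thesis using that(2,3) by simp
    qed
    have "form_bound n (\<lambda>i j. \<phi> S $$ (i, j) - \<phi>' S $$ (i, j)) (rho_toeplitz d \<phi> \<phi>')"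
      using form_bound_mono[OF fbd op_norm_le_rho_toeplitz(1)[OF \<phi> ball n d0]] car ball by (simp add: connes_ball_def)
    from form_bound_scale[OF this, of "of_real k"]
    have "form_bound n (\<lambda>i j. of_real k * (\<phi> S $$ (i, j) - \<phi>' S $$ (i, j))) (k * rho_toeplitz d \<phi> \<phi>')"
      using k by simp
    hence "form_bound n (\<lambda>i j. \<phi> (compr d N f) $$ (i, j) - \<phi>' (compr d N f) $$ (i, j)) (k * rho_toeplitz d \<phi> \<phi>')"
      by (rule form_bound_cong[rotated]) (simp add: ent[OF \<phi>(1)] ent[OF \<phi>(2)] right_diff_distrib)
    thus "op_norm (pull d N \<phi> f - pull d N \<phi>' f) \<le> k * rho_toeplitz d \<phi> \<phi>'"
      unfolding pull[OF f] using op_norm_diff_le_iff[OF car n] by simp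
  qed
  \<comment> \<open>The a priori bound on the distance makes the relative error absolute:
    \<open>32 / d * (4 * sqrt d) = 128 / sqrt d\<close>.\<close>
  have "rho_toeplitz d \<phi> \<phi>' \<le> 4 * s"
    unfolding s_def by (rule op_norm_le_rho_toeplitz(2)[OF \<phi> zero_connes_ball[OF d0] n d0])
  hence "32 / real d * rho_toeplitz d \<phi> \<phi>' \<le> 32 / real d * (4 * s)" by (intro mult_left_mono) auto
  also have "\<dots> = 128 / s" using s(1) unfolding s(2)[symmetric] by simp
  finally have "rho_circle (pull d N \<phi>) (pull d N \<phi>') \<le> rho_toeplitz d \<phi> \<phi>' + 128 / s"
    using lower by (simp add: k_def distrib_right)
  moreover have "4 / s \<le> 128 / s" using s(1) by (intro divide_right_mono) auto
  ultimately show ?thesis using upper unfolding s_def[symmetric] abs_le_iff by linarith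
qed

lemma GH_dist_bound:
  assumes n: "2 \<le> n" and M: "0 < M" and d: "2 * (M * n) + 2 \<le> d" "32 \<le> d"
  shows "GH_dist (PureUCP (toeplitz_sys d) n) (rho_toeplitz d) (UCP circle_sys n) rho_circle
    \<le> ennreal (2 * (128 / sqrt (real d) + approx_error n M d))"
proof (rule GH_dist_le[where \<alpha> = "pull d (d ^ 4)"])
  have n0: "0 < n" and d0: "0 < d" using n d by auto
  have sub: "PureUCP (toeplitz_sys d) n \<subseteq> UCP (toeplitz_sys d) n" by (auto simp: PureUCP_def)
  have dN: "d \<le> d ^ 4" using d self_le_power[of d 4] by simp
  have err: "0 \<le> approx_error n M d" unfolding approx_error_def by simp
  show "pseudo_metric_on (PureUCP (toeplitz_sys d) n) (rho_toeplitz d)"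
    by (rule pseudo_metric_rho_toeplitz[OF n0 d0 sub])
  show "pseudo_metric_on (UCP circle_sys n) rho_circle" by (rule pseudo_metric_rho_circle[OF n0])
  show "0 \<le> 128 / sqrt (real d) + approx_error n M d" using err by simp
  show "pull d (d ^ 4) x \<in> UCP circle_sys n" if "x \<in> PureUCP (toeplitz_sys d) n" for x
    using pull_UCP[OF _ d0 dN] that sub by blast
  show "\<bar>rho_toeplitz d x x' - rho_circle (pull d (d ^ 4) x) (pull d (d ^ 4) x')\<bar> \<le> 128 / sqrt (real d) + approx_error n M d"
    if "x \<in> PureUCP (toeplitz_sys d) n" "x' \<in> PureUCP (toeplitz_sys d) n" for x x'
    using pull_near_isometry[OF subsetD[OF sub that(1)] subsetD[OF sub that(2)] _ refl n0] d err by simp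
  fix y assume y: "y \<in> UCP circle_sys n"
  obtain x where x: "x \<in> PureUCP (toeplitz_sys d) n"
    "\<And>f. f \<in> lip1 \<Longrightarrow> form_bound n (\<lambda>a b. y f $$ (a, b) - x (compr d (d ^ 4) f) $$ (a, b)) (approx_error n M d)"
    using pure_approx[OF n y M d refl] by blast
  have "rho_circle (pull d (d ^ 4) x) y \<le> approx_error n M d"
    unfolding rho_circle_eq
  proof (rule cSUP_least)
    show "lip1 \<noteq> {}" using zero_lip1 by auto
    fix f assume f: "f \<in> lip1"
    have car: "x (compr d (d ^ 4) f) \<in> carrier_mat n n" "y f \<in> carrier_mat n n"
      using UCP_D(4)[OF subsetD[OF sub x(1)]] UCP_D(4)[OF y] lip1_in[OF f] by auto
    show "op_norm (pull d (d ^ 4) x f - y f) \<le> approx_error n M d"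
      using form_bound_uminus[OF x(2)[OF f]] lip1_in[OF f] op_norm_diff_le_iff[OF car n0]
      by (simp add: pull_def)
  qed
  thus "\<exists>x\<in>PureUCP (toeplitz_sys d) n. rho_circle (pull d (d ^ 4) x) y \<le> 128 / sqrt (real d) + approx_error n M d"
    using x(1) by (intro bexI[of _ x]) (auto intro: add_increasing)
qed

lemma approx_error_tendsto:
  "((\<lambda>d. 128 / sqrt (real d) + approx_error n M d) \<longlongrightarrow> 4 / sqrt (real M) + real n * (2 * pi * (1 / real M))) sequentially"
proof -
  have s: "(\<lambda>d. k / sqrt (real d)) \<longlonglongrightarrow> 0" for k
    by (intro tendsto_divide_0[OF tendsto_const] filterlim_at_top_imp_at_infinity
        filterlim_compose[OF sqrt_at_top filterlim_real_sequentially])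
  have r: "(\<lambda>d. k / real d) \<longlonglongrightarrow> 0" for k
    by (rule lim_const_over_n)
  have "(\<lambda>d. 128 / sqrt (real d) + approx_error n M d) \<longlonglongrightarrow>
     0 + (4 / sqrt (real M) + real n * (0 + 0 + 2 * pi * (0 + 1 / real M)))"
    unfolding approx_error_def by (intro tendsto_intros s r)
  thus ?thesis by simp
qed

theorem theorem3:
  fixes n :: nat
  assumes "n \<ge> 2"
  shows "(\<lambda>d. GH_dist (PureUCP (toeplitz_sys d) n) (rho_toeplitz d)
                      (UCP circle_sys n) rho_circle) \<longlonglongrightarrow> 0"
proof (rule order_tendstoI)
  fix a :: ennreal assume "0 < a"
  then obtain c where c: "0 < c" "c < a" using dense by blast
  then obtain \<epsilon> where \<epsilon>: "c = ennreal \<epsilon>" "0 < \<epsilon>" using c by (cases c) auto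
  \<comment> \<open>\<open>M\<close> is chosen first, for the part of the error that survives as
    \<open>d\<close> grows; \<open>\<epsilon> / 2\<close> absorbs the factor 2 in
    \<open>GH_dist_bound\<close>.\<close>
  have "(\<lambda>M. 4 / sqrt (real M) + real n * (2 * pi * (1 / real M))) \<longlonglongrightarrow> 0 + real n * (2 * pi * 0)"
    by (intro tendsto_intros lim_1_over_n tendsto_divide_0[OF tendsto_const] filterlim_at_top_imp_at_infinity
        filterlim_compose[OF sqrt_at_top filterlim_real_sequentially])
  hence "eventually (\<lambda>M. 4 / sqrt (real M) + real n * (2 * pi * (1 / real M)) < \<epsilon> / 2) sequentially"
    using \<epsilon>(2) by (intro order_tendstoD(2)) auto
  from eventually_conj[OF this eventually_gt_at_top[of 0]]
  obtain M where M: "4 / sqrt (real M) + real n * (2 * pi * (1 / real M)) < \<epsilon> / 2" "0 < M"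
    using eventually_happens'[OF sequentially_bot] by blast
  have "eventually (\<lambda>d. 128 / sqrt (real d) + approx_error n M d < \<epsilon> / 2) sequentially"
    by (rule order_tendstoD(2)[OF approx_error_tendsto M(1)])
  thus "eventually (\<lambda>d. GH_dist (PureUCP (toeplitz_sys d) n) (rho_toeplitz d) (UCP circle_sys n) rho_circle < a) sequentially"
    using eventually_ge_at_top[of "2 * (M * n) + 2"] eventually_ge_at_top[of 32]
  proof eventually_elim
    case (elim d)
    have "GH_dist (PureUCP (toeplitz_sys d) n) (rho_toeplitz d) (UCP circle_sys n) rho_circle
        \<le> ennreal (2 * (128 / sqrt (real d) + approx_error n M d))"
      by (rule GH_dist_bound[OF assms M(2) elim(2,3)])
    also have "\<dots> \<le> c" unfolding \<epsilon>(1) using elim(1) by (intro ennreal_leI) simp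
    finally show ?case using c(2) by (rule le_less_trans)
  qed
qed simp

end
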